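(* Let $R$ be a Lie conformal superalgebra of type $(r,s)$ satisfying conditions (1)–(4) of the context, let $\mathfrak g=\mathfrak g(R)$, and let $F$ be a finite-dimensional $\mathfrak g_0$-module with (homogeneous) basis $\{v_1,\dots,v_\ell\}$. Let $\{d_1,\dots,d_n\}$ be a basis of $\mathfrak g_{-1}\oplus\mathfrak g_{-3}$, $\Omega=\{1,\dots,n\}$, $d_\Omega=d_1\cdots d_n$, and let $\{(d_Iv_h)^*\}$ be the basis of the free $\bigwedge[\boldsymbol\partial]$-module $M(F)^*$ dual to the $\bigwedge[\boldsymbol\partial]$-basis $\{d_Iv_h: I\subseteq\Omega,\ 1\le h\le \ell\}$ of $M(F)$. Then the subspace $$F_\Omega=\mathrm{span}_{\mathbb F}\{(d_\Omega v_k)^*\mid k=1,\dots,\ell\}\subset M(F)^*$$ is a $\mathfrak g_0$-submodule, and it is isomorphic to the $\chi$-shifted dual of $F$, where the character $\chi$ of $\mathfrak g_0$ is $$\chi_x=\mathrm{str}\big(\mathrm{ad}(x)|_{\mathfrak g_{<0}}\big),\qquad x\in\mathfrak g_0 .$$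
   Context: Conventions. $\mathbb F$ is an algebraically closed field of characteristic $0$; $r,s\ge0$ are integers. In every set of variables $\lambda_1,\dots,\lambda_{r+s}$, $\mu_i$, $\partial_i$, $y_i$, those with index $\le r$ are even ($p_i=0$), those with index $>r$ are odd ($p_i=1$); bold letters denote the whole set. $\bigwedge[\boldsymbol\lambda]=\mathbb F[\lambda_1,\dots,\lambda_r]\otimes\bigwedge(\lambda_{r+1},\dots,\lambda_{r+s})$, similarly for the other sets; $\bigwedge[[\boldsymbol y]]$ is the completion (power series). $p(\cdot)$ is parity; the Koszul sign rule is used throughout, e.g. $a\lambda_i=(-1)^{p_ip(a)}\lambda_ia$. A Lie conformal superalgebra of type $(r,s)$ is a $\mathbb Z/2$-graded $\bigwedge[\boldsymbol\partial]$-bimodule $R$ with $a\partial_i=(-1)^{p_ip(a)}\partial_ia$ and a $\mathbb Z/2$-graded linear $\boldsymbol\lambda$-bracket $R\otimes R\to\bigwedge[\boldsymbol\lambda]\otimes R$ with $[(\partial_ia)_{\boldsymbol\lambda}b]=-\lambda_i[a_{\boldsymbol\lambda}b]$, $[a_{\boldsymbol\lambda}(b\partial_i)]=[a_{\boldsymbol\lambda}b](\partial_i+\lambda_i)$, $[b_{\boldsymbol\lambda}a]=-(-1)^{p(a)p(b)}[a_{-\boldsymbol\lambda-\boldsymbol\partial}b]$, $[a_{\boldsymbol\lambda}[b_{\boldsymbol\mu}c]]=[[a_{\boldsymbol\lambda}b]_{\boldsymbol\lambda+\boldsymbol\mu}c]+(-1)^{p(a)p(b)}[b_{\boldsymbol\mu}[a_{\boldsymbol\lambda}c]]$.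 For a finite sequence $K=(k_1,\dots,k_t)$ in $\{1,\dots,r+s\}$: $\ell(K)=t$, $\lambda_K=\lambda_{k_1}\cdots\lambda_{k_t}$ (similarly $y_K$, $(\partial_{\boldsymbol y})_K$), $p_K=\sum p_{k_j}$, $f(K)=\prod_i m_i(K)!$ with $m_i(K)$ the multiplicity of $i$, $\bar K$ the reversed sequence; $S_{r,s}$ is a set of representatives of sequences up to permutation. The products $(a_Kb)$ are determined by $(a_Kb)=0$ if $\lambda_K=0$, $\lambda_J(a_Jb)=\lambda_K(a_Kb)$ if $J$ is a permutation of $K$, and $[a_{\boldsymbol\lambda}b]=\sum_{K\in S_{r,s}}\frac{\lambda_K}{f(K)}(a_Kb)$. Annihilation algebra: $\mathcal A(R)=\tilde R/\sum_i(\partial_i+\partial_{y_i})\tilde R$, $\tilde R=R\otimes\bigwedge[[\boldsymbol y]]$, with (continuous) bracket $[y_Ma,by_N]=\sum_{J\in S_{r,s}}\frac1{f(J)}(y_M(\partial_{\boldsymbol y})_J)(a_Jb)y_N$, where derivatives act on $y_M$ from the right: $y_M\partial_{y_i}=(-1)^{p_ip_M}\partial_{y_i}(y_M)$. $R$ is $\mathbb Z$-graded if $\bigwedge[\boldsymbol\lambda]\otimes R=\bigoplus_{d\in\mathbb Z}(\bigwedge[\boldsymbol\lambda]\otimes R)_d$ with $\deg(\lambda_ia)=\deg(\partial_ia)=\deg a-2$ and $\deg[a_{\boldsymbol\lambda}b]=\deg a+\deg b$; then $\mathcal A(R)$ is $\mathbb Z$-graded by $\deg(ay_M)=\deg a+2\ell(M)$.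 Conditions: (1) $R$ is $\mathbb Z$-graded; (2) the induced gradation of $\mathcal A(R)$ has depth at most $3$; (3) $\mathcal A(R)_{-1}$ and $\mathcal A(R)_{-3}$ are purely odd (and finite-dimensional); (4) $\mathrm{ad}:\mathcal A(R)_{-2}\to\mathrm{der}(\mathcal A(R))$ is injective with image $D=\langle\partial_{y_1},\dots,\partial_{y_{r+s}}\rangle$, of which $\partial_{y_1},\dots,\partial_{y_{r+s}}$ is a basis. $\mathfrak g(R)=(D\ltimes\mathcal A(R))/\{x-\mathrm{ad}(x):x\in\mathcal A(R)_{-2}\}\cong\mathcal A(R)$, a $\mathbb Z$-graded Lie superalgebra, with $\mathfrak g(R)_{-2}$ identified with $D$; $\mathfrak g_{<0}=\bigoplus_{j<0}\mathfrak g_j$. A conformal $R$-module is a $\mathbb Z/2$-graded $\bigwedge[\boldsymbol\partial]$-module $M$ with a $\mathbb Z/2$-graded linear map $R\otimes M\to\bigwedge[\boldsymbol\lambda]\otimes M$, $a\otimes v\mapsto a_{\boldsymbol\lambda}v$, with $(\partial_ia)_{\boldsymbol\lambda}v=[\partial_i,a_{\boldsymbol\lambda}]v=-\lambda_ia_{\boldsymbol\lambda}v$ and $a_{\boldsymbol\lambda}(b_{\boldsymbol\mu}v)-(-1)^{p(a)p(b)}b_{\boldsymbol\mu}(a_{\boldsymbol\lambda}v)=[a_{\boldsymbol\lambda}b]_{\boldsymbol\lambda+\boldsymbol\mu}v$. Conformal $R$-modules are identified with continuous $D\ltimes\mathcal A(R)$-modules via $a_{\boldsymbol\lambda}v=\sum_{K\in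 S_{r,s}}(-1)^{p_K}\frac{\lambda_{\bar K}}{f(K)}(y_Ka).v$ and $\partial_iv=-\partial_{y_i}.v$. Coherent ones (all $x-\mathrm{ad}(x)$, $x\in\mathcal A(R)_{-2}$, act by $0$) are the continuous $\mathfrak g(R)$-modules. The conformal dual $M^*$ of $M$ is the space of ($\mathbb Z/2$-graded) linear maps $f_{\boldsymbol\lambda}:M\to\bigwedge[\boldsymbol\lambda]$ with $f_{\boldsymbol\lambda}(\partial_im)=(-1)^{p_ip(f)}\lambda_if_{\boldsymbol\lambda}(m)$, with $(\partial_if)_{\boldsymbol\lambda}(m)=-\lambda_if_{\boldsymbol\lambda}(m)$ and $(a_{\boldsymbol\lambda}f)_{\boldsymbol\mu}m=-(-1)^{p(a)p(f)}f_{\boldsymbol\mu-\boldsymbol\lambda}(a_{\boldsymbol\lambda}m)$. The dual of a coherent module which is finitely generated over $\bigwedge[\boldsymbol\partial]$ is coherent, so it is again a $\mathfrak g(R)$-module. $M(F)=\mathrm{Ind}_{\mathfrak g_{\ge0}}^{\mathfrak g}F$, where $\mathfrak g_{>0}$ acts trivially on $F$. For $I=\{i_1<\dots<i_k\}\subseteq\Omega$, $d_I=d_{i_1}\cdots d_{i_k}\in U(\mathfrak g)$; the $d_Iv_h$ form a basis of $M(F)$ over $\bigwedge[\boldsymbol\partial]$, and the dual basis is defined by $((d_Iv_h)^* )_{\boldsymbol\lambda}(d_Jv_k)=\delta_{IJ}\delta_{hk}$. For a character $\chi$ of a Lie superalgebra $\mathfrak a$ and an $\mathfrak a$-module $V$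 with basis $v_h$, the $\chi$-shifted dual of $V$ is $V^*$ with action $x.v_h^*=\chi_xv_h^*-(-1)^{p(x)p(v_h)}\sum_kv_h^*(x.v_k)v_k^*$. Isomorphisms of modules over a Lie superalgebra are bijective homogeneous linear maps $T$, possibly odd, with $T(xm)=(-1)^{p(x)p(T)}xT(m)$. $\mathrm{str}$ is the supertrace. *)

theory Defs
  imports
    "HOL-Computational_Algebra.Polynomial"
    "HOL-Library.Z2"
    "HOL-Library.Function_Algebras"
    "HOL-Library.Product_Lexorder"
begin

text \<open>
  Parities are elements of the field \<^typ>\<open>bit\<close>. All vector spaces live on a type of class
  \<^class>\<open>ab_group_add\<close> and carry their scalar multiplication explicitly; spaces of functions are
  added and scaled pointwise.
\<close>

definition ksgn :: "bit \<Rightarrow> 'k::comm_ring_1" where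
  "ksgn b = (if b = 1 then - 1 else 1)"

definition fsc :: "('k \<Rightarrow> 'v \<Rightarrow> 'v) \<Rightarrow> 'k \<Rightarrow> ('x \<Rightarrow> 'v) \<Rightarrow> 'x \<Rightarrow> 'v" where
  "fsc sc c f = (\<lambda>x. sc c (f x))"

definition lin_on :: "'v set \<Rightarrow> ('k \<Rightarrow> 'v \<Rightarrow> 'v) \<Rightarrow> ('k \<Rightarrow> 'w \<Rightarrow> 'w) \<Rightarrow>
    ('v::ab_group_add \<Rightarrow> 'w::ab_group_add) \<Rightarrow> bool" where
  "lin_on V s1 s2 f \<longleftrightarrow> (\<forall>x\<in>V. \<forall>y\<in>V. f (x + y) = f x + f y) \<and> (\<forall>c. \<forall>x\<in>V. f (s1 c x) = s2 c (f x))"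

definition finite_dim :: "('k::field \<Rightarrow> 'v::ab_group_add \<Rightarrow> 'v) \<Rightarrow> 'v set \<Rightarrow> bool" where
  "finite_dim sc V \<longleftrightarrow> (\<exists>B. finite B \<and> module.span sc B = V)"

definition basis_of :: "('k::field \<Rightarrow> 'v::ab_group_add \<Rightarrow> 'v) \<Rightarrow> 'v set \<Rightarrow> nat \<Rightarrow> (nat \<Rightarrow> 'v) \<Rightarrow> bool" where
  "basis_of sc V n b \<longleftrightarrow> inj_on b {1..n} \<and> \<not> module.dependent sc (b ` {1..n}) \<and>
     module.span sc (b ` {1..n}) = V"

definition direct_sum :: "('k::field \<Rightarrow> 'v::ab_group_add \<Rightarrow> 'v) \<Rightarrow> 'v set \<Rightarrow> ('i \<Rightarrow> 'v set) \<Rightarrow> bool" where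
  "direct_sum sc V W \<longleftrightarrow> (\<forall>i. module.subspace sc (W i)) \<and> V = module.span sc (\<Union>i. W i) \<and>
     (\<forall>c. (\<forall>i. c i \<in> W i) \<and> finite {i. c i \<noteq> 0} \<and> (\<Sum>i | c i \<noteq> 0. c i) = 0 \<longrightarrow> (\<forall>i. c i = 0))"

record ('k, 'v) superspace =
  car :: "'v set"
  scl :: "'k \<Rightarrow> 'v \<Rightarrow> 'v"
  par :: "bit \<Rightarrow> 'v set"

definition super_space :: "('k::field, 'v::ab_group_add, 'z) superspace_scheme \<Rightarrow> bool" where
  "super_space V \<longleftrightarrow> vector_space (scl V) \<and> direct_sum (scl V) (car V) (par V)"

definition hcomp :: "('k, 'v::ab_group_add, 'z) superspace_scheme \<Rightarrow> bit \<Rightarrow> 'v \<Rightarrow> 'v" where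
  "hcomp V p x = (THE y. y \<in> par V p \<and> x - y \<in> par V (p + 1))"

text \<open>Supertrace of \<open>T\<close> on a finite-dimensional graded subspace \<open>W\<close> of \<open>V\<close>, computed in some
  homogeneous basis.\<close>
definition supertrace :: "('k::field, 'v::ab_group_add, 'z) superspace_scheme \<Rightarrow> 'v set \<Rightarrow> ('v \<Rightarrow> 'v) \<Rightarrow> 'k" where
  "supertrace V W T =
     (let B = (SOME B. finite B \<and> B \<subseteq> par V 0 \<union> par V 1 \<and> \<not> module.dependent (scl V) B \<and>
                 module.span (scl V) B = W)
      in \<Sum>b\<in>B. (if b \<in> par V 1 then - 1 else 1) * module.representation (scl V) B (T b) b)"

text \<open>\<open>deg L j\<close> is the homogeneous component of degree \<open>j\<close>. As the algebras below contain infinite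
  sums of homogeneous elements of increasing degree, the part of degree at least \<open>j\<close>, written
  \<open>fil L j\<close>, is recorded separately.\<close>
record ('k, 'v) lie_super = "('k, 'v) superspace" +
  brk :: "'v \<Rightarrow> 'v \<Rightarrow> 'v"
  deg :: "int \<Rightarrow> 'v set"
  fil :: "int \<Rightarrow> 'v set"

definition lie_superalgebra :: "('k::field, 'v::ab_group_add) lie_super \<Rightarrow> bool" where
  "lie_superalgebra L \<longleftrightarrow> super_space L \<and> car L = UNIV \<and>
     (\<forall>x. Vector_Spaces.linear (scl L) (scl L) (brk L x)) \<and>
     (\<forall>y. Vector_Spaces.linear (scl L) (scl L) (\<lambda>x. brk L x y)) \<and>
     (\<forall>p q. \<forall>x\<in>par L p. \<forall>y\<in>par L q.
        brk L x y \<in> par L (p + q) \<and>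
        brk L y x = - scl L (ksgn (p * q)) (brk L x y) \<and>
        (\<forall>z. brk L x (brk L y z) = brk L (brk L x y) z + scl L (ksgn (p * q)) (brk L y (brk L x z))))"

record ('k, 'v, 'g) lie_mod = "('k, 'v) superspace" +
  act :: "'g \<Rightarrow> 'v \<Rightarrow> 'v"

text \<open>\<open>N\<close> is a module over the subalgebra \<open>S\<close> of \<open>L\<close>; values of \<open>act N\<close> outside \<open>S\<close> are irrelevant.\<close>
definition lie_module ::
  "('k::field, 'g::ab_group_add) lie_super \<Rightarrow> 'g set \<Rightarrow> ('k, 'v::ab_group_add, 'g) lie_mod \<Rightarrow> bool" where
  "lie_module L S N \<longleftrightarrow> super_space N \<and>
     (\<forall>x\<in>S. act N x ` car N \<subseteq> car N \<and> lin_on (car N) (scl N) (scl N) (act N x)) \<and>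
     (\<forall>v\<in>car N. lin_on S (scl L) (scl N) (\<lambda>x. act N x v)) \<and>
     (\<forall>p q. \<forall>x\<in>S \<inter> par L p. \<forall>v\<in>par N q. act N x v \<in> par N (p + q)) \<and>
     (\<forall>p q. \<forall>x\<in>S \<inter> par L p. \<forall>y\<in>S \<inter> par L q. \<forall>v\<in>car N.
        act N (brk L x y) v = act N x (act N y v) - scl N (ksgn (p * q)) (act N y (act N x v)))"

definition lie_submodule ::
  "'g set \<Rightarrow> ('k::field, 'v::ab_group_add, 'g) lie_mod \<Rightarrow> 'v set \<Rightarrow> bool" where
  "lie_submodule S N W \<longleftrightarrow> module.subspace (scl N) W \<and> W \<subseteq> car N \<and>
     W = module.span (scl N) (\<Union>q. W \<inter> par N q) \<and> (\<forall>x\<in>S. act N x ` W \<subseteq> W)"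

definition sub_mod :: "('k, 'v, 'g) lie_mod \<Rightarrow> 'v set \<Rightarrow> ('k, 'v, 'g) lie_mod" where
  "sub_mod N W = N\<lparr>car := W, par := (\<lambda>q. par N q \<inter> W)\<rparr>"

definition lie_isomorphic :: "('k::field, 'g::ab_group_add) lie_super \<Rightarrow> 'g set \<Rightarrow>
    ('k, 'v::ab_group_add, 'g) lie_mod \<Rightarrow> ('k, 'w::ab_group_add, 'g) lie_mod \<Rightarrow> bool" where
  "lie_isomorphic L S N N' \<longleftrightarrow> (\<exists>t T. lin_on (car N) (scl N) (scl N') T \<and> bij_betw T (car N) (car N') \<and>
     (\<forall>q. T ` par N q \<subseteq> par N' (q + t)) \<and>
     (\<forall>p. \<forall>x\<in>S \<inter> par L p. \<forall>m\<in>car N. T (act N x m) = scl N' (ksgn (p * t)) (act N' x (T m))))"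

definition character :: "('k::field, 'g::ab_group_add) lie_super \<Rightarrow> 'g set \<Rightarrow> ('g \<Rightarrow> 'k) \<Rightarrow> bool" where
  "character L S \<chi> \<longleftrightarrow> lin_on S (scl L) (*) \<chi> \<and> (\<forall>x\<in>S \<inter> par L 1. \<chi> x = 0) \<and>
     (\<forall>x\<in>S. \<forall>y\<in>S. \<chi> (brk L x y) = 0)"

text \<open>Value at \<open>w\<close> of the basis element dual to \<open>v h\<close>.\<close>
definition coord :: "('k::field, 'f::ab_group_add, 'z) superspace_scheme \<Rightarrow> nat \<Rightarrow> (nat \<Rightarrow> 'f) \<Rightarrow> nat \<Rightarrow> 'f \<Rightarrow> 'k" where
  "coord F l v h w = module.representation (scl F) (v ` {1..l}) w (v h)"

text \<open>The \<open>\<chi>\<close>-shifted dual of the module \<open>F\<close> with basis \<open>v 1, \<dots>, v l\<close> of parities \<open>pv 1, \<dots>, pv l\<close>.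
  The defining formula is for homogeneous \<open>x\<close> and basis elements of the dual.\<close>
definition shifted_dual :: "('k::field, 'g::ab_group_add) lie_super \<Rightarrow> ('g \<Rightarrow> 'k) \<Rightarrow>
    ('k, 'f::ab_group_add, 'g) lie_mod \<Rightarrow> nat \<Rightarrow> (nat \<Rightarrow> 'f) \<Rightarrow> (nat \<Rightarrow> bit) \<Rightarrow> ('k, 'f \<Rightarrow> 'k, 'g) lie_mod" where
  "shifted_dual L \<chi> F l v pv =
     (let A = (\<lambda>p x h. fsc (*) (\<chi> x) (coord F l v h) - fsc (*) (ksgn (p * pv h))
                 (\<Sum>k\<in>{1..l}. fsc (*) (coord F l v h (act F x (v k))) (coord F l v k)))
      in \<lparr>car = {\<phi>. Vector_Spaces.linear (scl F) (*) \<phi>},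
          scl = fsc (*),
          par = (\<lambda>q. {\<phi>. Vector_Spaces.linear (scl F) (*) \<phi> \<and> (\<forall>w\<in>par F (q + 1). \<phi> w = 0)}),
          act = (\<lambda>x \<phi>. \<Sum>h\<in>{1..l}. fsc (*) (\<phi> (v h)) (A 0 (hcomp L 0 x) h + A 1 (hcomp L 1 x) h))\<rparr>)"

text \<open>Words \<open>(xs, v)\<close> stand for \<open>xs\<^sub>1 \<cdots> xs\<^sub>m \<otimes> v\<close>. The quotient of the free vector space on
  all words by the span of the following relations is \<open>U(L) \<otimes>\<^bsub>U(H)\<^esub> F\<close>.\<close>
definition word :: "'w \<Rightarrow> 'w \<Rightarrow> 'k::comm_ring_1" where
  "word w = (\<lambda>u. if u = w then 1 else 0)"

definition ind_rels :: "('k::field, 'g::ab_group_add) lie_super \<Rightarrow> 'g set \<Rightarrow> ('k, 'f::ab_group_add, 'g) lie_mod \<Rightarrow>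
    ('g list \<times> 'f \<Rightarrow> 'k) set" where
  "ind_rels L H F =
     {word (xs @ (x + y) # ys, v) - word (xs @ x # ys, v) - word (xs @ y # ys, v) | xs x y ys v. True} \<union>
     {word (xs @ scl L c x # ys, v) - fsc (*) c (word (xs @ x # ys, v)) | xs c x ys v. True} \<union>
     {word (xs, v + w) - word (xs, v) - word (xs, w) | xs v w. True} \<union>
     {word (xs, scl F c v) - fsc (*) c (word (xs, v)) | xs c v. True} \<union>
     {word (xs @ x # y # ys, v) - fsc (*) (ksgn (p * q)) (word (xs @ y # x # ys, v)) -
        word (xs @ brk L x y # ys, v) | xs x y ys v p q. x \<in> par L p \<and> y \<in> par L q} \<union>
     {word (xs @ [x], v) - word (xs, act F x v) | xs x v. x \<in> H}"

text \<open>\<open>(M, \<iota>)\<close> is (a realization of) the module induced from the \<open>H\<close>-module \<open>F\<close>: the canonical map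
  from words to \<open>M\<close> is onto, with kernel spanned by the relations above.\<close>
definition induced_module :: "('k::field, 'g::ab_group_add) lie_super \<Rightarrow> 'g set \<Rightarrow>
    ('k, 'f::ab_group_add, 'g) lie_mod \<Rightarrow> ('k, 'm::ab_group_add, 'g) lie_mod \<Rightarrow> ('f \<Rightarrow> 'm) \<Rightarrow> bool" where
  "induced_module L H F M \<iota> \<longleftrightarrow> lie_module L UNIV M \<and> car M = UNIV \<and>
     Vector_Spaces.linear (scl F) (scl M) \<iota> \<and> (\<forall>q. \<iota> ` par F q \<subseteq> par M q) \<and>
     (let ev = (\<lambda>u. \<Sum>w | u w \<noteq> 0. scl M (u w) (foldr (act M) (fst w) (\<iota> (snd w))))
      in (\<forall>m. \<exists>u. finite {w. u w \<noteq> 0} \<and> ev u = m) \<and>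
         (\<forall>u. finite {w. u w \<noteq> 0} \<longrightarrow>
            (ev u = 0 \<longleftrightarrow> u \<in> module.span (fsc (*)) (ind_rels L H F))))"

definition vpar :: "nat \<Rightarrow> nat \<Rightarrow> bit" where
  "vpar r i = (if i \<le> r then 0 else 1)"

definition lpar :: "('i \<Rightarrow> bit) \<Rightarrow> 'i list \<Rightarrow> bit" where
  "lpar p K = sum_list (map p K)"

text \<open>The scalar \<open>\<epsilon>\<close> with \<open>x\<^sub>K = \<epsilon> x\<^bsub>sort K\<^esub>\<close>.\<close>
definition ssgn :: "('i::linorder \<Rightarrow> bit) \<Rightarrow> 'i list \<Rightarrow> 'k::comm_ring_1" where
  "ssgn p K = (if distinct (filter (\<lambda>i. p i = 1) K)
     then (- 1) ^ card {(a, b). a < b \<and> b < length K \<and> K ! b < K ! a \<and> p (K ! a) = 1 \<and> p (K ! b) = 1}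
     else 0)"

text \<open>The nondecreasing sequences \<open>K\<close> with \<open>\<lambda>\<^sub>K \<noteq> 0\<close>. They serve as \<open>S\<^bsub>r,s\<^esub>\<close> (representatives with
  \<open>\<lambda>\<^sub>K = 0\<close> never contribute) and index the monomial basis: an element
  \<open>\<Sum>\<^sub>K \<lambda>\<^sub>K c\<^sub>K\<close> of \<open>\<And>[\<lambda>] \<otimes> V\<close>, or a power series, is the function \<open>K \<mapsto> c\<^sub>K\<close>, which is \<open>0\<close> outside
  \<open>Std r s\<close>. The variables are always written to the left of the coefficients.\<close>
definition Std :: "nat \<Rightarrow> nat \<Rightarrow> nat list set" where
  "Std r s = {K. sorted K \<and> set K \<subseteq> {1..r + s} \<and> distinct (filter (\<lambda>i. vpar r i = 1) K)}"

definition fK :: "nat list \<Rightarrow> 'k::{semiring_char_0,comm_semiring_1}" where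
  "fK K = (\<Prod>i\<in>set K. fact (count_list K i))"

text \<open>The element \<open>x\<^sub>K v\<close>, for an arbitrary sequence \<open>K\<close>.\<close>
definition mon :: "('k::comm_ring_1 \<Rightarrow> 'v::ab_group_add \<Rightarrow> 'v) \<Rightarrow> ('i::linorder \<Rightarrow> bit) \<Rightarrow> 'i list \<Rightarrow> 'v \<Rightarrow> 'i list \<Rightarrow> 'v" where
  "mon sc p K v = (\<lambda>L. if L = sort K then sc (ssgn p K) v else 0)"

text \<open>\<open>\<Sum>\<^sub>K T K c\<^sub>K\<close> for the polynomial \<open>\<Sum>\<^sub>K \<lambda>\<^sub>K c\<^sub>K\<close>.\<close>
definition psum :: "('i list \<Rightarrow> 'v::zero) \<Rightarrow> ('i list \<Rightarrow> 'v \<Rightarrow> 'w::comm_monoid_add) \<Rightarrow> 'w" where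
  "psum P T = (\<Sum>K | P K \<noteq> 0. T K (P K))"

text \<open>Left multiplication of a polynomial by \<open>x\<^sub>i\<close>.\<close>
definition pmul :: "('k::comm_ring_1 \<Rightarrow> 'v::ab_group_add \<Rightarrow> 'v) \<Rightarrow> ('i::linorder \<Rightarrow> bit) \<Rightarrow> 'i \<Rightarrow> ('i list \<Rightarrow> 'v) \<Rightarrow> 'i list \<Rightarrow> 'v" where
  "pmul sc p i P = psum P (\<lambda>K. mon sc p (i # K))"

text \<open>For two sets of variables, \<open>(False, i)\<close> is \<open>\<lambda>\<^sub>i\<close> and \<open>(True, i)\<close> is \<open>\<mu>\<^sub>i\<close>, ordered
  lexicographically.\<close>
abbreviation lam_word :: "nat list \<Rightarrow> (bool \<times> nat) list" where
  "lam_word K \<equiv> map (Pair False) K"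

abbreviation mu_word :: "nat list \<Rightarrow> (bool \<times> nat) list" where
  "mu_word K \<equiv> map (Pair True) K"

definition vpar2 :: "nat \<Rightarrow> bool \<times> nat \<Rightarrow> bit" where
  "vpar2 r x = vpar r (snd x)"

text \<open>The action of \<open>\<partial>\<^sub>i\<close> from the left on \<open>\<And>[\<lambda>] \<otimes> R\<close>, or on \<open>R \<otimes> \<And>[[y]]\<close>, where \<open>D = \<partial>\<^sub>i\<close> on \<open>R\<close>.\<close>
definition pder :: "('k::comm_ring_1 \<Rightarrow> 'v \<Rightarrow> 'v) \<Rightarrow> nat \<Rightarrow> nat \<Rightarrow> ('v \<Rightarrow> 'v) \<Rightarrow> (nat list \<Rightarrow> 'v) \<Rightarrow> nat list \<Rightarrow> 'v" where
  "pder sc r i D P = (\<lambda>K. sc (ksgn (vpar r i * lpar (vpar r) K)) (D (P K)))"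

text \<open>\<open>der R i\<close> is the left action of \<open>\<partial>\<^sub>i\<close>; the right one is \<open>a \<partial>\<^sub>i = (-1)\<^bsup>p\<^sub>i p(a)\<^esup> \<partial>\<^sub>i a\<close>.
  The polynomial \<open>[a\<^sub>\<lambda> b]\<close> is \<open>lbr R a b\<close>.\<close>
record ('k, 'a) lie_conf = "('k, 'a) superspace" +
  der :: "nat \<Rightarrow> 'a \<Rightarrow> 'a"
  lbr :: "'a \<Rightarrow> 'a \<Rightarrow> nat list \<Rightarrow> 'a"

definition lambda_jacobi :: "nat \<Rightarrow> ('k::field, 'a::ab_group_add) lie_conf \<Rightarrow> bit \<Rightarrow> bit \<Rightarrow> 'a \<Rightarrow> 'a \<Rightarrow> 'a \<Rightarrow> bool" where
  "lambda_jacobi r R p q a b c \<longleftrightarrow>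
     (let sc = scl R; br = lbr R; par2 = vpar2 r; mul = pmul sc par2;
          lm = foldr mul \<circ> lam_word; mm = foldr mul \<circ> mu_word
      in psum (br b c) (\<lambda>N u. fsc sc (ksgn (p * lpar (vpar r) N))
           (mm N (psum (br a u) (\<lambda>K. mon sc par2 (lam_word K)))))
       = psum (br a b) (\<lambda>K u. lm K (psum (br u c) (\<lambda>N w.
           foldr (\<lambda>i P. mul (False, i) P + mul (True, i) P) N (mon sc par2 [] w))))
       + fsc sc (ksgn (p * q)) (psum (br a c) (\<lambda>N u. fsc sc (ksgn (q * lpar (vpar r) N))
           (lm N (psum (br b u) (\<lambda>K. mon sc par2 (mu_word K)))))))"

definition lie_conformal_superalgebra :: "nat \<Rightarrow> nat \<Rightarrow> ('k::field, 'a::ab_group_add) lie_conf \<Rightarrow> bool" where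
  "lie_conformal_superalgebra r s R \<longleftrightarrow>
     (let sc = scl R; D = der R; br = lbr R; vp = vpar r; X = {1..r + s} in
      super_space R \<and> car R = UNIV \<and>
      (\<forall>i\<in>X. Vector_Spaces.linear sc sc (D i) \<and> (\<forall>q. D i ` par R q \<subseteq> par R (vp i + q))) \<and>
      (\<forall>i\<in>X. \<forall>j\<in>X. \<forall>a. D i (D j a) = sc (ksgn (vp i * vp j)) (D j (D i a))) \<and>
      (\<forall>a b. finite {K. br a b K \<noteq> 0} \<and> {K. br a b K \<noteq> 0} \<subseteq> Std r s) \<and>
      (\<forall>a. Vector_Spaces.linear sc (fsc sc) (br a)) \<and>
      (\<forall>b. Vector_Spaces.linear sc (fsc sc) (\<lambda>a. br a b)) \<and>
      (\<forall>p q. \<forall>a\<in>par R p. \<forall>b\<in>par R q. \<forall>K. br a b K \<in> par R (p + q + lpar vp K)) \<and>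
      (\<forall>i\<in>X. \<forall>a b. br (D i a) b = - pmul sc vp i (br a b)) \<and>
      (\<forall>i\<in>X. \<forall>p q. \<forall>a\<in>par R p. \<forall>b\<in>par R q.
         br a (sc (ksgn (vp i * q)) (D i b)) =
           psum (br a b) (\<lambda>K c. fsc sc (ksgn (vp i * (p + q + lpar vp K)))
             (mon sc vp K (D i c) + mon sc vp (K @ [i]) c))) \<and>
      (\<forall>p q. \<forall>a\<in>par R p. \<forall>b\<in>par R q.
         br b a = - fsc sc (ksgn (p * q)) (psum (br a b) (\<lambda>K c.
           foldr (\<lambda>i P. - pmul sc vp i P - pder sc r i (D i) P) K (mon sc vp [] c)))) \<and>
      (\<forall>p q. \<forall>a\<in>par R p. \<forall>b\<in>par R q. \<forall>c. lambda_jacobi r R p q a b c))"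

text \<open>The product \<open>(a\<^sub>K b)\<close>, for \<open>K\<close> in \<open>Std r s\<close>.\<close>
definition kprod :: "('k::field_char_0, 'a::ab_group_add) lie_conf \<Rightarrow> nat list \<Rightarrow> 'a \<Rightarrow> 'a \<Rightarrow> 'a" where
  "kprod R K a b = scl R (fK K) (lbr R a b K)"

text \<open>A \<open>\<int>\<close>-gradation is given by its components \<open>gr d\<close> in \<open>R\<close>; the induced one on polynomials
  has \<open>\<lambda>\<^sub>K a\<close> in degree \<open>d - 2 \<ell>(K)\<close> for \<open>a\<close> in \<open>gr d\<close>. Components are sub-superspaces.\<close>
definition graded_conformal :: "nat \<Rightarrow> nat \<Rightarrow> ('k::field, 'a::ab_group_add) lie_conf \<Rightarrow> (int \<Rightarrow> 'a set) \<Rightarrow> bool" where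
  "graded_conformal r s R gr \<longleftrightarrow> direct_sum (scl R) UNIV gr \<and>
     (\<forall>d. gr d = module.span (scl R) (\<Union>q. gr d \<inter> par R q)) \<and>
     (\<forall>i\<in>{1..r + s}. \<forall>d. der R i ` gr d \<subseteq> gr (d - 2)) \<and>
     (\<forall>d e. \<forall>a\<in>gr d. \<forall>b\<in>gr e. \<forall>K. lbr R a b K \<in> gr (d + e + 2 * int (length K)))"

definition pow_ser :: "nat \<Rightarrow> nat \<Rightarrow> (nat list \<Rightarrow> 'k::zero) set" where
  "pow_ser r s = {g. \<forall>K. K \<notin> Std r s \<longrightarrow> g K = 0}"

text \<open>\<open>g a\<close> and \<open>b g\<close> for a power series \<open>g\<close>; in the second case \<open>q\<close> is the parity of \<open>b\<close>.\<close>
definition ser_l :: "('k \<Rightarrow> 'a \<Rightarrow> 'a) \<Rightarrow> (nat list \<Rightarrow> 'k) \<Rightarrow> 'a \<Rightarrow> nat list \<Rightarrow> 'a" where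
  "ser_l sc g a = (\<lambda>K. sc (g K) a)"

definition ser_r :: "('k::comm_ring_1 \<Rightarrow> 'a \<Rightarrow> 'a) \<Rightarrow> nat \<Rightarrow> bit \<Rightarrow> 'a \<Rightarrow> (nat list \<Rightarrow> 'k) \<Rightarrow> nat list \<Rightarrow> 'a" where
  "ser_r sc r q b g = (\<lambda>K. sc (ksgn (q * lpar (vpar r) K) * g K) b)"

text \<open>The algebraic tensor product \<open>R \<otimes> \<And>[[y]]\<close>, embedded in the families \<open>(c\<^sub>K)\<close> of elements of \<open>R\<close>.\<close>
definition Rtilde :: "nat \<Rightarrow> nat \<Rightarrow> ('k::field, 'a::ab_group_add) lie_conf \<Rightarrow> (nat list \<Rightarrow> 'a) set" where
  "Rtilde r s R = module.span (fsc (scl R)) {ser_l (scl R) g a | g a. g \<in> pow_ser r s}"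

text \<open>\<open>\<partial>\<close> with respect to \<open>y\<^sub>i\<close>: \<open>y\<^sub>i y\<^sub>L\<close>, which is \<open>\<plusminus>y\<^bsub>sort (i # L)\<^esub>\<close> or \<open>0\<close>, is sent to a
  multiple of \<open>y\<^sub>L\<close>.\<close>
definition dy :: "('k::comm_ring_1 \<Rightarrow> 'v::zero \<Rightarrow> 'v) \<Rightarrow> nat \<Rightarrow> nat \<Rightarrow> nat \<Rightarrow> (nat list \<Rightarrow> 'v) \<Rightarrow> nat list \<Rightarrow> 'v" where
  "dy sc r s i g = (\<lambda>L. if L \<in> Std r s
     then sc (ssgn (vpar r) (i # L) * of_nat (count_list L i + 1)) (g (sort (i # L))) else 0)"

text \<open>\<open>g \<partial>\<close> for \<open>\<partial>\<close> with respect to \<open>y\<^sub>i\<close>, that is \<open>y\<^sub>M \<mapsto> (-1)\<^bsup>p\<^sub>i p\<^sub>M\<^esup> \<partial>(y\<^sub>M)\<close>.\<close>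
definition dy_right :: "nat \<Rightarrow> nat \<Rightarrow> nat \<Rightarrow> (nat list \<Rightarrow> 'k::comm_ring_1) \<Rightarrow> nat list \<Rightarrow> 'k" where
  "dy_right r s i g = dy (*) r s i (\<lambda>M. ksgn (vpar r i * lpar (vpar r) M) * g M)"

text \<open>The product \<open>g c h\<close> of power series \<open>g\<close>, \<open>h\<close> and an element \<open>c\<close> of parity \<open>q\<close>.\<close>
definition ser_prod :: "('k::comm_ring_1 \<Rightarrow> 'a \<Rightarrow> 'a) \<Rightarrow> nat \<Rightarrow> nat \<Rightarrow> bit \<Rightarrow> (nat list \<Rightarrow> 'k) \<Rightarrow> 'a \<Rightarrow> (nat list \<Rightarrow> 'k) \<Rightarrow> nat list \<Rightarrow> 'a" where
  "ser_prod sc r s q g c h = (\<lambda>L. sc (\<Sum>(M, N) | M \<in> Std r s \<and> N \<in> Std r s \<and> sort (M @ N) = L.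
     ssgn (vpar r) (M @ N) * ksgn (q * lpar (vpar r) N) * g M * h N) c)"

text \<open>\<open>A\<close> is (a realization of) \<open>\<A>(R)\<close>, with \<open>\<pi>\<close> the projection from \<open>R \<otimes> \<And>[[y]]\<close>. The bracket
  is given on products \<open>g a\<close> and \<open>b h\<close> of power series with homogeneous elements, which is the
  continuous extension of the formula for monomials.\<close>
definition annihilation_algebra :: "nat \<Rightarrow> nat \<Rightarrow> ('k::field_char_0, 'a::ab_group_add) lie_conf \<Rightarrow> (int \<Rightarrow> 'a set) \<Rightarrow>
    ('k, 'b::ab_group_add) lie_super \<Rightarrow> ((nat list \<Rightarrow> 'a) \<Rightarrow> 'b) \<Rightarrow> bool" where
  "annihilation_algebra r s R gr A \<pi> \<longleftrightarrow>
     (let sc = scl R; vp = vpar r; Rt = Rtilde r s R in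
      lie_superalgebra A \<and>
      lin_on Rt (fsc sc) (scl A) \<pi> \<and> \<pi> ` Rt = UNIV \<and>
      {\<phi> \<in> Rt. \<pi> \<phi> = 0} =
        module.span (fsc sc) (\<Union>i\<in>{1..r + s}. (\<lambda>\<phi>. pder sc r i (der R i) \<phi> + dy sc r s i \<phi>) ` Rt) \<and>
      (\<forall>p. par A p = \<pi> ` {\<phi> \<in> Rt. \<forall>K. \<phi> K \<in> par R (p + lpar vp K)}) \<and>
      (\<forall>p q. \<forall>a\<in>par R p. \<forall>b\<in>par R q. \<forall>g\<in>pow_ser r s. \<forall>h\<in>pow_ser r s.
         brk A (\<pi> (ser_l sc g a)) (\<pi> (ser_r sc r q b h)) =
           \<pi> (\<Sum>J | kprod R J a b \<noteq> 0. fsc sc (1 / fK J)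
                (ser_prod sc r s (p + q + lpar vp J) (fold (dy_right r s) J g) (kprod R J a b) h))) \<and>
      (\<forall>j. deg A j = \<pi> ` module.span (fsc sc)
             {mon sc vp M a | M a. M \<in> Std r s \<and> a \<in> gr (j - 2 * int (length M))}) \<and>
      (\<forall>j. fil A j = \<pi> ` {\<phi> \<in> Rt. \<forall>M. \<phi> M \<in> module.span sc (\<Union>d\<in>{j - 2 * int (length M)..}. gr d)}))"

text \<open>The derivation of \<open>\<A>(R)\<close> induced by \<open>\<partial>\<close> with respect to \<open>y\<^sub>i\<close>.\<close>
definition dyA :: "nat \<Rightarrow> nat \<Rightarrow> ('k::field, 'a::ab_group_add) lie_conf \<Rightarrow> ((nat list \<Rightarrow> 'a) \<Rightarrow> 'b) \<Rightarrow> nat \<Rightarrow> 'b \<Rightarrow> 'b" where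
  "dyA r s R \<pi> i x = \<pi> (dy (scl R) r s i (inv_into (Rtilde r s R) \<pi> x))"

definition Dspace :: "nat \<Rightarrow> nat \<Rightarrow> ('k::field, 'a::ab_group_add) lie_conf \<Rightarrow> ('k, 'b::ab_group_add) lie_super \<Rightarrow>
    ((nat list \<Rightarrow> 'a) \<Rightarrow> 'b) \<Rightarrow> ('b \<Rightarrow> 'b) set" where
  "Dspace r s R A \<pi> = module.span (fsc (scl A)) (dyA r s R \<pi> ` {1..r + s})"

definition Dpar :: "nat \<Rightarrow> nat \<Rightarrow> ('k::field, 'a::ab_group_add) lie_conf \<Rightarrow> ('k, 'b::ab_group_add) lie_super \<Rightarrow>
    ((nat list \<Rightarrow> 'a) \<Rightarrow> 'b) \<Rightarrow> bit \<Rightarrow> ('b \<Rightarrow> 'b) set" where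
  "Dpar r s R A \<pi> p = module.span (fsc (scl A)) (dyA r s R \<pi> ` {i \<in> {1..r + s}. vpar r i = p})"

definition cond_depth :: "('k, 'b::ab_group_add) lie_super \<Rightarrow> bool" where
  "cond_depth A \<longleftrightarrow> (\<forall>j < - 3. deg A j = {0})"

definition cond_odd :: "('k::field, 'b::ab_group_add) lie_super \<Rightarrow> bool" where
  "cond_odd A \<longleftrightarrow> (\<forall>j\<in>{- 1, - 3}. deg A j \<subseteq> par A 1 \<and> finite_dim (scl A) (deg A j))"

definition cond_ad :: "nat \<Rightarrow> nat \<Rightarrow> ('k::field, 'a::ab_group_add) lie_conf \<Rightarrow> ('k, 'b::ab_group_add) lie_super \<Rightarrow>
    ((nat list \<Rightarrow> 'a) \<Rightarrow> 'b) \<Rightarrow> bool" where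
  "cond_ad r s R A \<pi> \<longleftrightarrow> inj_on (brk A) (deg A (- 2)) \<and> brk A ` deg A (- 2) = Dspace r s R A \<pi> \<and>
     basis_of (fsc (scl A)) (Dspace r s R A \<pi>) (r + s) (dyA r s R \<pi>)"

text \<open>\<open>G\<close> is (a realization of) \<open>\<g>(R)\<close>, with \<open>\<rho> \<delta> x\<close> the class of \<open>\<delta> + x\<close> for \<open>\<delta>\<close> in \<open>D\<close> and
  \<open>x\<close> in \<open>\<A>(R)\<close>.\<close>
definition g_algebra :: "nat \<Rightarrow> nat \<Rightarrow> ('k::field, 'a::ab_group_add) lie_conf \<Rightarrow> ('k, 'b::ab_group_add) lie_super \<Rightarrow>
    ((nat list \<Rightarrow> 'a) \<Rightarrow> 'b) \<Rightarrow> ('k, 'g::ab_group_add) lie_super \<Rightarrow> (('b \<Rightarrow> 'b) \<Rightarrow> 'b \<Rightarrow> 'g) \<Rightarrow> bool" where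
  "g_algebra r s R A \<pi> G \<rho> \<longleftrightarrow>
     (let D = Dspace r s R A \<pi>; Dp = Dpar r s R A \<pi> in
      lie_superalgebra G \<and>
      (\<forall>\<delta>\<in>D. \<forall>\<delta>'\<in>D. \<forall>x x'. \<rho> (\<delta> + \<delta>') (x + x') = \<rho> \<delta> x + \<rho> \<delta>' x') \<and>
      (\<forall>c. \<forall>\<delta>\<in>D. \<forall>x. \<rho> (fsc (scl A) c \<delta>) (scl A c x) = scl G c (\<rho> \<delta> x)) \<and>
      {\<rho> \<delta> x | \<delta> x. \<delta> \<in> D} = UNIV \<and>
      (\<forall>\<delta>\<in>D. \<forall>x. \<rho> \<delta> x = 0 \<longleftrightarrow> x \<in> deg A (- 2) \<and> \<delta> = - brk A x) \<and>
      (\<forall>p. par G p = {\<rho> \<delta> x | \<delta> x. \<delta> \<in> Dp p \<and> x \<in> par A p}) \<and>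
      (\<forall>p q. \<forall>\<delta>\<in>Dp p. \<forall>x\<in>par A p. \<forall>\<delta>'\<in>Dp q. \<forall>x'\<in>par A q.
         brk G (\<rho> \<delta> x) (\<rho> \<delta>' x') =
           \<rho> (\<delta> \<circ> \<delta>' - fsc (scl A) (ksgn (p * q)) (\<delta>' \<circ> \<delta>))
             (brk A x x' + \<delta> x' - scl A (ksgn (p * q)) (\<delta>' x))) \<and>
      (\<forall>j. deg G j = \<rho> 0 ` deg A j) \<and> (\<forall>j. fil G j = \<rho> 0 ` fil A j))"

definition neg_part :: "('k::field, 'g::ab_group_add) lie_super \<Rightarrow> 'g set" where
  "neg_part G = module.span (scl G) (\<Union>j\<in>{..< 0}. deg G j)"

text \<open>Below, \<open>cl \<phi>\<close> is the class in \<open>\<g>(R)\<close> of an element of \<open>R \<otimes> \<And>[[y]]\<close> and \<open>dd i\<close> that of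
  \<open>\<partial>\<close> with respect to \<open>y\<^sub>i\<close>.\<close>

definition y_el :: "nat \<Rightarrow> ('k::field, 'a::ab_group_add) lie_conf \<Rightarrow> ((nat list \<Rightarrow> 'a) \<Rightarrow> 'g) \<Rightarrow> nat list \<Rightarrow> 'a \<Rightarrow> 'g" where
  "y_el r R cl K a = cl (mon (scl R) (vpar r) K a)"

text \<open>The scalar \<open>(-1)\<^bsup>p\<^sub>K\<^esup> \<epsilon> / f(K)\<close>, where \<open>\<epsilon> \<lambda>\<^sub>K\<close> is the monomial of the reversed sequence.\<close>
definition conf_coeff :: "nat \<Rightarrow> nat list \<Rightarrow> 'k::field_char_0" where
  "conf_coeff r K = ksgn (lpar (vpar r) K) * ssgn (vpar r) (rev K) / fK K"

text \<open>The conformal module of a module over \<open>\<g>(R)\<close>: the polynomial \<open>a\<^sub>\<lambda> v\<close> and the action of \<open>\<partial>\<^sub>i\<close>.\<close>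
definition lam_act :: "nat \<Rightarrow> nat \<Rightarrow> ('k::field_char_0, 'a::ab_group_add) lie_conf \<Rightarrow> ((nat list \<Rightarrow> 'a) \<Rightarrow> 'g) \<Rightarrow>
    ('k, 'm::ab_group_add, 'g) lie_mod \<Rightarrow> 'a \<Rightarrow> 'm \<Rightarrow> nat list \<Rightarrow> 'm" where
  "lam_act r s R cl M a v = (\<lambda>K. if K \<in> Std r s
     then scl M (conf_coeff r K) (act M (y_el r R cl K a) v) else 0)"

definition del_act :: "(nat \<Rightarrow> 'g) \<Rightarrow> ('k, 'm::ab_group_add, 'g) lie_mod \<Rightarrow> nat \<Rightarrow> 'm \<Rightarrow> 'm" where
  "del_act dd M i v = - act M (dd i) v"

text \<open>The elements of parity \<open>q\<close> of the conformal dual of \<open>M\<close>.\<close>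
definition conf_dual :: "nat \<Rightarrow> nat \<Rightarrow> (nat \<Rightarrow> 'g) \<Rightarrow> ('k::field, 'm::ab_group_add, 'g) lie_mod \<Rightarrow> bit \<Rightarrow>
    ('m \<Rightarrow> nat list \<Rightarrow> 'k) set" where
  "conf_dual r s dd M q = {f. Vector_Spaces.linear (scl M) (fsc (*)) f \<and>
     (\<forall>m. finite {K. f m K \<noteq> 0} \<and> {K. f m K \<noteq> 0} \<subseteq> Std r s) \<and>
     (\<forall>p. \<forall>m\<in>par M p. \<forall>K. f m K \<noteq> 0 \<longrightarrow> lpar (vpar r) K = p + q) \<and>
     (\<forall>i\<in>{1..r + s}. \<forall>m. f (del_act dd M i m) =
        fsc (*) (ksgn (vpar r i * q)) (pmul (*) (vpar r) i (f m)))}"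

text \<open>The polynomial \<open>(a\<^sub>\<lambda> f)\<^sub>\<mu> m = -(-1)\<^bsup>p(a)p(f)\<^esup> f\<^bsub>\<mu>-\<lambda>\<^esub>(a\<^sub>\<lambda> m)\<close> in \<open>\<lambda>\<close> and \<open>\<mu>\<close>, for \<open>a\<close>, \<open>f\<close> of
  parities \<open>p\<close>, \<open>q\<close>.\<close>
definition dual_lam :: "nat \<Rightarrow> nat \<Rightarrow> ('k::field_char_0, 'a::ab_group_add) lie_conf \<Rightarrow> ((nat list \<Rightarrow> 'a) \<Rightarrow> 'g) \<Rightarrow>
    ('k, 'm::ab_group_add, 'g) lie_mod \<Rightarrow> bit \<Rightarrow> bit \<Rightarrow> 'a \<Rightarrow> ('m \<Rightarrow> nat list \<Rightarrow> 'k) \<Rightarrow> 'm \<Rightarrow> (bool \<times> nat) list \<Rightarrow> 'k" where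
  "dual_lam r s R cl M p q a f m =
     (let par2 = vpar2 r; mul = pmul (*) par2;
          sub = (\<lambda>P. psum P (\<lambda>L c. foldr (\<lambda>i Q. mul (True, i) Q - mul (False, i) Q) L (mon (*) par2 [] c)))
      in - fsc (*) (ksgn (p * q)) (psum (lam_act r s R cl M a m) (\<lambda>N u.
           fsc (*) (ksgn (lpar (vpar r) N * q)) (foldr mul (lam_word N) (sub (f u))))))"

definition dual_mod :: "nat \<Rightarrow> nat \<Rightarrow> (nat \<Rightarrow> 'g) \<Rightarrow> ('k::field, 'm::ab_group_add, 'g) lie_mod \<Rightarrow>
    ('g \<Rightarrow> ('m \<Rightarrow> nat list \<Rightarrow> 'k) \<Rightarrow> 'm \<Rightarrow> nat list \<Rightarrow> 'k) \<Rightarrow> ('k, 'm \<Rightarrow> nat list \<Rightarrow> 'k, 'g) lie_mod" where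
  "dual_mod r s dd M \<sigma> =
     \<lparr>car = module.span (fsc (fsc (*))) (\<Union>q. conf_dual r s dd M q),
      scl = fsc (fsc (*)), par = conf_dual r s dd M, act = \<sigma>\<rparr>"

text \<open>\<open>\<sigma>\<close> is the action of \<open>\<g>(R)\<close> that turns the conformal dual of \<open>M\<close> into a continuous
  \<open>\<g>(R)\<close>-module: the monomial \<open>\<lambda>\<^sub>K \<mu>\<^sub>L\<close> is compared in
  \<open>a\<^sub>\<lambda> f = \<Sum>\<^sub>K conf_coeff K \<lambda>\<^sub>K (y\<^sub>K a).f\<close>, evaluated at \<open>m\<close>, and \<open>\<partial>\<^sub>i f\<close> is \<open>m \<mapsto> -\<lambda>\<^sub>i f(m)\<close>.\<close>
definition dual_action :: "nat \<Rightarrow> nat \<Rightarrow> ('k::field_char_0, 'a::ab_group_add) lie_conf \<Rightarrow> ('k, 'g::ab_group_add) lie_super \<Rightarrow>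
    ((nat list \<Rightarrow> 'a) \<Rightarrow> 'g) \<Rightarrow> (nat \<Rightarrow> 'g) \<Rightarrow> ('k, 'm::ab_group_add, 'g) lie_mod \<Rightarrow>
    ('g \<Rightarrow> ('m \<Rightarrow> nat list \<Rightarrow> 'k) \<Rightarrow> 'm \<Rightarrow> nat list \<Rightarrow> 'k) \<Rightarrow> bool" where
  "dual_action r s R G cl dd M \<sigma> \<longleftrightarrow>
     lie_module G UNIV (dual_mod r s dd M \<sigma>) \<and>
     (\<forall>p q. \<forall>a\<in>par R p. \<forall>f\<in>conf_dual r s dd M q. \<forall>m. \<forall>K\<in>Std r s. \<forall>L\<in>Std r s.
        conf_coeff r K * \<sigma> (y_el r R cl K a) f m L =
          dual_lam r s R cl M p q a f m (lam_word K @ mu_word L)) \<and>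
     (\<forall>i\<in>{1..r + s}. \<forall>f\<in>car (dual_mod r s dd M \<sigma>). \<forall>m.
        - \<sigma> (dd i) f m = - pmul (*) (vpar r) i (f m)) \<and>
     (\<forall>a. \<forall>f\<in>car (dual_mod r s dd M \<sigma>). \<exists>N. \<forall>g\<in>pow_ser r s.
        (\<forall>K. length K < N \<longrightarrow> g K = 0) \<longrightarrow> \<sigma> (cl (ser_l (scl R) g a)) f = 0)"

text \<open>\<open>d\<^sub>I v\<^sub>h\<close>, where \<open>\<iota>\<close> embeds \<open>F\<close> in \<open>M\<close>.\<close>
definition dI :: "('k, 'm, 'g) lie_mod \<Rightarrow> ('f \<Rightarrow> 'm) \<Rightarrow> (nat \<Rightarrow> 'g) \<Rightarrow> (nat \<Rightarrow> 'f) \<Rightarrow> nat set \<Rightarrow> nat \<Rightarrow> 'm" where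
  "dI M \<iota> d v I h = foldr (\<lambda>i. act M (d i)) (sorted_list_of_set I) (\<iota> (v h))"

text \<open>\<open>e I h\<close>, for \<open>I \<subseteq> {1..n}\<close> and \<open>h\<close> in \<open>{1..l}\<close>, is the basis of the conformal dual dual to
  \<open>d\<^sub>I v\<^sub>h\<close>.\<close>
definition dual_basis :: "nat \<Rightarrow> nat \<Rightarrow> (nat \<Rightarrow> 'g) \<Rightarrow> ('k::field, 'm::ab_group_add, 'g) lie_mod \<Rightarrow> ('f \<Rightarrow> 'm) \<Rightarrow>
    nat \<Rightarrow> (nat \<Rightarrow> 'g) \<Rightarrow> nat \<Rightarrow> (nat \<Rightarrow> 'f) \<Rightarrow> (nat set \<Rightarrow> nat \<Rightarrow> 'm \<Rightarrow> nat list \<Rightarrow> 'k) \<Rightarrow> bool" where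
  "dual_basis r s dd M \<iota> n d l v e \<longleftrightarrow> (\<forall>I h. I \<subseteq> {1..n} \<and> h \<in> {1..l} \<longrightarrow>
     e I h \<in> module.span (fsc (fsc (*))) (\<Union>q. conf_dual r s dd M q) \<and>
     (\<forall>J k. J \<subseteq> {1..n} \<and> k \<in> {1..l} \<longrightarrow>
        e I h (dI M \<iota> d v J k) = mon (*) (vpar r) [] (if I = J \<and> h = k then 1 else 0)))"

end

theory Submission
  imports Defs
begin

text \<open>
  Let \<open>f\<close> be the basis element dual to \<open>d\<^sub>\<Omega> v\<^sub>h\<close> and \<open>x = y\<^sub>K a\<close> of degree 0. As \<open>y\<^sub>N a\<close> has degree
  \<open>2 \<ell>(N) - 2 \<ell>(K)\<close> and the depth is at most 3, the coefficient of \<open>\<lambda>\<^sub>K\<close> in \<open>f\<^bsub>\<mu>-\<lambda>\<^esub>(a\<^sub>\<lambda> m)\<close> involves only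
  \<open>f(x m)\<close> and the \<open>f((y\<^sub>N a) m)\<close> where \<open>N\<close> is \<open>K\<close> with one variable \<open>i\<close> deleted. In the latter case \<open>y\<^sub>N a\<close>
  is a multiple of \<open>[\<partial>\<^sub>i, x]\<close> and acts on \<open>M\<close> as a combination of derivatives, so if \<open>f(m)\<close> is constant
  these terms add up to the supertrace of \<open>ad x\<close> on \<open>\<g>\<^sub>-\<^sub>2\<close>, which is spanned by the derivatives.
  The \<open>d\<^sub>i\<close> anticommute up to derivatives, and \<open>f\<close> vanishes on all words in fewer than \<open>n\<close> of them; hence
  \<open>f\<close> is alternating on words of length \<open>n\<close>, and \<open>f(x d\<^sub>\<Omega> v\<^sub>k)\<close> consists of the trace of \<open>ad x\<close> on
  \<open>\<g>\<^sub>-\<^sub>1 \<oplus> \<g>\<^sub>-\<^sub>3\<close> and the action on \<open>F\<close>. That space is odd, so with the sign of the dual action the trace is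
  again a supertrace. A functional is determined by its values on the \<open>d\<^sub>I v\<^sub>k\<close>.
\<close>

section \<open>Signs and monomials\<close>

text \<open>Two obstacles shape the argument. The algebra g(R) is a quotient whose elements may be
  infinite sums, and neither a basis nor a direct decomposition of it is given. Generation by
  \<open>fil G 0\<close> and the degrees -1, -2, -3 takes the place of a decomposition. Linear
  independence of the \<open>d i\<close> together with the derivatives, which is what allows the
  supertrace to be evaluated in a concrete basis, is read off from the action on M: the functional
  dual to d_i v_h detects the coefficient of \<open>d i\<close>. This needs some h in {1..l}, an
  assumption that runs through the last lemmas. The character property mentions no h and also has to
  hold for l = 0, so it uses an arbitrary basis extracted from a spanning set. The action on the
  dual is prescribed only through the coefficients of \<lambda>_K \<mu>_L, for homogeneous
  functionals and elements \<open>y K a\<close>. Identities are therefore proved for these and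
  extended by linearity, and the sum over all N is cut off because elements of large degree
  annihilate a given vector of M.\<close>

lemma bit_eq_1_iff: "(b::bit) \<noteq> 0 \<longleftrightarrow> b = 1" by (cases b) auto
lemma ksgn_0 [simp]: "ksgn 0 = 1" by (simp add: ksgn_def)
lemma ksgn_1 [simp]: "ksgn 1 = -1" by (simp add: ksgn_def)
lemma ksgn_add: "ksgn (a + b) = ksgn a * ksgn b"
  by (cases a; cases b) (auto simp: ksgn_def)
lemma ksgn_mult_self [simp]: "ksgn a * ksgn a = 1" by (auto simp: ksgn_def)
lemma ksgn_neq_0 [simp]: "ksgn a \<noteq> (0::'k::{comm_ring_1})" by (auto simp: ksgn_def)

section \<open>Parities, inversions and the sign of sorting a word\<close>

lemma lpar_simps [simp]: "lpar p [] = 0" "lpar p (i # K) = p i + lpar p K" "lpar p (K @ L) = lpar p K + lpar p L"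
  by (simp_all add: lpar_def)

lemma lpar_mset: "mset K = mset L \<Longrightarrow> lpar p K = lpar p L"
  unfolding lpar_def by (metis mset_map sum_mset_sum_list)
lemma lpar_sort [simp]: "lpar p (sort K) = lpar p K"
  by (rule lpar_mset) simp

text \<open>Exponent of the sign picked up when an odd letter is moved past the odd letters of
  \<open>K\<close> that satisfy \<open>P\<close>.\<close>

definition nodd :: "('i \<Rightarrow> bit) \<Rightarrow> ('i \<Rightarrow> bool) \<Rightarrow> 'i list \<Rightarrow> nat" where
  "nodd p P K = length (filter (\<lambda>j. p j = 1 \<and> P j) K)"

lemma nodd_simps [simp]: "nodd p P [] = 0"
  "nodd p P (i # K) = (if p i = 1 \<and> P i then 1 else 0) + nodd p P K"
  "nodd p P (K @ L) = nodd p P K + nodd p P L"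
  "nodd p P (rev K) = nodd p P K"
  by (simp_all add: nodd_def flip: rev_filter)

lemma nodd_mset: "mset K = mset L \<Longrightarrow> nodd p P K = nodd p P L"
  unfolding nodd_def by (metis mset_filter size_mset)
lemma nodd_sort [simp]: "nodd p P (sort K) = nodd p P K"
  by (rule nodd_mset) simp

definition inversions :: "('i::linorder \<Rightarrow> bit) \<Rightarrow> 'i list \<Rightarrow> (nat \<times> nat) set" where
  "inversions p K = {(a, b). a < b \<and> b < length K \<and> K ! b < K ! a \<and> p (K ! a) = 1 \<and> p (K ! b) = 1}"

lemma finite_inversions [simp]: "finite (inversions p K)"
  by (rule finite_subset[of _ "{..<length K} \<times> {..<length K}"]) (auto simp: inversions_def)

text \<open>An inversion either involves position 0, which for odd \<open>i\<close> gives the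
  smaller odd letters of \<open>K\<close>, or is a shifted inversion of \<open>K\<close>.\<close>

lemma card_inversions_Cons:
  "card (inversions p (i # K)) = (if p i = 1 then nodd p (\<lambda>j. j < i) K else 0) + card (inversions p K)"
proof -
  let ?S = "{b. b < length K \<and> p (K ! b) = 1 \<and> K ! b < i}"
  let ?A = "if p i = 1 then (\<lambda>b. (0::nat, Suc b)) ` ?S else {}"
  let ?B = "map_prod Suc Suc ` inversions p K"
  have eq: "inversions p (i # K) = ?A \<union> ?B"
  proof (intro equalityI subsetI)
    fix x assume "x \<in> inversions p (i # K)"
    then obtain a b where x: "x = (a, b)" and ab: "(a, b) \<in> inversions p (i # K)" by (cases x) auto
    from ab obtain b' where b: "b = Suc b'" by (cases b) (auto simp: inversions_def)
    show "x \<in> ?A \<union> ?B"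
      using ab unfolding x b by (cases a) (auto simp: inversions_def image_iff)
  qed (auto simp: inversions_def split: if_splits)
  have "finite ?A" "finite ?B" "?A \<inter> ?B = {}" by auto
  then have "card (?A \<union> ?B) = card ?A + card ?B"
    by (rule card_Un_disjoint)
  moreover have "card ?B = card (inversions p K)"
    by (rule card_image) (auto simp: inj_on_def)
  moreover have "card ((\<lambda>b. (0::nat, Suc b)) ` ?S) = card ?S"
    by (rule card_image) (auto simp: inj_on_def)
  moreover have "card ?S = nodd p (\<lambda>j. j < i) K"
    by (simp add: nodd_def length_filter_conv_card)
  ultimately show ?thesis unfolding eq by simp
qed

lemma ssgn_alt: "ssgn p K = (if distinct (filter (\<lambda>i. p i = 1) K) then (- 1) ^ card (inversions p K) else 0)"
  by (simp add: ssgn_def inversions_def)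

lemma ssgn_Nil [simp]: "ssgn p [] = 1"
  by (simp add: ssgn_alt inversions_def)

lemma ssgn_Cons: "ssgn p (i # K) =
    (if p i = 1 then if i \<in> set K then 0 else (- 1) ^ nodd p (\<lambda>j. j < i) K else 1) * ssgn p K"
  by (auto simp: ssgn_alt card_inversions_Cons power_add)

text \<open>Counterpart of \<open>ssgn_Cons\<close> for the last letter, used for the products
  \<open>N @ [i]\<close> in the dual action and for reversed words.\<close>

lemma ssgn_snoc: "ssgn p (K @ [i]) =
    (if p i = 1 then if i \<in> set K then 0 else (- 1) ^ nodd p (\<lambda>j. i < j) K else 1) * ssgn p K"
proof (induction K)
  case (Cons k K)
  show ?case
  proof (cases "p i = 1 \<and> p k = 1")
    case True
    then show ?thesis using Cons by (cases k i rule: linorder_cases) (auto simp: ssgn_Cons)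
  next
    case False
    then show ?thesis using Cons by (auto simp: ssgn_Cons)
  qed
qed (simp add: ssgn_Cons)

lemma ssgn_map: "(\<And>x y. f x < f y \<longleftrightarrow> x < y) \<Longrightarrow> (\<And>x. p (f x) = q x) \<Longrightarrow> inj f \<Longrightarrow> ssgn p (map f K) = ssgn q K"
proof (induction K)
  case (Cons k K)
  then show ?case by (auto simp: ssgn_Cons nodd_def filter_map o_def inj_def)
qed simp

lemma ssgn_sorted:
  assumes "sorted K" "distinct (filter (\<lambda>i. p i = 1) K)" shows "ssgn p K = 1"
  using assms
proof (induction K)
  case (Cons k K)
  have "nodd p (\<lambda>j. j < k) K = 0"
    using Cons.prems by (auto simp: nodd_def filter_empty_conv)
  then show ?case using Cons by (auto simp: ssgn_Cons split: if_splits)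
qed simp

lemma ssgn_eq_0_iff: "(ssgn p K :: 'k::idom) = 0 \<longleftrightarrow> \<not> distinct (filter (\<lambda>i. p i = 1) K)"
  by (simp add: ssgn_alt)

lemma distinct_filter_mset: "mset K = mset L \<Longrightarrow> distinct (filter P K) = distinct (filter P L)"
  by (metis mset_eq_imp_distinct_iff mset_filter)

text \<open>A tail with a repeated odd letter makes both sides vanish. Any other tail has sign 1
  once sorted, and the factor in \<open>ssgn_Cons\<close> depends only on the letters of the
  tail.\<close>

lemma ssgn_Cons_sort: "ssgn p (i # sort K) * ssgn p K = ssgn p (i # K)"
proof (cases "distinct (filter (\<lambda>i. p i = 1) K)")
  case True
  then have "ssgn p (sort K) = (1::'a)"
    by (intro ssgn_sorted) (auto simp: distinct_filter_mset[of "sort K" K])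
  then show ?thesis by (simp add: ssgn_Cons)
next
  case False
  then have "ssgn p K = (0::'a)" by (simp add: ssgn_alt)
  then show ?thesis by (simp add: ssgn_Cons)
qed

lemma sorted_sort_Cons [simp]: "sort (i # sort K) = sort (i # K)"
  by (simp add: sorted_sort_id)

lemma vpar2_simp [simp]: "vpar2 r (b, i) = vpar r i" by (simp add: vpar2_def)

section \<open>Standard monomials and their normalizing factors\<close>

lemma Std_sorted: "K \<in> Std r s \<Longrightarrow> sort K = K"
  by (simp add: Std_def sorted_sort_id)
lemma Std_ssgn [simp]: "K \<in> Std r s \<Longrightarrow> ssgn (vpar r) K = 1"
  by (simp add: Std_def ssgn_sorted)
lemma Nil_Std [simp]: "[] \<in> Std r s" by (simp add: Std_def)

lemma sort_Cons_Std: 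
  assumes "K \<in> Std r s" "i \<in> {1..r+s}"
  shows "sort (i # K) \<in> Std r s \<longleftrightarrow> \<not> (vpar r i = 1 \<and> i \<in> set K)"
proof -
  have "distinct (filter P (sort (i # K))) = distinct (filter P (i # K))" for P
    by (rule distinct_filter_mset) simp
  with assms show ?thesis by (auto simp: Std_def set_insort_key simp del: sort_key_simps(2))
qed

lemma remove1_Std: "K \<in> Std r s \<Longrightarrow> remove1 i K \<in> Std r s"
  using set_remove1_subset[of i K]
  by (auto simp: Std_def sorted_remove1 distinct_remove1 filter_remove1)

lemma sort_Cons_eq_iff:
  assumes "K \<in> Std r s" "N \<in> Std r s"
  shows "sort (i # N) = K \<longleftrightarrow> i \<in> set K \<and> N = remove1 i K"
proof
  assume "sort (i # N) = K"
  then show "i \<in> set K \<and> N = remove1 i K"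
    using assms by (metis remove1.simps(2) Std_sorted list.set_intros(1) set_sort sort_key_simps(2) remove1_insort_key)
next
  assume "i \<in> set K \<and> N = remove1 i K"
  then show "sort (i # N) = K"
    using assms by (simp add: Std_def sorted_sort_id insort_remove1)
qed

lemma finite_Std_le: "finite {K \<in> Std r s. length K \<le> B}"
  by (rule finite_subset[OF _ finite_lists_length_le[of "{1..r+s}" B]]) (auto simp: Std_def)

text \<open>This is m! = m (m-1)! for the multiplicity m of \<open>i\<close>, written through the
  shortened word because a derivative in y_i produces exactly this factor.\<close>

lemma fK_insert:
  assumes "i \<in> set K" 
  shows "(fK K :: 'k::field_char_0) = of_nat (count_list (remove1 i K) i + 1) * fK (remove1 i K)"
proof -
  let ?N = "remove1 i K"
  have cnt: "count_list ?N j = (if j = i then count_list K i - 1 else count_list K j)" for j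
    by (simp flip: count_mset)
  \<comment> \<open>If \<open>i\<close> occurs only once, it is missing from \<open>set ?N\<close>;
    the product over \<open>set K\<close> then has one extra factor, which is 0! = 1.\<close>
  have "count_list K i - Suc 0 = 0" if "i \<notin> set ?N"
    using that cnt[of i] by (simp add: count_list_0_iff del: count_list_remove1)
  note zero = this
  have pos: "count_list K i > 0" using assms
    by (metis count_list_0_iff gr0I)
  have "(fK K :: 'k) = fact (count_list K i) * (\<Prod>j\<in>set K - {i}. fact (count_list K j))"
    unfolding fK_def using assms by (simp add: prod.remove)
  also have "fact (count_list K i) = (of_nat (count_list ?N i + 1) * fact (count_list ?N i) :: 'k)"
    using pos by (simp add: cnt fact_reduce)
  also have "(\<Prod>j\<in>set K - {i}. fact (count_list K j)) = (\<Prod>j\<in>set K - {i}. fact (count_list ?N j) :: 'k)"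
    by (rule prod.cong) (auto simp: cnt)
  also have "of_nat (count_list ?N i + 1) * fact (count_list ?N i) * \<dots> =
      of_nat (count_list ?N i + 1) * (\<Prod>j\<in>set K. fact (count_list ?N j) :: 'k)"
    using assms by (simp add: prod.remove[of "set K" i])
  also have "(\<Prod>j\<in>set K. fact (count_list ?N j) :: 'k) = fK ?N"
    unfolding fK_def
    using set_remove1_subset[of i K] by (intro prod.mono_neutral_right) (auto simp: count_list_0_iff zero)
  finally show ?thesis .
qed

lemma fK_neq_0 [simp]: "(fK K :: 'k::field_char_0) \<noteq> 0"
  by (simp add: fK_def)

lemma conf_coeff_neq_0: "K \<in> Std r s \<Longrightarrow> (conf_coeff r K :: 'k::field_char_0) \<noteq> 0"
  by (simp add: conf_coeff_def ssgn_eq_0_iff Std_def distinct_rev flip: rev_filter)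

text \<open>Reversing a nondecreasing word without repeated odd letters inverts every pair of odd
  letters. The number of pairs is kept as a sum because one more odd letter then adds exactly one
  summand.\<close>

lemma ssgn_rev_Std:
  "sorted K \<Longrightarrow> distinct (filter (\<lambda>i. p i = 1) K) \<Longrightarrow> ssgn p (rev K) = (- 1) ^ (\<Sum>j<nodd p (\<lambda>_. True) K. j)"
proof (induction K)
  case (Cons k K)
  have "nodd p (\<lambda>j. k < j) K = nodd p (\<lambda>_. True) K" if "p k = 1"
    unfolding nodd_def using Cons.prems that
    by (intro arg_cong[where f = length] filter_cong) (auto simp: order.strict_iff_order)
  then show ?case using Cons by (auto simp: ssgn_snoc power_add split: if_splits)
qed simp

lemma neg_one_power_twice: "(- 1) ^ a * ((- 1) ^ a * x) = (x::'k::comm_ring_1)"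
  by (simp add: mult.assoc[symmetric] flip: power_add mult_2)

text \<open>The factor on the left comes from \<open>\<lambda>\<^sub>N \<lambda>\<^sub>i\<close> in the dual action, the one on the right from the
  derivative of \<open>y\<^sub>K\<close> in \<open>y\<^sub>i\<close>. The sign \<open>(-1)\<^bsup>p\<^sub>i\<^esup>\<close> is what makes a supertrace out of a trace.\<close>
lemma conf_coeff_remove1:
  assumes K: "K \<in> Std r s" and i: "i \<in> set K" and N: "N = remove1 i K"
  shows "ssgn (vpar r) (N @ [i]) * conf_coeff r N =
    ksgn (vpar r i) * ssgn (vpar r) (i # N) * of_nat (count_list N i + 1) * (conf_coeff r K :: 'k::field_char_0)"
proof -
  let ?p = "vpar r"
  have NS: "N \<in> Std r s" using K N by (simp add: remove1_Std)
  have KN: "mset K = mset (i # N)" using i N by simp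
  have m: "nodd ?p (\<lambda>_. True) K = (if ?p i = 1 then 1 else 0) + nodd ?p (\<lambda>_. True) N"
    using nodd_mset[OF KN, of ?p] by simp
  have lp: "lpar ?p K = ?p i + lpar ?p N" using lpar_mset[OF KN, of ?p] by simp
  have rN: "ssgn ?p (rev N) = ((- 1) ^ (\<Sum>j<nodd ?p (\<lambda>_. True) N. j) :: 'k)"
    and rK: "ssgn ?p (rev K) = ((- 1) ^ (\<Sum>j<nodd ?p (\<lambda>_. True) K. j) :: 'k)"
    using NS K by (auto simp: Std_def intro!: ssgn_rev_Std)
  have iN: "i \<notin> set N" if "?p i = 1"
  proof
    assume "i \<in> set N"
    then have "\<not> distinct (filter (\<lambda>i. ?p i = 1) (i # N))" using that by simp
    then show False using K distinct_filter_mset[OF KN] by (auto simp: Std_def)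
  qed
  \<comment> \<open>An odd \<open>i\<close> does not recur, so each odd letter of \<open>N\<close>
    lies on one side of it. Hence the signs of \<open>N @ [i]\<close> and \<open>i # N\<close>
    differ by (-1)^m, with m odd letters in \<open>N\<close>, which is also the ratio of the two
    reversal signs.\<close>
  have split: "nodd ?p (\<lambda>_. True) N = nodd ?p (\<lambda>j. j < i) N + nodd ?p (\<lambda>j. i < j) N" if "?p i = 1"
    using iN[OF that] by (induction N) auto
  have f: "(fK K :: 'k) = of_nat (count_list N i + 1) * fK N" using fK_insert[OF i] N by simp
  have f0: "of_nat (count_list N i + 1) \<noteq> (0::'k)" by (metis Suc_eq_plus1 of_nat_neq_0)
  show ?thesis
  proof (cases "?p i = 1")
    case True
    then show ?thesis using f0 
      unfolding conf_coeff_def rN rK m f lp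
      by (simp add: ssgn_snoc ssgn_Cons iN NS ksgn_add split power_add field_simps neg_one_power_twice del: of_nat_add of_nat_Suc)
  next
    case False
    then have "?p i = 0" by (simp add: bit_eq_1_iff vpar_def)
    then show ?thesis using f0 unfolding conf_coeff_def rN rK m f lp
      by (simp add: ssgn_snoc ssgn_Cons NS del: of_nat_add of_nat_Suc)
  qed
qed

section \<open>Polynomials in one and two sets of variables\<close>

lemma sum_fun_apply: "(\<Sum>x\<in>S. f x) y = (\<Sum>x\<in>S. f x y)"
  by (induction S rule: infinite_finite_induct) auto

lemma fsc_apply [simp]: "fsc sc c f x = sc c (f x)"
  by (simp add: fsc_def)

lemma vector_space_fsc: "vector_space sc \<Longrightarrow> vector_space (fsc sc)"
  by (simp add: vector_space_def fsc_def fun_eq_iff)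

lemma mon_0 [simp]: "mon (*) p K 0 = (0 :: 'i::linorder list \<Rightarrow> 'k::field)"
  by (auto simp: mon_def)

lemma mon_uminus: "mon (*) p K (- c) = - (mon (*) p K c :: 'i::linorder list \<Rightarrow> 'k::field)"
  by (auto simp: mon_def)

lemma psum_mono_neutral:
  assumes "finite S" "\<And>K. P K \<noteq> 0 \<Longrightarrow> K \<in> S" "\<And>K. K \<in> S \<Longrightarrow> T K 0 = 0"
  shows "psum P T = (\<Sum>K\<in>S. T K (P K))"
  unfolding psum_def using assms by (intro sum.mono_neutral_left) auto

lemma psum_mon:
  assumes "T (sort K) 0 = 0"
  shows "psum (mon (*) p K (c::'k::field)) T = T (sort K) (ssgn p K * c)"
  by (subst psum_mono_neutral[of "{sort K}"]) (auto simp: mon_def assms split: if_splits)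

lemma pmul_0 [simp]: "pmul (*) p i 0 = (0 :: 'i::linorder list \<Rightarrow> 'k::field)"
  by (simp add: pmul_def psum_def)

lemma pmul_mon: "pmul (*) p i (mon (*) p K (c::'k::field)) = mon (*) p (i # K) c"
proof -
  have "pmul (*) p i (mon (*) p K c) = mon (*) p (i # sort K) (ssgn p K * c)"
    by (simp add: pmul_def psum_mon)
  also have "\<dots> = mon (*) p (i # K) c"
    by (simp add: mon_def fun_eq_iff mult.assoc[symmetric] ssgn_Cons_sort sorted_sort_id)
  finally show ?thesis .
qed

lemma pmul_add:
  assumes "finite {K. P K \<noteq> (0::'k::field)}" "finite {K. Q K \<noteq> 0}"
  shows "pmul (*) p (i::'i::linorder) (P + Q) = pmul (*) p i P + pmul (*) p i Q"
proof -
  let ?S = "{K. P K \<noteq> 0} \<union> {K. Q K \<noteq> 0}"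
  have S: "psum R (\<lambda>K. mon (*) p (i # K)) = (\<Sum>K\<in>?S. mon (*) p (i # K) (R K))"
    if "\<And>K. R K \<noteq> 0 \<Longrightarrow> K \<in> ?S" for R :: "'i list \<Rightarrow> 'k"
    using assms that by (intro psum_mono_neutral) auto
  have "mon (*) p (i # K) (P K + Q K) = mon (*) p (i # K) (P K) + mon (*) p (i # K) (Q K)" for K
    by (auto simp: mon_def algebra_simps)
  then show ?thesis
    unfolding pmul_def by (subst (1 2 3) S) (auto simp: sum.distrib)
qed

lemma sum_mon_support:
  assumes "(\<Sum>x\<in>S. mon (*) p (u x) (c x)) K \<noteq> (0::'k::field)"
  shows "\<exists>x\<in>S. K = sort (u x)"
proof -
  have "(\<Sum>x\<in>S. mon (*) p (u x) (c x) K) \<noteq> 0"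
    using assms by (simp only: sum_fun_apply not_False_eq_True)
  then obtain x where "x \<in> S" "mon (*) p (u x) (c x) K \<noteq> 0"
    by (rule sum.not_neutral_contains_not_neutral)
  then show ?thesis by (auto simp: mon_def split: if_splits)
qed

lemma finite_support_sum_mon:
  assumes "finite S" shows "finite {K. (\<Sum>x\<in>S. mon (*) p (u x) (c x)) K \<noteq> (0::'k::field)}"
  by (rule finite_subset[of _ "(sort \<circ> u) ` S"]) (use assms sum_mon_support in fastforce)+

lemma pmul_sum_mon:
  assumes "finite S"
  shows "pmul (*) p i (\<Sum>x\<in>S. mon (*) p (u x) (c x)) = (\<Sum>x\<in>S. mon (*) p (i # u x) (c x :: 'k::field))"
  using assms
proof (induction S)
  case (insert x S)
  have "finite {K. mon (*) p (u x) (c x) K \<noteq> 0}"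
    using finite_support_sum_mon[of "{x}" p u c] by simp
  then show ?case using insert finite_support_sum_mon[OF insert(1), of p u c]
    by (simp only: sum.insert[OF insert(1,2)] pmul_add pmul_mon)
qed (simp only: sum.empty pmul_0)

lemma foldr_pmul_sum_mon:
  assumes "finite S"
  shows "foldr (pmul (*) p) w (\<Sum>x\<in>S. mon (*) p (u x) (c x)) = (\<Sum>x\<in>S. mon (*) p (w @ u x) (c x :: 'k::field))"
  by (induction w) (simp_all add: pmul_sum_mon[OF assms])

lemma foldr_pmul_mon:
  "foldr (pmul (*) p) w (mon (*) p u c) = mon (*) p (w @ u) (c :: 'k::field)"
  by (induction w) (simp_all add: pmul_mon)

lemma foldr_pmul_0 [simp]: "foldr (pmul (*) p) w 0 = (0 :: 'i::linorder list \<Rightarrow> 'k::field)"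
  by (induction w) (simp_all only: foldr.simps id_apply o_apply pmul_0)

text \<open>The substitution of \<mu>_i - \<lambda>_i for the i-th variable. It repeats the local
  \<open>sub\<close> of \<open>dual_lam\<close>, so that it can be folded there.\<close>

definition lam_shift :: "nat \<Rightarrow> (nat list \<Rightarrow> 'k::field) \<Rightarrow> (bool \<times> nat) list \<Rightarrow> 'k" where
  "lam_shift r P = psum P (\<lambda>L c. foldr (\<lambda>i Q. pmul (*) (vpar2 r) (True, i) Q - pmul (*) (vpar2 r) (False, i) Q) L
     (mon (*) (vpar2 r) [] c))"

lemma lam_shift_0 [simp]: "lam_shift r 0 = 0"
  by (simp add: lam_shift_def psum_def)

lemma lam_shift_const: "lam_shift r (mon (*) (vpar r) [] c) = mon (*) (vpar2 r) [] c"
  by (simp add: lam_shift_def psum_mon)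

text \<open>Both halves of \<mu>_j - \<lambda>_j are collected in one sum over the letters
  \<open>(False, j)\<close> and \<open>(True, j)\<close>, the shape required by
  \<open>foldr_pmul_sum_mon\<close>.\<close>

lemma lam_shift_linear:
  assumes "finite X"
  shows "lam_shift r (\<Sum>j\<in>X. mon (*) (vpar r) [j] (t j :: 'k::field)) =
    (\<Sum>x\<in>{False, True} \<times> X. mon (*) (vpar2 r) [x] (if fst x then t (snd x) else - t (snd x)))"
proof -
  let ?P = "\<Sum>j\<in>X. mon (*) (vpar r) [j] (t j)"
  have P1: "?P [j] = t j" if "j \<in> X" for j
  proof -
    have "?P [j] = (\<Sum>i\<in>X. if i = j then t j else 0)"
      unfolding sum_fun_apply by (rule sum.cong) (auto simp: mon_def ssgn_Cons)
    then show ?thesis using assms that by simp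
  qed
  have P2: "K \<in> (\<lambda>j. [j]) ` X" if "?P K \<noteq> 0" for K
    using sum_mon_support[OF that] by auto
  have "lam_shift r ?P = (\<Sum>K\<in>(\<lambda>j. [j]) ` X. foldr (\<lambda>i Q. pmul (*) (vpar2 r) (True, i) Q - pmul (*) (vpar2 r) (False, i) Q) K
     (mon (*) (vpar2 r) [] (?P K)))"
    unfolding lam_shift_def by (rule psum_mono_neutral) (use assms P2 in auto)
  also have "\<dots> = (\<Sum>j\<in>X. mon (*) (vpar2 r) [(True, j)] (t j) + mon (*) (vpar2 r) [(False, j)] (- t j))"
    by (subst sum.reindex) (auto simp: inj_on_def P1 pmul_mon mon_uminus)
  also have "\<dots> = (\<Sum>x\<in>{False, True} \<times> X. mon (*) (vpar2 r) [x] (if fst x then t (snd x) else - t (snd x)))"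
    by (subst sum.cartesian_product') (simp add: sum.distrib add.commute)
  finally show ?thesis .
qed

lemma length_filter_sort: "length (filter P (sort L)) = length (filter P L)"
proof -
  have "size (mset (filter P (sort L))) = size (mset (filter P L))"
    by (simp only: mset_filter mset_sort)
  then show ?thesis by (simp only: size_mset)
qed

text \<open>Every left factor from \<open>lam_word N\<close> raises the \<lambda>-degree of a
  monomial by one, and sorting preserves it. So a word N longer than K cannot contribute to
  \<lambda>_K \<mu>_L.\<close>

lemma lam_degree:
  assumes "foldr (pmul (*) (vpar2 r)) (lam_word N) Q L \<noteq> (0::'k::field)"
  shows "length N \<le> length (filter (\<lambda>x. \<not> fst x) L)"
  using assms
proof (induction N arbitrary: L)
  case (Cons i N)
  let ?Q = "foldr (pmul (*) (vpar2 r)) (lam_word N) Q"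
  have "(\<Sum>K | ?Q K \<noteq> 0. mon (*) (vpar2 r) ((False, i) # K) (?Q K) L) \<noteq> 0"
    using Cons.prems by (simp add: pmul_def[of _ _ "(False, i)"] psum_def sum_fun_apply)
  then obtain K where "?Q K \<noteq> 0" "mon (*) (vpar2 r) ((False, i) # K) (?Q K) L \<noteq> 0"
    by (auto elim!: sum.not_neutral_contains_not_neutral)
  then have K: "?Q K \<noteq> 0" "L = sort ((False, i) # K)" by (auto simp: mon_def split: if_splits)
  have "length (filter (\<lambda>x. \<not> fst x) L) = length (filter (\<lambda>x. \<not> fst x) ((False, i) # K))"
    unfolding K(2) by (rule length_filter_sort)
  then show ?case using Cons.IH[OF K(1)] by simp
qed simp

lemma sorted_lam_word: "sorted (lam_word K) = sorted K"
  by (induction K) auto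

lemma sort_lam_word: "sort (lam_word K) = lam_word (sort K)"
  by (rule properties_for_sort) (auto simp: sorted_lam_word)

lemma ssgn_lam_word: "ssgn (vpar2 r) (lam_word K) = ssgn (vpar r) K"
  by (rule ssgn_map) (auto simp: inj_def)

lemma lam_mu_eq_lam_iff: "lam_word K @ mu_word L = lam_word N \<longleftrightarrow> N = K \<and> L = []"
proof
  assume *: "lam_word K @ mu_word L = lam_word N"
  then have "True \<notin> fst ` set (lam_word K @ mu_word L)" by (metis (no_types, lifting) image_iff list.set_map fst_conv)
  then have "L = []" by (cases L) auto
  then show "N = K \<and> L = []" using * by (simp add: inj_map_eq_map inj_def)
qed auto

lemma lam_coeff_const:
  assumes "N \<in> Std r s"
  shows "foldr (pmul (*) (vpar2 r)) (lam_word N) (mon (*) (vpar2 r) [] c) (lam_word K @ mu_word L) =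
    (if N = K \<and> L = [] then c else (0::'k::field))"
  unfolding foldr_pmul_mon using assms Std_ssgn[OF assms]
  by (auto simp: mon_def sort_lam_word Std_sorted ssgn_lam_word lam_mu_eq_lam_iff del: Std_ssgn)

text \<open>Only the half -\<lambda>_j reaches the required \<lambda>-degree, one more than the
  length of \<open>N\<close>; the half \<mu>_j falls short. The sign on the right is that of the
  substitution.\<close>

lemma lam_coeff_linear:
  assumes "finite X" and len: "length K = Suc (length N)"
  shows "foldr (pmul (*) (vpar2 r)) (lam_word N)
      (lam_shift r (\<Sum>j\<in>X. mon (*) (vpar r) [j] (t j :: 'k::field))) (lam_word K @ mu_word L) =
    - (\<Sum>j\<in>X. if L = [] \<and> sort (N @ [j]) = K then ssgn (vpar r) (N @ [j]) * t j else 0)"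
proof -
  have "foldr (pmul (*) (vpar2 r)) (lam_word N) (lam_shift r (\<Sum>j\<in>X. mon (*) (vpar r) [j] (t j)))
     = (\<Sum>x\<in>{False, True} \<times> X. mon (*) (vpar2 r) (lam_word N @ [x]) (if fst x then t (snd x) else - t (snd x)))"
    unfolding lam_shift_linear[OF assms(1)] by (rule foldr_pmul_sum_mon) (use assms in auto)
  also have "\<dots> = (\<Sum>j\<in>X. mon (*) (vpar2 r) (lam_word (N @ [j])) (- t j)) +
      (\<Sum>j\<in>X. mon (*) (vpar2 r) (lam_word N @ [(True, j)]) (t j))"
    by (subst sum.cartesian_product') simp
  finally have "foldr (pmul (*) (vpar2 r)) (lam_word N)
      (lam_shift r (\<Sum>j\<in>X. mon (*) (vpar r) [j] (t j))) (lam_word K @ mu_word L) =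
      (\<Sum>j\<in>X. mon (*) (vpar2 r) (lam_word (N @ [j])) (- t j) (lam_word K @ mu_word L)) +
      (\<Sum>j\<in>X. mon (*) (vpar2 r) (lam_word N @ [(True, j)]) (t j) (lam_word K @ mu_word L))"
    by (simp only: sum_fun_apply plus_fun_apply)
  also have "(\<Sum>j\<in>X. mon (*) (vpar2 r) (lam_word N @ [(True, j)]) (t j) (lam_word K @ mu_word L)) = 0"
  proof (rule sum.neutral, rule ballI)
    fix j assume "j \<in> X"
    have "lam_word K @ mu_word L \<noteq> sort (lam_word N @ [(True, j)])"
    proof
      assume eq: "lam_word K @ mu_word L = sort (lam_word N @ [(True, j)])"
      have "length (filter (\<lambda>x. \<not> fst x) (lam_word K @ mu_word L)) = length (filter (\<lambda>x. \<not> fst x) (lam_word N @ [(True, j)]))"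
        unfolding eq by (rule length_filter_sort)
      then show False using len by (simp add: filter_map o_def)
    qed
    then show "mon (*) (vpar2 r) (lam_word N @ [(True, j)]) (t j) (lam_word K @ mu_word L) = 0"
      by (simp add: mon_def)
  qed
  also have "(\<Sum>j\<in>X. mon (*) (vpar2 r) (lam_word (N @ [j])) (- t j) (lam_word K @ mu_word L)) =
     - (\<Sum>j\<in>X. if L = [] \<and> sort (N @ [j]) = K then ssgn (vpar r) (N @ [j]) * t j else 0)"
    unfolding sum_negf[symmetric]
    by (rule sum.cong)
      (auto simp: mon_def sort_lam_word ssgn_lam_word lam_mu_eq_lam_iff simp del: map_append)
  finally show ?thesis by simp
qed

section \<open>Superspaces and supertraces\<close>

lemma UNIV_bit: "(UNIV :: bit set) = {0, 1}"
  using bit_eq_1_iff by auto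

lemma bit_add_self: "(p::bit) + p = 0" "p + (p + q) = q"
  by (cases p; cases q; simp)+

text \<open>Sign bookkeeping for a product of two matrix entries: applying operators of parities p
  and q in turn leads back to the starting parity, which forces p = q.\<close>

lemma ksgn_commute_aux:
  assumes "c = q + (p + c)" shows "ksgn c * ksgn (p * q) = (ksgn (p + c) :: 'k::comm_ring_1)"
proof -
  have "c + c = (q + (p + c)) + c" using assms by simp
  then have "p + q = 0" by (simp only: bit_add_self add.assoc) (simp add: add.commute)
  then have "p = q" by (cases p; cases q; simp)
  then show ?thesis by (cases p; cases c; simp)
qed

locale superspace =
  fixes V :: "('k::field, 'v::ab_group_add, 'z) superspace_scheme"
  assumes super_space: "super_space V"
begin

sublocale vector_space "scl V"
  using super_space by (simp add: super_space_def)

lemma subspace_par [simp, intro]: "subspace (par V p)"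
  using super_space by (simp add: super_space_def direct_sum_def)

lemma car_eq_span: "car V = span (\<Union>p. par V p)"
  using super_space by (simp add: super_space_def direct_sum_def)

lemma subspace_car [simp, intro]: "subspace (car V)"
  by (simp add: car_eq_span)

lemma par_subset_car: "par V p \<subseteq> car V"
  by (auto simp: car_eq_span intro: span_base)

lemma par_disjoint:
  assumes "x \<in> par V p" "x \<in> par V q" "p \<noteq> q" shows "x = 0"
proof (rule ccontr)
  assume x: "x \<noteq> 0"
  \<comment> \<open>A nonzero common vector would give the family x, -x with sum zero, against
    directness.\<close>
  define c where "c = (\<lambda>i. if i = p then x else - x)"
  have "(\<forall>i. c i \<in> par V i) \<and> finite {i. c i \<noteq> 0} \<and> (\<Sum>i | c i \<noteq> 0. c i) = 0 \<longrightarrow> (\<forall>i. c i = 0)"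
    using super_space unfolding super_space_def direct_sum_def by blast
  moreover have q: "i = q" if "i \<noteq> p" for i
    using assms(3) that bit_eq_1_iff by metis
  have c0: "c p \<noteq> 0" "c q \<noteq> 0" using x assms(3) by (simp_all add: c_def)
  then have S: "{i. c i \<noteq> 0} = {p, q}" using q by blast
  have "(\<Sum>i | c i \<noteq> 0. c i) = 0" unfolding S using assms(3) by (simp add: c_def)
  moreover have "c i \<in> par V i" for i
  proof (cases "i = p")
    case False
    then show ?thesis using q[OF False] assms(2) by (simp add: c_def subspace_neg)
  qed (use assms(1) in \<open>simp add: c_def\<close>)
  moreover have "finite {i. c i \<noteq> 0}" unfolding S by simp
  ultimately show False using c0 by blast
qed

lemma par_decomp:
  assumes "x \<in> car V"
  obtains x0 x1 where "x0 \<in> par V 0" "x1 \<in> par V 1" "x = x0 + x1"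
proof -
  have "x \<in> span (par V 0 \<union> par V 1)"
    using assms by (simp add: car_eq_span UNIV_bit)
  then have "x \<in> {x + y |x y. x \<in> par V 0 \<and> y \<in> par V 1}"
    by (simp add: span_Un span_eq_iff[THEN iffD2] del: span_eq_iff)
  then show ?thesis using that by blast
qed

lemma hcomp_eq:
  assumes "x \<in> par V p" "y \<in> par V (p + 1)" shows "hcomp V p (x + y) = x"
  unfolding hcomp_def
proof (rule the_equality)
  fix z assume z: "z \<in> par V p \<and> x + y - z \<in> par V (p + 1)"
  then have "(x + y - z) - y \<in> par V (p + 1)"
    using z assms(2) by (blast intro: subspace_diff subspace_par)
  moreover have "x - z \<in> par V p"
    using z assms(1) by (blast intro: subspace_diff subspace_par)
  moreover have "(x + y - z) - y = x - z" by simp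
  moreover have "p \<noteq> p + 1" by (cases p) auto
  ultimately have "x - z = 0" using par_disjoint by metis
  then show "z = x" by simp
qed (use assms in auto)

lemma hcomp_same: "x \<in> par V p \<Longrightarrow> hcomp V p x = x"
  using hcomp_eq[of x p 0] by (simp add: subspace_0)

lemma hcomp_other: "x \<in> par V (p + 1) \<Longrightarrow> hcomp V p x = 0"
  using hcomp_eq[of 0 p x] by (simp add: subspace_0)

text \<open>The part of the expansion with the wrong parity is a difference of two vectors of parity
  p, so it lies in both components and is zero; independence then kills its coefficients.\<close>

lemma representation_parity:
  assumes B: "B \<subseteq> par V 0 \<union> par V 1" "independent B"
    and x: "x \<in> span B" "x \<in> par V p" and nz: "representation B x b \<noteq> 0"
  shows "b \<in> par V p"
proof (rule ccontr)
  assume b: "b \<notin> par V p"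
  let ?S = "{b. representation B x b \<noteq> 0}"
  let ?f = "\<lambda>b. scl V (representation B x b) b"
  have fin: "finite ?S" by (rule finite_representation)
  have SB: "?S \<subseteq> B" using representation_ne_zero by blast
  have odd: "b \<in> par V (p + 1)" if "b \<in> ?S" "b \<notin> par V p" for b
    using that SB B by (cases p) auto
  have "x = sum ?f ?S" using sum_nonzero_representation_eq[OF B(2) x(1)] by simp
  also have "\<dots> = sum ?f (?S \<inter> par V p) + sum ?f (?S - par V p)"
    by (rule sum.Int_Diff[OF fin])
  finally have eq: "x = sum ?f (?S \<inter> par V p) + sum ?f (?S - par V p)" .
  have 1: "sum ?f (?S - par V p) \<in> par V (p + 1)"
    using odd by (intro subspace_sum subspace_scale) auto
  have "sum ?f (?S \<inter> par V p) \<in> par V p"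
    by (intro subspace_sum subspace_scale) auto
  then have "x - sum ?f (?S \<inter> par V p) \<in> par V p" using x(2) by (auto intro: subspace_diff)
  moreover have "x - sum ?f (?S \<inter> par V p) = sum ?f (?S - par V p)"
    using eq unfolding diff_eq_eq by (simp only: add.commute)
  ultimately have 2: "sum ?f (?S - par V p) \<in> par V p" by (simp only:)
  have "p \<noteq> p + 1" by (cases p) auto
  then have "sum ?f (?S - par V p) = 0" using par_disjoint[OF 2 1] by auto
  then have "representation B x b = 0"
    using independentD[OF B(2), of "?S - par V p" "representation B x" b] fin SB b nz by auto
  then show False using nz by simp
qed

section \<open>Basis independence of the supertrace\<close>

definition homogeneous_basis :: "'v set \<Rightarrow> 'v set \<Rightarrow> bool" where
  "homogeneous_basis W B \<longleftrightarrow> finite B \<and> B \<subseteq> par V 0 \<union> par V 1 \<and> independent B \<and> span B = W"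

definition parity_sign :: "'v \<Rightarrow> 'k" where
  "parity_sign b = (if b \<in> par V 1 then - 1 else 1)"

definition str_sum :: "'v set \<Rightarrow> ('v \<Rightarrow> 'v) \<Rightarrow> 'k" where
  "str_sum B T = (\<Sum>b\<in>B. parity_sign b * representation B (T b) b)"

lemma parity_sign: "b \<in> par V p \<Longrightarrow> b \<noteq> 0 \<Longrightarrow> parity_sign b = ksgn p"
  using par_disjoint[of b p 1] by (cases p) (auto simp: parity_sign_def)

text \<open>The change of basis between homogeneous bases is even, so the diagonal matrix of signs
  commutes with it. This reduces supertraces to the argument for ordinary traces.\<close>

lemma parity_sign_representation:
  assumes B: "homogeneous_basis W B" and C: "homogeneous_basis W C" and b: "b \<in> B"
  shows "parity_sign b * representation C b c = parity_sign c * representation C b c"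
proof (cases "representation C b c = 0")
  case False
  have b0: "b \<noteq> 0" using B b dependent_zero by (auto simp: homogeneous_basis_def)
  have "c \<in> C" using False by (rule representation_ne_zero)
  then have c0: "c \<noteq> 0" using C dependent_zero by (auto simp: homogeneous_basis_def)
  obtain p where p: "b \<in> par V p" using B b by (auto simp: homogeneous_basis_def)
  have "b \<in> span C" using B C b span_base[of b B] by (auto simp: homogeneous_basis_def)
  then have "c \<in> par V p" using representation_parity[OF _ _ _ p False] C by (auto simp: homogeneous_basis_def)
  then show ?thesis using parity_sign p b0 c0 by simp
qed simp

lemma representation_linear:
  assumes B: "finite B" "independent B" and C: "finite C" "independent C" "span C = span B"
    and T: "Vector_Spaces.linear (scl V) (scl V) T" "T ` span B \<subseteq> span B" and x: "x \<in> span B"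
  shows "representation B (T x) b = (\<Sum>c\<in>C. representation C x c * representation B (T c) b)"
proof -
  interpret T: Vector_Spaces.linear "scl V" "scl V" T by (rule T)
  have Tc: "T c \<in> span B" if "c \<in> C" for c using that T(2) C(3) span_base[of c C] by auto
  have "x = (\<Sum>c\<in>C. scl V (representation C x c) c)"
    using sum_representation_eq[OF C(2)] x C by auto
  then have "T x = T (\<Sum>c\<in>C. scl V (representation C x c) c)" by simp
  then have "T x = (\<Sum>c\<in>C. scl V (representation C x c) (T c))"
    by (simp only: T.scale T.sum)
  then have "representation B (T x) b = representation B (\<Sum>c\<in>C. scl V (representation C x c) (T c)) b" by simp
  also have "\<dots> = (\<Sum>c\<in>C. representation B (scl V (representation C x c) (T c)) b)"
    using Tc B by (subst representation_sum) (auto intro: span_scale)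
  also have "\<dots> = (\<Sum>c\<in>C. representation C x c * representation B (T c) b)"
    using Tc B by (intro sum.cong) (auto simp: representation_scale)
  finally show ?thesis .
qed

text \<open>The conjugation invariance of the trace: expand twice in the basis \<open>C\<close>,
  move the sign over to \<open>C\<close>, and contract the two change-of-basis matrices to the
  identity.\<close>

lemma str_sum_basis_independent:
  assumes B: "homogeneous_basis W B" and C: "homogeneous_basis W C"
    and T: "Vector_Spaces.linear (scl V) (scl V) T" "T ` W \<subseteq> W"
  shows "str_sum B T = str_sum C T"
proof -
  have fB: "finite B" "independent B" "span B = W" and fC: "finite C" "independent C" "span C = W"
    using B C by (auto simp: homogeneous_basis_def)
  have idl: "Vector_Spaces.linear (scl V) (scl V) (\<lambda>x. x)"
    by (rule linear_ident)
  have TC: "T c \<in> W" if "c \<in> C" for c using that T(2) fC(3) span_base[of c C] by auto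
  have CW: "c \<in> W" if "c \<in> C" for c using that fC(3) span_base[of c C] by auto
  have BW: "c \<in> W" if "c \<in> B" for c using that fB(3) span_base[of c B] by auto
  have "str_sum B T = (\<Sum>b\<in>B. \<Sum>c\<in>C. \<Sum>c'\<in>C. parity_sign c * (representation C b c * (representation C (T c) c' * representation B c' b)))"
    unfolding str_sum_def
  proof (rule sum.cong[OF refl])
    fix b assume b: "b \<in> B"
    have "representation B (T b) b = (\<Sum>c\<in>C. representation C b c * representation B (T c) b)"
      by (rule representation_linear) (use fB fC T BW b in auto)
    also have "parity_sign b * \<dots> = (\<Sum>c\<in>C. parity_sign c * (representation C b c * representation B (T c) b))"
      unfolding sum_distrib_left
      by (intro sum.cong refl) (metis (no_types, lifting) mult.assoc parity_sign_representation[OF B C b])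
    also have "\<dots> = (\<Sum>c\<in>C. \<Sum>c'\<in>C. parity_sign c * (representation C b c * (representation C (T c) c' * representation B c' b)))"
    proof (intro sum.cong refl)
      fix c assume c: "c \<in> C"
      have "representation B (T c) b = (\<Sum>c'\<in>C. representation C (T c) c' * representation B c' b)"
        by (rule representation_linear[where T = "\<lambda>x. x"]) (use fB fC TC c idl in auto)
      then show "parity_sign c * (representation C b c * representation B (T c) b) =
        (\<Sum>c'\<in>C. parity_sign c * (representation C b c * (representation C (T c) c' * representation B c' b)))"
        by (simp add: sum_distrib_left)
    qed
    finally show "parity_sign b * representation B (T b) b = (\<Sum>c\<in>C. \<Sum>c'\<in>C. parity_sign c * (representation C b c * (representation C (T c) c' * representation B c' b)))" .
  qed
  also have "\<dots> = (\<Sum>c\<in>C. \<Sum>b\<in>B. \<Sum>c'\<in>C. parity_sign c * (representation C b c * (representation C (T c) c' * representation B c' b)))"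
    by (rule sum.swap)
  also have "\<dots> = (\<Sum>c\<in>C. parity_sign c * representation C (T c) c)"
  proof (rule sum.cong[OF refl])
    fix c assume c: "c \<in> C"
    have "(\<Sum>b\<in>B. \<Sum>c'\<in>C. parity_sign c * (representation C b c * (representation C (T c) c' * representation B c' b))) =
      (\<Sum>c'\<in>C. \<Sum>b\<in>B. parity_sign c * (representation C b c * (representation C (T c) c' * representation B c' b)))"
      by (rule sum.swap)
    also have "\<dots> = (\<Sum>c'\<in>C. parity_sign c * representation C (T c) c' * (\<Sum>b\<in>B. representation B c' b * representation C b c))"
      by (simp add: sum_distrib_left mult_ac)
    also have "\<dots> = (\<Sum>c'\<in>C. parity_sign c * representation C (T c) c' * (if c' = c then 1 else 0))"
    proof (intro sum.cong refl)
      fix c' assume c': "c' \<in> C"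
      have "representation C c' c = (\<Sum>b\<in>B. representation B c' b * representation C b c)"
        by (rule representation_linear[where T = "\<lambda>x. x"]) (use fB fC CW c' idl in auto)
      moreover have "representation C c' c = (if c' = c then 1 else 0)"
        using representation_basis[OF fC(2) c'] by auto
      ultimately have "(\<Sum>b\<in>B. representation B c' b * representation C b c) = (if c' = c then 1 else 0)"
        by (simp only:)
      then show "parity_sign c * representation C (T c) c' * (\<Sum>b\<in>B. representation B c' b * representation C b c) =
        parity_sign c * representation C (T c) c' * (if c' = c then 1 else 0)" by (simp only:)
    qed
    also have "\<dots> = parity_sign c * representation C (T c) c"
      using c fC by (simp add: if_distrib[where f = "(*) _"] cong: if_cong)
    finally show "(\<Sum>b\<in>B. \<Sum>c'\<in>C. parity_sign c * (representation C b c * (representation C (T c) c' * representation B c' b))) = parity_sign c * representation C (T c) c" .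
  qed
  finally show ?thesis by (simp add: str_sum_def)
qed

text \<open>\<open>supertrace\<close> works in a basis picked by choice; by basis independence any
  homogeneous basis may be used to compute it.\<close>

lemma supertrace_eq:
  assumes B: "homogeneous_basis W B"
    and T: "Vector_Spaces.linear (scl V) (scl V) T" "T ` W \<subseteq> W"
  shows "supertrace V W T = str_sum B T"
proof -
  define C where "C = (SOME B. homogeneous_basis W B)"
  have "homogeneous_basis W C" unfolding C_def by (rule someI[of "homogeneous_basis W", OF B])
  then have "str_sum B T = str_sum C T" by (intro str_sum_basis_independent[OF B _ T])
  then show ?thesis
    by (simp add: supertrace_def str_sum_def parity_sign_def C_def homogeneous_basis_def Let_def)
qed

end

section \<open>Supertraces of adjoint actions\<close>

locale lie_super_alg =
  fixes L :: "('k::field, 'v::ab_group_add) lie_super"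
  assumes lie_superalgebra: "lie_superalgebra L"
begin

sublocale superspace L
  using lie_superalgebra by unfold_locales (simp add: lie_superalgebra_def)

lemma car_UNIV [simp]: "car L = UNIV"
  using lie_superalgebra by (simp add: lie_superalgebra_def)

lemma linear_brk: "Vector_Spaces.linear (scl L) (scl L) (brk L x)"
  and linear_brk_left: "Vector_Spaces.linear (scl L) (scl L) (\<lambda>x. brk L x y)"
  using lie_superalgebra by (simp_all add: lie_superalgebra_def)

lemma brk_simps [simp]:
  "brk L x 0 = 0" "brk L 0 x = 0"
  "brk L x (scl L c y) = scl L c (brk L x y)" "brk L (scl L c x) y = scl L c (brk L x y)"
  and brk_add: "brk L x (y + z) = brk L x y + brk L x z" "brk L (x + y) z = brk L x z + brk L y z"
proof -
  interpret r: Vector_Spaces.linear "scl L" "scl L" "brk L x" for x by (rule linear_brk)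
  interpret l: Vector_Spaces.linear "scl L" "scl L" "\<lambda>x. brk L x y" for y by (rule linear_brk_left)
  show "brk L x 0 = 0" "brk L 0 x = 0"
    "brk L x (scl L c y) = scl L c (brk L x y)" "brk L (scl L c x) y = scl L c (brk L x y)"
    "brk L x (y + z) = brk L x y + brk L x z" "brk L (x + y) z = brk L x z + brk L y z"
    by (simp_all add: r.zero l.zero r.scale l.scale r.add l.add)
qed

lemma brk_par: "x \<in> par L p \<Longrightarrow> y \<in> par L q \<Longrightarrow> brk L x y \<in> par L (p + q)"
  and brk_skew: "x \<in> par L p \<Longrightarrow> y \<in> par L q \<Longrightarrow> brk L y x = - scl L (ksgn (p * q)) (brk L x y)"
  and brk_jacobi: "x \<in> par L p \<Longrightarrow> y \<in> par L q \<Longrightarrow>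
    brk L x (brk L y z) = brk L (brk L x y) z + scl L (ksgn (p * q)) (brk L y (brk L x z))"
  using lie_superalgebra unfolding lie_superalgebra_def by blast+

text \<open>An odd element changes parity, so the diagonal entries of its adjoint action are
  zero.\<close>

lemma str_sum_odd:
  assumes B: "homogeneous_basis W B" and x: "x \<in> par L 1" "brk L x ` W \<subseteq> W"
  shows "str_sum B (brk L x) = 0"
  unfolding str_sum_def
proof (rule sum.neutral, rule ballI)
  fix b assume b: "b \<in> B"
  have B': "finite B" "B \<subseteq> par L 0 \<union> par L 1" "independent B" "span B = W" "b \<in> W"
    using B b span_base[of b B] by (auto simp: homogeneous_basis_def)
  obtain p where p: "b \<in> par L p" using B' b by auto
  have "b \<noteq> 0" using B' b dependent_zero by auto
  moreover have "1 + p \<noteq> p" by (cases p) auto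
  moreover have "brk L x b \<in> par L (1 + p)" using brk_par[OF x(1) p] .
  ultimately have "representation B (brk L x b) b = 0"
    using representation_parity[of B "brk L x b" "1 + p" b] par_disjoint[OF p, of "1 + p"] B' x by auto
  then show "parity_sign b * representation B (brk L x b) b = 0" by simp
qed

text \<open>Graded cyclicity of the trace. By the Jacobi identity both terms are double sums over
  pairs of basis vectors, and after exchanging the roles of the pair they agree up to a sign that
  matters only where both entries are nonzero.\<close>

lemma str_sum_commutator:
  assumes B: "homogeneous_basis W B"
    and x: "x \<in> par L p" "brk L x ` W \<subseteq> W" and y: "y \<in> par L q" "brk L y ` W \<subseteq> W"
  shows "str_sum B (brk L (brk L x y)) = 0"
proof -
  have fB: "finite B" "B \<subseteq> par L 0 \<union> par L 1" "independent B" "span B = W"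
    using B by (auto simp: homogeneous_basis_def)
  have BW: "b \<in> W" if "b \<in> B" for b using that fB(4) span_base[of b B] by auto
  have r: "representation B (brk L u (brk L w b)) b =
      (\<Sum>c\<in>B. representation B (brk L w b) c * representation B (brk L u c) b)"
    if "b \<in> B" "brk L u ` W \<subseteq> W" "brk L w ` W \<subseteq> W" for b u w
    by (rule representation_linear) (use fB BW that linear_brk in auto)
  have xyW: "brk L x (brk L y b) \<in> span B" "brk L y (brk L x b) \<in> span B" if "b \<in> B" for b
    using BW[OF that] x(2) y(2) fB by auto
  have eq: "brk L (brk L x y) b = brk L x (brk L y b) - scl L (ksgn (p * q)) (brk L y (brk L x b))" for b
    using brk_jacobi[OF x(1) y(1), of b] by simp
  have "str_sum B (brk L (brk L x y)) =
    (\<Sum>b\<in>B. parity_sign b * (representation B (brk L x (brk L y b)) b - ksgn (p * q) * representation B (brk L y (brk L x b)) b))"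
    unfolding str_sum_def
  proof (intro sum.cong refl arg_cong2[where f = "(*)"])
    fix b assume "b \<in> B"
    then show "representation B (brk L (brk L x y) b) b =
        representation B (brk L x (brk L y b)) b - ksgn (p * q) * representation B (brk L y (brk L x b)) b"
      unfolding eq using xyW[of b] by (simp only: representation_diff[OF fB(3)] representation_scale[OF fB(3)] span_scale)
  qed
  also have "\<dots> = (\<Sum>b\<in>B. \<Sum>c\<in>B. parity_sign b * representation B (brk L y b) c * representation B (brk L x c) b)
      - (\<Sum>b\<in>B. \<Sum>c\<in>B. parity_sign b * ksgn (p * q) * representation B (brk L x b) c * representation B (brk L y c) b)"
    by (simp add: r x y sum_distrib_left right_diff_distrib sum_subtractf mult.assoc)
  also have "(\<Sum>b\<in>B. \<Sum>c\<in>B. parity_sign b * ksgn (p * q) * representation B (brk L x b) c * representation B (brk L y c) b)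
     = (\<Sum>b\<in>B. \<Sum>c\<in>B. parity_sign c * ksgn (p * q) * representation B (brk L x c) b * representation B (brk L y b) c)"
    by (rule sum.swap)
  also have "\<dots> = (\<Sum>b\<in>B. \<Sum>c\<in>B. parity_sign b * representation B (brk L y b) c * representation B (brk L x c) b)"
  proof (intro sum.cong refl)
    fix b c assume bc: "b \<in> B" "c \<in> B"
    show "parity_sign c * ksgn (p * q) * representation B (brk L x c) b * representation B (brk L y b) c
      = parity_sign b * representation B (brk L y b) c * representation B (brk L x c) b"
    proof (cases "representation B (brk L x c) b = 0 \<or> representation B (brk L y b) c = 0")
      case False
      obtain pb pc where pb: "b \<in> par L pb" and pc: "c \<in> par L pc" using bc fB by (metis Un_iff subsetD)
      have nz: "b \<noteq> 0" "c \<noteq> 0" using bc fB dependent_zero by auto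
      have sp: "brk L x c \<in> span B" "brk L y b \<in> span B"
        using x(2) y(2) BW bc fB(4) by blast+
      \<comment> \<open>Nonzero entries tie the parities together: \<open>b\<close> occurs in the
        expansion of [x, c], and \<open>c\<close> in that of [y, b].\<close>
      have "b \<in> par L (p + pc)"
        by (rule representation_parity[OF fB(2,3) sp(1) brk_par[OF x(1) pc]]) (use False in blast)
      then have pcb: "pb = p + pc" using par_disjoint[OF pb] nz by blast
      have "c \<in> par L (q + pb)"
        by (rule representation_parity[OF fB(2,3) sp(2) brk_par[OF y(1) pb]]) (use False in blast)
      then have "pc = q + pb" using par_disjoint[OF pc] nz by blast
      then have "ksgn pc * ksgn (p * q) = (ksgn pb :: 'k)"
        unfolding pcb by (rule ksgn_commute_aux)
      then show ?thesis using parity_sign[OF pb nz(1)] parity_sign[OF pc nz(2)] by simp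
    qed auto
  qed
  finally show ?thesis by simp
qed

text \<open>The vanishing on commutators is available for homogeneous elements; through
  \<open>dec\<close> a general bracket splits into four homogeneous ones.\<close>

lemma character_supertrace:
  assumes B: "homogeneous_basis W B" and S: "subspace S"
    and SW: "\<And>x. x \<in> S \<Longrightarrow> brk L x ` W \<subseteq> W"
    and SS: "\<And>x y. x \<in> S \<Longrightarrow> y \<in> S \<Longrightarrow> brk L x y \<in> S"
    and dec: "\<And>x. x \<in> S \<Longrightarrow> \<exists>x0\<in>S \<inter> par L 0. \<exists>x1\<in>S \<inter> par L 1. x = x0 + x1"
  shows "character L S (\<lambda>x. supertrace L W (brk L x))"
proof -
  have fB: "finite B" "B \<subseteq> par L 0 \<union> par L 1" "independent B" "span B = W"
    using B by (auto simp: homogeneous_basis_def)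
  have BW: "b \<in> W" if "b \<in> B" for b using that fB(4) span_base[of b B] by auto
  have str: "supertrace L W (brk L x) = str_sum B (brk L x)" if "x \<in> S" for x
    by (rule supertrace_eq[OF B linear_brk SW[OF that]])
  have xB: "brk L x b \<in> span B" if "x \<in> S" "b \<in> B" for x b
    using SW[OF that(1)] BW[OF that(2)] fB by auto
  have add: "str_sum B (brk L (x + y)) = str_sum B (brk L x) + str_sum B (brk L y)" if "x \<in> S" "y \<in> S" for x y
    using that xB fB by (simp add: str_sum_def brk_add representation_add distrib_left sum.distrib)
  have scale: "str_sum B (brk L (scl L c x)) = c * str_sum B (brk L x)" if "x \<in> S" for x c
    using that xB fB by (simp add: str_sum_def representation_scale sum_distrib_left mult_ac)
  have brk0: "str_sum B (brk L (brk L x y)) = 0" if xy: "x \<in> S" "y \<in> S" for x y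
  proof -
    obtain x0 x1 y0 y1 where x: "x0 \<in> S" "x1 \<in> S" "x0 \<in> par L 0" "x1 \<in> par L 1" "x = x0 + x1"
      and y: "y0 \<in> S" "y1 \<in> S" "y0 \<in> par L 0" "y1 \<in> par L 1" "y = y0 + y1"
      using dec[OF xy(1)] dec[OF xy(2)] by auto
    have "brk L x y = (brk L x0 y0 + brk L x0 y1) + (brk L x1 y0 + brk L x1 y1)"
      by (simp add: x(5) y(5) brk_add add_ac)
    also have "str_sum B (brk L \<dots>) = 0"
      using x y S SS str_sum_commutator[OF B] SW by (simp add: add subspace_add)
    finally show ?thesis .
  qed
  show ?thesis
    unfolding character_def lin_on_def
    using add scale brk0 str_sum_odd[OF B] SW S SS by (auto simp: str subspace_add subspace_scale)
qed

end

section \<open>The annihilation algebra\<close>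

text \<open>A relative version for maps such as \<open>\<pi>\<close> on \<open>Rt\<close> or
  \<open>\<lambda>\<delta>. \<rho> \<delta> 0\<close> on \<open>D\<close>, whose linearity is given
  only on a subspace of their type.\<close>

lemma lin_on_image_span:
  assumes "module s1" "module s2" "lin_on V s1 s2 f" "module.subspace s1 V" "S \<subseteq> V"
  shows "f ` module.span s1 S = module.span s2 (f ` S)"
proof -
  interpret m1: module s1 by fact
  interpret m2: module s2 by fact
  have add: "f (x + y) = f x + f y" if "x \<in> V" "y \<in> V" for x y
    using assms(3) that unfolding lin_on_def by blast
  have scale: "f (s1 c x) = s2 c (f x)" if "x \<in> V" for c x
    using assms(3) that unfolding lin_on_def by blast
  have zero: "f 0 = 0" using add[of 0 0] m1.subspace_0[OF assms(4)] by simp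
  have V: "m1.span S \<subseteq> V" using assms(4,5) by (rule m1.span_minimal[rotated])
  show ?thesis
  proof (intro equalityI subsetI)
    fix y assume "y \<in> f ` m1.span S"
    then obtain x where x: "x \<in> m1.span S" "y = f x" by blast
    from x(1) have "x \<in> m1.span S \<and> f x \<in> m2.span (f ` S)"
    proof (induction rule: m1.span_induct_alt)
      case (step c x y)
      then have "x \<in> m1.span S" by (simp add: m1.span_base)
      then show ?case using step V
        by (simp add: add scale subsetD m1.subspace_scale[OF assms(4)] m1.span_add m1.span_scale m2.span_add m2.span_scale m2.span_base)
    qed (simp add: zero m1.span_zero m2.span_zero)
    then show "y \<in> m2.span (f ` S)" using x by simp
  next
    fix y assume "y \<in> m2.span (f ` S)"
    then show "y \<in> f ` m1.span S"
    proof (induction rule: m2.span_induct_alt)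
      case base
      then show ?case using zero m1.span_zero by (metis imageI)
    next
      case (step c x y)
      then obtain u w where "u \<in> S" "x = f u" "w \<in> m1.span S" "y = f w" by blast
      then have "s2 c x + y = f (s1 c u + w)"
        using V assms(5) by (simp add: add scale subsetD m1.subspace_scale[OF assms(4)])
      moreover have "s1 c u + w \<in> m1.span S"
        using \<open>u \<in> S\<close> \<open>w \<in> m1.span S\<close> by (simp add: m1.span_add m1.span_scale m1.span_base)
      ultimately show ?case by blast
    qed
  qed
qed

lemma Std_append_ssgn:
  assumes "M \<in> Std r s" "N \<in> Std r s" "ssgn (vpar r) (M @ N) \<noteq> (0::'k::idom)"
  shows "sort (M @ N) \<in> Std r s"
proof -
  have "distinct (filter (\<lambda>i. vpar r i = 1) (M @ N))" using assms(3) unfolding ssgn_eq_0_iff by simp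
  then have "distinct (filter (\<lambda>i. vpar r i = 1) (sort (M @ N)))"
    using distinct_filter_mset[of "sort (M @ N)" "M @ N"] by simp
  then show ?thesis using assms(1,2) by (auto simp: Std_def)
qed

locale conformal_annihilation =
  fixes r s :: nat
    and R :: "('k::field_char_0, 'a::ab_group_add) lie_conf"
    and gr :: "int \<Rightarrow> 'a set"
    and A :: "('k, 'b::ab_group_add) lie_super"
    and \<pi> :: "(nat list \<Rightarrow> 'a) \<Rightarrow> 'b"
  assumes conformal: "lie_conformal_superalgebra r s R"
    and graded: "graded_conformal r s R gr"
    and annihilation: "annihilation_algebra r s R gr A \<pi>"
begin

sublocale R: superspace R
  using conformal unfolding lie_conformal_superalgebra_def Let_def by unfold_locales blast

sublocale A: lie_super_alg A
  using annihilation unfolding annihilation_algebra_def Let_def by unfold_locales blast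

sublocale Fn: vector_space "fsc (scl R)"
  by (rule vector_space_fsc) (rule R.vector_space_axioms)

abbreviation "Rt \<equiv> Rtilde r s R"
abbreviation "vp \<equiv> vpar r"

lemma linear_der: "i \<in> {1..r + s} \<Longrightarrow> Vector_Spaces.linear (scl R) (scl R) (der R i)"
  using conformal[unfolded lie_conformal_superalgebra_def Let_def, THEN conjunct2, THEN conjunct2, THEN conjunct1]
  by blast

lemmas graded_conjs = graded[unfolded graded_conformal_def direct_sum_def]

lemma subspace_gr [simp, intro]: "R.subspace (gr d)"
  using graded_conjs[THEN conjunct1, THEN conjunct1] by (rule spec)

lemma span_gr: "R.span (\<Union>d. gr d) = UNIV"
  using graded_conjs[THEN conjunct1, THEN conjunct2, THEN conjunct1] by (rule sym)

lemma gr_homogeneous: "gr d = R.span (\<Union>q. gr d \<inter> par R q)"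
  using graded_conjs[THEN conjunct2, THEN conjunct1] by (rule spec)

lemma lbr_gr: "a \<in> gr d \<Longrightarrow> b \<in> gr e \<Longrightarrow> lbr R a b K \<in> gr (d + e + 2 * int (length K))"
  using graded_conjs[THEN conjunct2, THEN conjunct2, THEN conjunct2] by blast

lemmas annihilation_conjs = annihilation[unfolded annihilation_algebra_def Let_def, THEN conjunct2]

lemma lin_on_\<pi>: "lin_on Rt (fsc (scl R)) (scl A) \<pi>"
  by (rule annihilation_conjs[THEN conjunct1])

lemma \<pi>_surj: "\<pi> ` Rt = UNIV"
  by (rule annihilation_conjs[THEN conjunct2, THEN conjunct1])

lemma \<pi>_kernel: "{\<phi> \<in> Rt. \<pi> \<phi> = 0} =
    Fn.span (\<Union>i\<in>{1..r + s}. (\<lambda>\<phi>. pder (scl R) r i (der R i) \<phi> + dy (scl R) r s i \<phi>) ` Rt)"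
  by (rule annihilation_conjs[THEN conjunct2, THEN conjunct2, THEN conjunct1])

lemma par_A: "par A p = \<pi> ` {\<phi> \<in> Rt. \<forall>K. \<phi> K \<in> par R (p + lpar vp K)}"
  using annihilation_conjs[THEN conjunct2, THEN conjunct2, THEN conjunct2, THEN conjunct1] by (rule spec)

lemma brk_A: "a \<in> par R p \<Longrightarrow> b \<in> par R q \<Longrightarrow> g \<in> pow_ser r s \<Longrightarrow> h \<in> pow_ser r s \<Longrightarrow>
    brk A (\<pi> (ser_l (scl R) g a)) (\<pi> (ser_r (scl R) r q b h)) =
      \<pi> (\<Sum>J | kprod R J a b \<noteq> 0. fsc (scl R) (1 / fK J)
          (ser_prod (scl R) r s (p + q + lpar vp J) (fold (dy_right r s) J g) (kprod R J a b) h))"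
  using annihilation_conjs[THEN conjunct2, THEN conjunct2, THEN conjunct2, THEN conjunct2, THEN conjunct1]
  by blast

lemma deg_A: "deg A j = \<pi> ` Fn.span {mon (scl R) vp M a | M a. M \<in> Std r s \<and> a \<in> gr (j - 2 * int (length M))}"
  using annihilation_conjs[THEN conjunct2, THEN conjunct2, THEN conjunct2, THEN conjunct2, THEN conjunct2,
      THEN conjunct1] by (rule spec)

lemma fil_A: "fil A j = \<pi> ` {\<phi> \<in> Rt. \<forall>M. \<phi> M \<in> R.span (\<Union>d\<in>{j - 2 * int (length M)..}. gr d)}"
  using annihilation_conjs[THEN conjunct2, THEN conjunct2, THEN conjunct2, THEN conjunct2, THEN conjunct2,
      THEN conjunct2] by (rule spec)

lemma subspace_Rt [simp, intro]: "Fn.subspace Rt"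
  by (simp add: Rtilde_def)

lemma ser_l_Rt: "g \<in> pow_ser r s \<Longrightarrow> ser_l (scl R) g a \<in> Rt"
  unfolding Rtilde_def by (rule Fn.span_base) blast

lemma \<pi>_add: "\<phi> \<in> Rt \<Longrightarrow> \<psi> \<in> Rt \<Longrightarrow> \<pi> (\<phi> + \<psi>) = \<pi> \<phi> + \<pi> \<psi>"
  and \<pi>_scale: "\<phi> \<in> Rt \<Longrightarrow> \<pi> (fsc (scl R) c \<phi>) = scl A c (\<pi> \<phi>)"
  using lin_on_\<pi> unfolding lin_on_def by blast+

lemma \<pi>_0 [simp]: "\<pi> 0 = 0"
  using \<pi>_add[of 0 0] Fn.subspace_0[OF subspace_Rt] by simp

lemma \<pi>_diff: "\<phi> \<in> Rt \<Longrightarrow> \<psi> \<in> Rt \<Longrightarrow> \<pi> (\<phi> - \<psi>) = \<pi> \<phi> - \<pi> \<psi>"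
  using \<pi>_add[of "\<phi> - \<psi>" \<psi>] Fn.subspace_diff[OF subspace_Rt] by simp

lemma mon_Std: "K \<in> Std r s \<Longrightarrow> mon (scl R) vp K a = (\<lambda>L. if L = K then a else 0)"
  by (simp add: mon_def fun_eq_iff Std_sorted)

lemma mon_eq_ser_l: "K \<in> Std r s \<Longrightarrow> mon (scl R) vp K a = ser_l (scl R) (\<lambda>L. if L = K then 1 else 0) a"
  by (auto simp: mon_Std ser_l_def fun_eq_iff)

lemma indicator_pow_ser: "K \<in> Std r s \<Longrightarrow> (\<lambda>L. if L = K then c else 0) \<in> pow_ser r s"
  by (auto simp: pow_ser_def)

lemma mon_Rt: "K \<in> Std r s \<Longrightarrow> mon (scl R) vp K a \<in> Rt"
  by (simp add: mon_eq_ser_l ser_l_Rt indicator_pow_ser)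

lemma eq_sum_mon:
  assumes "finite S" "S \<subseteq> Std r s" "\<And>K. \<phi> K \<noteq> 0 \<Longrightarrow> K \<in> S"
  shows "\<phi> = (\<Sum>K\<in>S. mon (scl R) vp K (\<phi> K))"
proof
  fix L
  have "(\<Sum>K\<in>S. mon (scl R) vp K (\<phi> K)) L = (\<Sum>K\<in>S. if K = L then \<phi> L else 0)"
    unfolding sum_fun_apply using assms(2) by (intro sum.cong) (auto simp: mon_Std)
  then show "\<phi> L = (\<Sum>K\<in>S. mon (scl R) vp K (\<phi> K)) L"
    using assms by (auto simp: sum.delta)
qed

lemma mon_add: "K \<in> Std r s \<Longrightarrow> mon (scl R) vp K (a + b) = mon (scl R) vp K a + mon (scl R) vp K b"
  and mon_scale: "K \<in> Std r s \<Longrightarrow> mon (scl R) vp K (scl R c a) = fsc (scl R) c (mon (scl R) vp K a)"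
  and mon_zero: "K \<in> Std r s \<Longrightarrow> mon (scl R) vp K 0 = 0"
  by (auto simp: mon_Std fun_eq_iff)

text \<open>Classes y_M a homogeneous in degree and in parity. Shifting the parity of
  \<open>a\<close> by that of \<open>M\<close> gives the product parity \<open>p\<close>.\<close>

definition deg_gens :: "int \<Rightarrow> bit \<Rightarrow> 'b set" where
  "deg_gens j p = {\<pi> (mon (scl R) vp M a) | M a. M \<in> Std r s \<and> a \<in> gr (j - 2 * int (length M)) \<inter> par R (p + lpar vp M)}"

text \<open>The components of R are spanned by elements of pure parity, so coefficients of pure
  parity suffice. These are the ones for which the bracket formula is given.\<close>

lemma deg_A_span: "deg A j = A.span (\<Union>p. deg_gens j p)"
proof -
  let ?S = "{mon (scl R) vp M a | M a. M \<in> Std r s \<and> a \<in> gr (j - 2 * int (length M))}"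
  have "deg A j = A.span (\<pi> ` ?S)"
    unfolding deg_A
    by (rule lin_on_image_span[OF Fn.module_axioms A.module_axioms lin_on_\<pi> subspace_Rt]) (auto simp: mon_Rt)
  also have "\<dots> = A.span (\<Union>p. deg_gens j p)"
  proof (rule A.span_eq[THEN iffD2], rule conjI)
    show "(\<Union>p. deg_gens j p) \<subseteq> A.span (\<pi> ` ?S)"
      unfolding deg_gens_def by (intro UN_least subsetI A.span_base) blast
    show "\<pi> ` ?S \<subseteq> A.span (\<Union>p. deg_gens j p)"
    proof
      fix x assume "x \<in> \<pi> ` ?S"
      then obtain M a where M: "M \<in> Std r s" and a: "a \<in> gr (j - 2 * int (length M))"
        and x: "x = \<pi> (mon (scl R) vp M a)" by blast
      have "a \<in> R.span (\<Union>q. gr (j - 2 * int (length M)) \<inter> par R q)"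
        using a gr_homogeneous by simp
      then show "x \<in> A.span (\<Union>p. deg_gens j p)"
        unfolding x
      proof (induction rule: R.span_induct_alt)
        case base
        show ?case unfolding mon_zero[OF M] \<pi>_0 by (rule A.span_zero)
      next
        case (step c a b)
        then obtain q where "a \<in> gr (j - 2 * int (length M)) \<inter> par R ((q + lpar vp M) + lpar vp M)"
          by (metis UN_E bit_add_self(1) add.assoc add.right_neutral)
        then have "\<pi> (mon (scl R) vp M a) \<in> (\<Union>p. deg_gens j p)" unfolding deg_gens_def using M by blast
        moreover have "\<pi> (mon (scl R) vp M (scl R c a + b)) = scl A c (\<pi> (mon (scl R) vp M a)) + \<pi> (mon (scl R) vp M b)"
          by (simp only: mon_add[OF M] mon_scale[OF M] \<pi>_add \<pi>_scale mon_Rt[OF M] Fn.subspace_scale[OF subspace_Rt])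
        ultimately show ?case using step(2) by (simp only: A.span_add A.span_scale A.span_base)
      qed
    qed
  qed
  finally show ?thesis .
qed

lemma subspace_deg_A [simp, intro]: "A.subspace (deg A j)"
  by (simp add: deg_A_span)

lemma deg_gens_par: "x \<in> deg_gens j p \<Longrightarrow> x \<in> par A p"
proof -
  assume "x \<in> deg_gens j p"
  then obtain M a where M: "M \<in> Std r s" and a: "a \<in> par R (p + lpar vp M)"
    and x: "x = \<pi> (mon (scl R) vp M a)" unfolding deg_gens_def by blast
  have "mon (scl R) vp M a K \<in> par R (p + lpar vp K)" for K
    using a R.subspace_0[OF R.subspace_par] by (simp add: mon_Std M)
  then show ?thesis unfolding x par_A using mon_Rt[OF M] by blast
qed

section \<open>Derivatives in y_i and their descent to the quotient\<close>

lemma dy_add: "dy (scl R) r s i (\<phi> + \<psi>) = dy (scl R) r s i \<phi> + dy (scl R) r s i \<psi>"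
  and dy_scale: "dy (scl R) r s i (fsc (scl R) c \<phi>) = fsc (scl R) c (dy (scl R) r s i \<phi>)"
  and dy_0: "dy (scl R) r s i 0 = 0"
  by (auto simp: dy_def fun_eq_iff R.scale_right_distrib mult.commute)

lemma dy_ser_l: "dy (scl R) r s i (ser_l (scl R) g a) = ser_l (scl R) (dy (*) r s i g) a"
  by (auto simp: dy_def ser_l_def fun_eq_iff)

lemma dy_Rt: assumes "\<phi> \<in> Rt" shows "dy (scl R) r s i \<phi> \<in> Rt"
  using assms unfolding Rtilde_def
proof (induction rule: Fn.span_induct_alt)
  case base
  show ?case unfolding dy_0 by (rule Fn.span_zero)
next
  case (step c x y)
  then obtain g a where x: "x = ser_l (scl R) g a" by blast
  have "dy (*) r s i g \<in> pow_ser r s" by (simp add: dy_def pow_ser_def)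
  then have "dy (scl R) r s i x \<in> Fn.span {ser_l (scl R) g a |g a. g \<in> pow_ser r s}"
    unfolding x dy_ser_l by (intro Fn.span_base) blast
  then show ?case using step(2) by (simp only: dy_add dy_scale Fn.span_add Fn.span_scale)
qed

lemma dy_pder:
  assumes i: "i \<in> {1..r + s}"
  shows "dy (scl R) r s j (pder (scl R) r i (der R i) \<phi>) =
    fsc (scl R) (ksgn (vp i * vp j)) (pder (scl R) r i (der R i) (dy (scl R) r s j \<phi>))"
proof -
  interpret D: Vector_Spaces.linear "scl R" "scl R" "der R i" by (rule linear_der[OF i])
  have "lpar vp (sort (j # L)) = vp j + lpar vp L" for L by (simp only: lpar_sort lpar_simps)
  then show ?thesis
    by (auto simp: dy_def pder_def fun_eq_iff D.zero D.scale distrib_left ksgn_add mult_ac)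
qed

text \<open>Both orders evaluate \<phi> at the same sorted word with the same product of
  multiplicities; only the sign of ordering the two letters differs. For a repeated odd letter both
  sides vanish.\<close>

lemma dy_dy:
  assumes i: "i \<in> {1..r + s}" and j: "j \<in> {1..r + s}"
  shows "dy (scl R) r s j (dy (scl R) r s i \<phi>) =
    fsc (scl R) (ksgn (vp i * vp j)) (dy (scl R) r s i (dy (scl R) r s j \<phi>))"
proof
  fix L
  have expand: "dy (scl R) r s b (dy (scl R) r s a \<phi>) L =
      scl R (ssgn vp (a # b # L) * of_nat ((count_list L b + 1) * (count_list (b # L) a + 1))) (\<phi> (sort (a # b # L)))"
    if L: "L \<in> Std r s" and ab: "a \<in> {1..r + s}" "b \<in> {1..r + s}" for a b
  proof (cases "sort (b # L) \<in> Std r s")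
    case True
    have c: "count_list (sort (b # L)) a = count_list (b # L) a"
      by (metis count_mset mset_sort)
    have g: "ssgn vp (a # sort (b # L)) * ssgn vp (b # L) = (ssgn vp (a # b # L) :: 'k)"
      by (rule ssgn_Cons_sort)
    have t: "sort (a # sort (b # L)) = sort (a # b # L)" by (rule sorted_sort_Cons)
    have "ssgn vp (b # L) * of_nat (count_list L b + 1) * (ssgn vp (a # sort (b # L)) * of_nat (count_list (b # L) a + 1)) =
      (ssgn vp (a # b # L) * of_nat ((count_list L b + 1) * (count_list (b # L) a + 1)) :: 'k)"
      unfolding g[symmetric] of_nat_mult by (simp only: mult_ac)
    then show ?thesis
      by (simp only: dy_def if_True L True R.scale_scale c t)
  next
    case False
    then have "ssgn vp (b # L) = (0::'k)" using sort_Cons_Std[OF L ab(2)] by (simp add: ssgn_Cons)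
    then show ?thesis using L unfolding dy_def by (simp add: ssgn_Cons[of _ a])
  qed
  show "dy (scl R) r s j (dy (scl R) r s i \<phi>) L =
    fsc (scl R) (ksgn (vp i * vp j)) (dy (scl R) r s i (dy (scl R) r s j \<phi>)) L"
  proof (cases "L \<in> Std r s")
    case L: True
    have s: "sort (i # j # L) = sort (j # i # L)"
      by (rule properties_for_sort) (simp_all add: sorted_insort)
    have e: "ssgn vp (i # j # L) * of_nat ((count_list L j + 1) * (count_list (j # L) i + 1)) =
      ksgn (vp i * vp j) * (ssgn vp (j # i # L) * of_nat ((count_list L i + 1) * (count_list (i # L) j + 1)) :: 'k)"
    proof (cases "i = j")
      case True
      then show ?thesis by (cases "vp j") (simp_all add: ssgn_Cons)
    next
      case False
      then show ?thesis
        by (cases "vp i"; cases "vp j") (auto simp: ssgn_Cons mult_ac)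
    qed
    show ?thesis
      by (simp only: fsc_apply expand[OF L i j] expand[OF L j i] s e R.scale_scale)
  qed (simp add: dy_def)
qed

text \<open>The derivatives supercommute with the defining relations: the relation for
  \<open>i\<close> at \<psi> goes to plus or minus the relation for \<open>i\<close> at the
  derivative of \<psi>.\<close>

lemma dy_kernel:
  assumes j: "j \<in> {1..r + s}" and "\<phi> \<in> Rt" "\<pi> \<phi> = 0"
  shows "\<pi> (dy (scl R) r s j \<phi>) = 0"
proof -
  let ?f = "\<lambda>i \<phi>. pder (scl R) r i (der R i) \<phi> + dy (scl R) r s i \<phi>"
  let ?W = "Fn.span (\<Union>i\<in>{1..r + s}. ?f i ` Rt)"
  have "\<phi> \<in> ?W" using assms(2,3) \<pi>_kernel by blast
  then have "dy (scl R) r s j \<phi> \<in> ?W"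
  proof (induction rule: Fn.span_induct_alt)
    case base
    show ?case unfolding dy_0 by (rule Fn.span_zero)
  next
    case (step c x y)
    then obtain i \<psi> where i: "i \<in> {1..r + s}" and \<psi>: "\<psi> \<in> Rt" and x: "x = ?f i \<psi>" by blast
    have "dy (scl R) r s j x = fsc (scl R) (ksgn (vp i * vp j)) (?f i (dy (scl R) r s j \<psi>))"
      unfolding x by (simp only: dy_add dy_pder[OF i] dy_dy[OF i j] Fn.scale_right_distrib)
    moreover have "?f i (dy (scl R) r s j \<psi>) \<in> ?W"
      using i dy_Rt[OF \<psi>] by (intro Fn.span_base) blast
    ultimately show ?case using step(2) by (simp only: dy_add dy_scale Fn.span_add Fn.span_scale)
  qed
  then show ?thesis using \<pi>_kernel by blast
qed

text \<open>\<open>dyA\<close> is defined through a chosen preimage; stability of the kernel makes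
  the choice immaterial.\<close>

lemma dyA_\<pi>:
  assumes j: "j \<in> {1..r + s}" and \<phi>: "\<phi> \<in> Rt"
  shows "dyA r s R \<pi> j (\<pi> \<phi>) = \<pi> (dy (scl R) r s j \<phi>)"
proof -
  define \<psi> where "\<psi> = inv_into Rt \<pi> (\<pi> \<phi>)"
  have \<psi>: "\<psi> \<in> Rt" "\<pi> \<psi> = \<pi> \<phi>"
    unfolding \<psi>_def using \<phi> by (simp_all add: inv_into_into f_inv_into_f)
  have d: "\<psi> - \<phi> \<in> Rt" using \<psi> \<phi> by (rule_tac Fn.subspace_diff) auto
  have "\<pi> (dy (scl R) r s j (\<psi> - \<phi>)) = 0"
    using dy_kernel[OF j d] \<psi> \<phi> by (simp add: \<pi>_diff)
  then have "\<pi> (dy (scl R) r s j ((\<psi> - \<phi>) + \<phi>)) = \<pi> (dy (scl R) r s j \<phi>)"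
    unfolding dy_add using \<phi> d by (simp add: \<pi>_add dy_Rt)
  then show ?thesis by (simp add: dyA_def \<psi>_def)
qed

section \<open>Brackets, gradation and filtration of the annihilation algebra\<close>

lemma dy_right_support:
  assumes g: "\<And>K. g K \<noteq> (0::'k) \<Longrightarrow> K \<in> Std r s \<and> length K + m = n"
    and nz: "fold (dy_right r s) J g K \<noteq> 0"
  shows "K \<in> Std r s \<and> length K + (length J + m) = n"
  using assms
proof (induction J arbitrary: g m)
  case (Cons i J)
  \<comment> \<open>One more derivative shortens the words in the support by one, so the counter
    \<open>m\<close> of derivatives already applied goes up.\<close>
  have "L \<in> Std r s \<and> length L + Suc m = n" if "dy_right r s i g L \<noteq> 0" for L
  proof -
    have "L \<in> Std r s" "g (sort (i # L)) \<noteq> 0"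
      using that by (auto simp: dy_right_def dy_def split: if_splits)
    then show ?thesis using Cons.prems(1)[of "sort (i # L)"] by simp
  qed
  then have "K \<in> Std r s \<and> length K + (length J + Suc m) = n"
  proof (rule Cons.IH)
    show "fold (dy_right r s) J (dy_right r s i g) K \<noteq> 0" using Cons.prems(2) by simp
  qed
  then show ?case by simp
qed auto

text \<open>Each derivative in \<open>y\<^sub>i\<close> lowers the length by one and \<open>(a\<^sub>J b)\<close> has degree
  \<open>d + e + 2 \<ell>(J)\<close>, which balances.\<close>
lemma brk_A_mon:
  assumes M: "M \<in> Std r s" and N: "N \<in> Std r s"
    and a: "a \<in> gr d \<inter> par R p" and b: "b \<in> gr e \<inter> par R q"
  shows "brk A (\<pi> (mon (scl R) vp M a)) (\<pi> (mon (scl R) vp N b)) \<in>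
    deg A (d + e + 2 * int (length M) + 2 * int (length N))"
proof -
  let ?j = "d + e + 2 * int (length M) + 2 * int (length N)"
  let ?S = "{mon (scl R) vp M a | M a. M \<in> Std r s \<and> a \<in> gr (?j - 2 * int (length M))}"
  define g where "g = (\<lambda>L. if L = M then 1 else (0::'k))"
  \<comment> \<open>The bracket formula has the second series on the right of \<open>b\<close>; the
    sign in \<open>h\<close> compensates for moving y_N past \<open>b\<close>.\<close>
  define h where "h = (\<lambda>L. if L = N then ksgn (q * lpar vp N) else (0::'k))"
  have gh: "g \<in> pow_ser r s" "h \<in> pow_ser r s"
    using M N by (auto simp: g_def h_def intro: indicator_pow_ser)
  have ga: "mon (scl R) vp M a = ser_l (scl R) g a"
    using M by (simp only: mon_eq_ser_l g_def)
  have hb: "mon (scl R) vp N b = ser_r (scl R) r q b h"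
    unfolding mon_Std[OF N] ser_r_def h_def by (auto simp: fun_eq_iff)
  have mem: "fsc (scl R) (1 / fK J) (ser_prod (scl R) r s q' (fold (dy_right r s) J g) (kprod R J a b) h) \<in> Fn.span ?S"
    for J q'
  proof -
    let ?c = "kprod R J a b"
    let ?T = "{L \<in> Std r s. length L + length J = length M + length N}"
    define \<phi> where "\<phi> = fsc (scl R) (1 / fK J) (ser_prod (scl R) r s q' (fold (dy_right r s) J g) ?c h)"
    have supp: "L \<in> ?T" if "\<phi> L \<noteq> 0" for L
    proof -
      let ?f = "\<lambda>(M, N). ssgn vp (M @ N) * ksgn (q' * lpar vp N) * fold (dy_right r s) J g M * h N"
      have "(\<Sum>x | fst x \<in> Std r s \<and> snd x \<in> Std r s \<and> sort (fst x @ snd x) = L. ?f x) \<noteq> 0"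
        using that by (auto simp: \<phi>_def ser_prod_def case_prod_unfold)
      then obtain M' N' where *: "M' \<in> Std r s" "N' \<in> Std r s" "sort (M' @ N') = L" "?f (M', N') \<noteq> 0"
        by (elim sum.not_neutral_contains_not_neutral) (auto simp del: sort_append)
      then have nz: "ssgn vp (M' @ N') \<noteq> (0::'k)" "fold (dy_right r s) J g M' \<noteq> 0" "h N' \<noteq> 0" by auto
      have "length M' + (length J + 0) = length M"
      proof (rule dy_right_support[OF _ nz(2), THEN conjunct2])
        show "K \<in> Std r s \<and> length K + 0 = length M" if "g K \<noteq> 0" for K
          using that M unfolding g_def by (cases "K = M") simp_all
      qed
      moreover have "N' = N" using nz(3) unfolding h_def by meson
      moreover have "length L = length M' + length N'" unfolding *(3)[symmetric] length_sort by simp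
      moreover have "L \<in> Std r s" using Std_append_ssgn[OF *(1,2) nz(1)] *(3) by simp
      ultimately show ?thesis by simp
    qed
    have fin: "finite ?T"
      by (rule finite_subset[OF _ finite_Std_le[of r s "length M + length N"]]) auto
    have "\<phi> = (\<Sum>L\<in>?T. mon (scl R) vp L (\<phi> L))"
      by (rule eq_sum_mon) (use fin supp in auto)
    also have "\<dots> \<in> Fn.span ?S"
    proof (rule Fn.span_sum, rule Fn.span_base)
      fix L assume L: "L \<in> ?T"
      have "?c \<in> gr (d + e + 2 * int (length J))"
        unfolding kprod_def using a b by (intro R.subspace_scale lbr_gr) auto
      also have "d + e + 2 * int (length J) = ?j - 2 * int (length L)" using L by auto
      finally have "\<phi> L \<in> gr (?j - 2 * int (length L))"
        unfolding \<phi>_def fsc_apply ser_prod_def by (intro R.subspace_scale) auto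
      then show "mon (scl R) vp L (\<phi> L) \<in> ?S" using L by blast
    qed
    finally show ?thesis unfolding \<phi>_def .
  qed
  have "(\<Sum>J | kprod R J a b \<noteq> 0. fsc (scl R) (1 / fK J)
          (ser_prod (scl R) r s (p + q + lpar vp J) (fold (dy_right r s) J g) (kprod R J a b) h)) \<in> Fn.span ?S"
    by (rule Fn.span_sum) (rule mem)
  then show ?thesis
    unfolding deg_A ga hb using a b gh by (subst brk_A) auto
qed

lemma brk_A_deg:
  assumes "x \<in> deg A i" "y \<in> deg A j" shows "brk A x y \<in> deg A (i + j)"
proof -
  have gens: "brk A u w \<in> deg A (i + j)" if u_in: "u \<in> deg_gens i p" and w_in: "w \<in> deg_gens j q" for u w p q
  proof -
    obtain M a where M: "M \<in> Std r s" and a: "a \<in> gr (i - 2 * int (length M)) \<inter> par R (p + lpar vp M)"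
      and u: "u = \<pi> (mon (scl R) vp M a)" using u_in unfolding deg_gens_def by blast
    obtain N b where N: "N \<in> Std r s" and b: "b \<in> gr (j - 2 * int (length N)) \<inter> par R (q + lpar vp N)"
      and w: "w = \<pi> (mon (scl R) vp N b)" using w_in unfolding deg_gens_def by blast
    show ?thesis using brk_A_mon[OF M N a b] unfolding u w by (simp add: algebra_simps)
  qed
  have "brk A u y \<in> deg A (i + j)" if "u \<in> deg_gens i p" for u p
    using assms(2) unfolding deg_A_span[of j]
  proof (induction rule: A.span_induct_alt)
    case base
    show ?case unfolding A.brk_simps by (rule A.subspace_0) simp
  next
    case (step c x z)
    then obtain q where "x \<in> deg_gens j q" by blast
    then show ?case using step(2) gens[OF that]
      by (simp add: A.brk_add A.subspace_add A.subspace_scale)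
  qed
  note left = this
  show ?thesis using assms(1) unfolding deg_A_span[of i]
  proof (induction rule: A.span_induct_alt)
    case base
    show ?case unfolding A.brk_simps by (rule A.subspace_0) simp
  next
    case (step c x z)
    then obtain q where "x \<in> deg_gens i q" by blast
    then show ?case using step(2) left
      by (simp add: A.brk_add A.subspace_add A.subspace_scale)
  qed
qed

lemma deg_fil_A: assumes "i \<le> j" shows "deg A j \<subseteq> fil A i"
proof -
  let ?V = "{\<phi> \<in> Rt. \<forall>M. \<phi> M \<in> R.span (\<Union>d\<in>{i - 2 * int (length M)..}. gr d)}"
  let ?S = "{mon (scl R) vp M a | M a. M \<in> Std r s \<and> a \<in> gr (j - 2 * int (length M))}"
  have "Fn.subspace ?V"
    by (rule Fn.subspaceI)
      (auto intro: R.span_add R.span_scale R.span_zero Fn.subspace_add Fn.subspace_scale Fn.subspace_0)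
  moreover have "?S \<subseteq> ?V"
  proof clarify
    fix M a assume M: "M \<in> Std r s" and a: "a \<in> gr (j - 2 * int (length M))"
    have "a \<in> R.span (\<Union>d\<in>{i - 2 * int (length M)..}. gr d)"
      using a assms by (intro R.span_base UN_I[of "j - 2 * int (length M)"]) auto
    then show "mon (scl R) vp M a \<in> Rt \<and> (\<forall>K. mon (scl R) vp M a K \<in> R.span (\<Union>d\<in>{i - 2 * int (length K)..}. gr d))"
      using M mon_Rt[OF M, of a] by (simp add: mon_Std R.span_zero)
  qed
  ultimately have "Fn.span ?S \<subseteq> ?V" by (rule Fn.span_minimal[rotated])
  then show ?thesis unfolding deg_A fil_A by (rule image_mono)
qed

text \<open>For \<open>a\<close> of degree d only finitely many y_K a have negative degree. These
  are split off as elements of negative components, and the rest of the series lies in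
  \<open>fil A 0\<close>.\<close>

lemma fil_deg_span_A: "A.span (fil A 0 \<union> (\<Union>j\<in>{..<0}. deg A j)) = UNIV"
proof -
  let ?U = "A.span (fil A 0 \<union> (\<Union>j\<in>{..<0}. deg A j))"
  have gen: "\<pi> (ser_l (scl R) g a) \<in> ?U" if g: "g \<in> pow_ser r s" and a: "a \<in> gr d" for g a d
  proof -
    let ?T = "{K \<in> Std r s. d + 2 * int (length K) < 0}"
    define g' where "g' = (\<lambda>K. if d + 2 * int (length K) < 0 then 0 else g K)"
    have g': "g' \<in> pow_ser r s" using g by (simp add: g'_def pow_ser_def)
    have fin: "finite ?T"
      by (rule finite_subset[OF _ finite_Std_le[of r s "nat (- d)"]]) auto
    have eq: "ser_l (scl R) g a = ser_l (scl R) g' a + (\<Sum>K\<in>?T. mon (scl R) vp K (scl R (g K) a))"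
    proof
      fix L
      have "(\<Sum>K\<in>?T. mon (scl R) vp K (scl R (g K) a)) L = (\<Sum>K\<in>?T. if K = L then scl R (g L) a else 0)"
        unfolding sum_fun_apply by (intro sum.cong) (auto simp: mon_Std)
      also have "\<dots> = (if L \<in> ?T then scl R (g L) a else 0)" using fin by simp
      finally show "ser_l (scl R) g a L = (ser_l (scl R) g' a + (\<Sum>K\<in>?T. mon (scl R) vp K (scl R (g K) a))) L"
        using g by (auto simp: ser_l_def g'_def pow_ser_def)
    qed
    have Tm: "mon (scl R) vp K (scl R (g K) a) \<in> Rt" if "K \<in> ?T" for K using that mon_Rt by blast
    have "\<pi> (\<Sum>K\<in>X. mon (scl R) vp K (scl R (g K) a)) \<in> ?U \<and> (\<Sum>K\<in>X. mon (scl R) vp K (scl R (g K) a)) \<in> Rt"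
      if "finite X" "X \<subseteq> ?T" for X
      using that
    proof (induction X)
      case empty
      show ?case unfolding sum.empty \<pi>_0 by (intro conjI A.span_zero Fn.subspace_0 subspace_Rt)
    next
      case (insert K X)
      have K: "K \<in> Std r s" "d + 2 * int (length K) < 0" using insert.prems by auto
      have "mon (scl R) vp K (scl R (g K) a) \<in> {mon (scl R) vp M b |M b. M \<in> Std r s \<and> b \<in> gr (d + 2 * int (length K) - 2 * int (length M))}"
        using K(1) a
        by (intro CollectI exI[of _ K] exI[of _ "scl R (g K) a"] conjI refl) (simp_all add: R.subspace_scale)
      then have "\<pi> (mon (scl R) vp K (scl R (g K) a)) \<in> deg A (d + 2 * int (length K))"
        unfolding deg_A by (intro imageI Fn.span_base)
      then have "\<pi> (mon (scl R) vp K (scl R (g K) a)) \<in> ?U"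
        using K(2) by (intro A.span_base UnI2 UN_I[of "d + 2 * int (length K)"]) auto
      then show ?case
        using insert mon_Rt[OF K(1)]
        by (simp only: sum.insert[OF insert(1,2)] insert_subset \<pi>_add A.span_add Fn.subspace_add[OF subspace_Rt] simp_thms)
    qed
    then have 2: "\<pi> (\<Sum>K\<in>?T. mon (scl R) vp K (scl R (g K) a)) \<in> ?U" "(\<Sum>K\<in>?T. mon (scl R) vp K (scl R (g K) a)) \<in> Rt"
      using fin by blast+
    have "ser_l (scl R) g' a M \<in> R.span (\<Union>d\<in>{0 - 2 * int (length M)..}. gr d)" for M
    proof (cases "d + 2 * int (length M) < 0")
      case True
      then show ?thesis by (simp add: ser_l_def g'_def R.span_zero)
    next
      case False
      then show ?thesis unfolding ser_l_def using a
        by (intro R.span_scale R.span_base UN_I[of d]) auto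
    qed
    then have "\<pi> (ser_l (scl R) g' a) \<in> fil A 0" unfolding fil_A using ser_l_Rt[OF g'] by blast
    then have "\<pi> (ser_l (scl R) g' a) \<in> ?U" by (intro A.span_base UnI1)
    then show ?thesis unfolding eq using 2 ser_l_Rt[OF g'] by (simp only: \<pi>_add A.span_add)
  qed
  have gen2: "\<pi> (ser_l (scl R) g a) \<in> ?U" if g: "g \<in> pow_ser r s" for g a
  proof -
    have "a \<in> R.span (\<Union>d. gr d)" using span_gr by simp
    then show ?thesis
    proof (induction rule: R.span_induct_alt)
      case base
      have "ser_l (scl R) g 0 = 0" by (simp add: ser_l_def fun_eq_iff)
      then show ?case by (simp only: \<pi>_0 A.span_zero)
    next
      case (step c x y)
      have "ser_l (scl R) g (scl R c x + y) = fsc (scl R) c (ser_l (scl R) g x) + ser_l (scl R) g y"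
        by (simp add: ser_l_def fun_eq_iff R.scale_right_distrib mult.commute)
      moreover have "\<pi> (ser_l (scl R) g x) \<in> ?U" using step(1) gen[OF g] by blast
      ultimately show ?case using step(2)
        by (simp only: \<pi>_add \<pi>_scale ser_l_Rt[OF g] Fn.subspace_scale[OF subspace_Rt] A.span_add A.span_scale)
    qed
  qed
  have "\<pi> \<phi> \<in> ?U \<and> \<phi> \<in> Rt" if "\<phi> \<in> Fn.span {ser_l (scl R) g a | g a. g \<in> pow_ser r s}" for \<phi>
    using that
  proof (induction rule: Fn.span_induct_alt)
    case base
    show ?case unfolding \<pi>_0 by (intro conjI A.span_zero Fn.subspace_0 subspace_Rt)
  next
    case (step c x y)
    then have "\<pi> x \<in> ?U" "x \<in> Rt" using gen2 ser_l_Rt by blast+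
    then show ?case using step(2)
      by (simp only: \<pi>_add \<pi>_scale Fn.subspace_scale[OF subspace_Rt] Fn.subspace_add[OF subspace_Rt] A.span_add A.span_scale simp_thms)
  qed
  then have "\<pi> ` Rt \<subseteq> ?U" unfolding Rtilde_def by blast
  then show ?thesis using \<pi>_surj by blast
qed

end

section \<open>The algebra \<open>\<g>(R)\<close>\<close>

locale conformal_g = conformal_annihilation r s R gr A \<pi>
  for r s :: nat
    and R :: "('k::field_char_0, 'a::ab_group_add) lie_conf"
    and gr :: "int \<Rightarrow> 'a set"
    and A :: "('k, 'b::ab_group_add) lie_super"
    and \<pi> :: "(nat list \<Rightarrow> 'a) \<Rightarrow> 'b" +
  fixes G :: "('k, 'g::ab_group_add) lie_super"
    and \<rho> :: "('b \<Rightarrow> 'b) \<Rightarrow> 'b \<Rightarrow> 'g"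
    and cl :: "(nat list \<Rightarrow> 'a) \<Rightarrow> 'g" and dd :: "nat \<Rightarrow> 'g"
  assumes depth: "cond_depth A" and odd: "cond_odd A" and ad: "cond_ad r s R A \<pi>"
    and g_alg: "g_algebra r s R A \<pi> G \<rho>"
    and cl_def: "cl = (\<lambda>\<phi>. \<rho> 0 (\<pi> \<phi>))" and dd_def: "dd = (\<lambda>i. \<rho> (dyA r s R \<pi> i) 0)"
begin

sublocale G: lie_super_alg G
  using g_alg[unfolded g_algebra_def Let_def, THEN conjunct1] by unfold_locales

sublocale AFn: vector_space "fsc (scl A)"
  by (rule vector_space_fsc) (rule A.vector_space_axioms)

abbreviation "X \<equiv> {1..r + s}"
abbreviation "D \<equiv> Dspace r s R A \<pi>"
abbreviation "y \<equiv> y_el r R cl"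

lemmas g_conjs = g_alg[unfolded g_algebra_def Let_def, THEN conjunct2]

lemma \<rho>_add: "\<delta> \<in> D \<Longrightarrow> \<delta>' \<in> D \<Longrightarrow> \<rho> (\<delta> + \<delta>') (x + x') = \<rho> \<delta> x + \<rho> \<delta>' x'"
  using g_conjs[THEN conjunct1] by blast

lemma \<rho>_scale: "\<delta> \<in> D \<Longrightarrow> \<rho> (fsc (scl A) c \<delta>) (scl A c x) = scl G c (\<rho> \<delta> x)"
  using g_conjs[THEN conjunct2, THEN conjunct1] by blast

lemma \<rho>_surj: "{\<rho> \<delta> x | \<delta> x. \<delta> \<in> D} = UNIV"
  by (rule g_conjs[THEN conjunct2, THEN conjunct2, THEN conjunct1])

lemma \<rho>_eq_0_iff: "\<delta> \<in> D \<Longrightarrow> \<rho> \<delta> x = 0 \<longleftrightarrow> x \<in> deg A (- 2) \<and> \<delta> = - brk A x"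
  using g_conjs[THEN conjunct2, THEN conjunct2, THEN conjunct2, THEN conjunct1] by blast

lemma par_G: "par G p = {\<rho> \<delta> x | \<delta> x. \<delta> \<in> Dpar r s R A \<pi> p \<and> x \<in> par A p}"
  using g_conjs[THEN conjunct2, THEN conjunct2, THEN conjunct2, THEN conjunct2, THEN conjunct1] by (rule spec)

lemma brk_\<rho>: "\<delta> \<in> Dpar r s R A \<pi> p \<Longrightarrow> x \<in> par A p \<Longrightarrow> \<delta>' \<in> Dpar r s R A \<pi> q \<Longrightarrow> x' \<in> par A q \<Longrightarrow>
    brk G (\<rho> \<delta> x) (\<rho> \<delta>' x') = \<rho> (\<delta> \<circ> \<delta>' - fsc (scl A) (ksgn (p * q)) (\<delta>' \<circ> \<delta>))
      (brk A x x' + \<delta> x' - scl A (ksgn (p * q)) (\<delta>' x))"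
  using g_conjs[THEN conjunct2, THEN conjunct2, THEN conjunct2, THEN conjunct2, THEN conjunct2, THEN conjunct1]
  by blast

lemma deg_G: "deg G j = \<rho> 0 ` deg A j"
  using g_conjs[THEN conjunct2, THEN conjunct2, THEN conjunct2, THEN conjunct2, THEN conjunct2, THEN conjunct2,
      THEN conjunct1] by (rule spec)

lemma fil_G: "fil G j = \<rho> 0 ` fil A j"
  using g_conjs[THEN conjunct2, THEN conjunct2, THEN conjunct2, THEN conjunct2, THEN conjunct2, THEN conjunct2,
      THEN conjunct2] by (rule spec)

lemma subspace_D: "AFn.subspace D"
  unfolding Dspace_def by (rule AFn.subspace_span)

lemma zero_D: "0 \<in> D"
  by (rule AFn.subspace_0[OF subspace_D])

lemma zero_Dpar: "0 \<in> Dpar r s R A \<pi> p"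
  unfolding Dpar_def by (rule AFn.span_zero)

lemma dyA_D: "i \<in> X \<Longrightarrow> dyA r s R \<pi> i \<in> D"
  unfolding Dspace_def by (rule AFn.span_base) (rule imageI)

lemma dyA_Dpar: "i \<in> X \<Longrightarrow> dyA r s R \<pi> i \<in> Dpar r s R A \<pi> (vp i)"
  unfolding Dpar_def by (rule AFn.span_base) (rule imageI, simp)

lemma linear_\<rho>_0: "Vector_Spaces.linear (scl A) (scl G) (\<rho> 0)"
proof (unfold_locales)
  show "\<rho> 0 (x + y) = \<rho> 0 x + \<rho> 0 y" for x y
    using \<rho>_add[OF zero_D zero_D] unfolding add_0_left .
  show "\<rho> 0 (scl A c x) = scl G c (\<rho> 0 x)" for c x
    using \<rho>_scale[OF zero_D] unfolding AFn.scale_zero_right .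
qed

sublocale \<rho>0: Vector_Spaces.linear "scl A" "scl G" "\<rho> 0"
  by (rule linear_\<rho>_0)

lemma \<rho>0_par: "x \<in> par A p \<Longrightarrow> \<rho> 0 x \<in> par G p"
  unfolding par_G using zero_Dpar by blast

lemma \<rho>_split: assumes "\<delta> \<in> D" shows "\<rho> \<delta> x = \<rho> \<delta> 0 + \<rho> 0 x"
  using \<rho>_add[OF assms zero_D, of 0 x] unfolding add_0_left add_0_right .

lemma lin_on_\<rho>: "lin_on D (fsc (scl A)) (scl G) (\<lambda>\<delta>. \<rho> \<delta> 0)"
  unfolding lin_on_def
proof (intro conjI ballI allI)
  show "\<rho> (\<delta> + \<delta>') 0 = \<rho> \<delta> 0 + \<rho> \<delta>' 0" if "\<delta> \<in> D" "\<delta>' \<in> D" for \<delta> \<delta>'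
    using \<rho>_add[OF that, of 0 0] unfolding add_0_left .
  show "\<rho> (fsc (scl A) c \<delta>) 0 = scl G c (\<rho> \<delta> 0)" if "\<delta> \<in> D" for c \<delta>
    using \<rho>_scale[OF that, of c 0] unfolding A.scale_zero_right .
qed

lemma brk_\<rho>_0: "brk G (\<rho> 0 x) (\<rho> 0 z) = \<rho> 0 (brk A x z)"
proof -
  have hom: "brk G (\<rho> 0 x) (\<rho> 0 z) = \<rho> 0 (brk A x z)" if "x \<in> par A p" "z \<in> par A q" for x z p q
  proof -
    have 1: "(0::'b \<Rightarrow> 'b) \<circ> (0::'b \<Rightarrow> 'b) - fsc (scl A) (ksgn (p * q)) (0 \<circ> 0) = 0"
      by (rule ext) simp
    have 2: "brk A x z + (0::'b \<Rightarrow> 'b) z - scl A (ksgn (p * q)) ((0::'b \<Rightarrow> 'b) x) = brk A x z" by simp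
    show ?thesis
      using brk_\<rho>[OF zero_Dpar that(1) zero_Dpar that(2)] unfolding 1 2 .
  qed
  obtain x0 x1 where x: "x0 \<in> par A 0" "x1 \<in> par A 1" "x = x0 + x1" using A.par_decomp[of x] by auto
  obtain z0 z1 where z: "z0 \<in> par A 0" "z1 \<in> par A 1" "z = z0 + z1" using A.par_decomp[of z] by auto
  show ?thesis unfolding x z
    by (simp only: \<rho>0.add G.brk_add A.brk_add hom[OF x(1) z(1)] hom[OF x(1) z(2)] hom[OF x(2) z(1)] hom[OF x(2) z(2)])
qed

lemma deg_brk: "x \<in> deg G i \<Longrightarrow> z \<in> deg G j \<Longrightarrow> brk G x z \<in> deg G (i + j)"
  unfolding deg_G using brk_A_deg brk_\<rho>_0 by force

lemma subspace_deg: "G.subspace (deg G j)"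
  unfolding deg_G by (rule \<rho>0.subspace_image[OF subspace_deg_A])

lemma deg_below: "j < - 3 \<Longrightarrow> deg G j = {0}"
  using depth unfolding deg_G cond_depth_def by (simp add: \<rho>0.zero)

lemma deg_fil: "i \<le> j \<Longrightarrow> deg G j \<subseteq> fil G i"
  unfolding deg_G fil_G by (rule image_mono[OF deg_fil_A])

lemma deg_odd: "j \<in> {- 1, - 3} \<Longrightarrow> deg G j \<subseteq> par G 1"
  using odd \<rho>0_par unfolding deg_G cond_odd_def by blast

text \<open>In the quotient z is identified with ad z, so its class is that of the derivation it
  induces.\<close>

lemma \<rho>0_brk: assumes "z \<in> deg A (- 2)" shows "\<rho> 0 z = \<rho> (brk A z) 0"
proof -
  have D: "brk A z \<in> D" using ad assms unfolding cond_ad_def by blast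
  then have mD: "- brk A z \<in> D" by (rule AFn.subspace_neg[OF subspace_D])
  have "\<rho> (- brk A z) z = 0" using \<rho>_eq_0_iff[OF mD] assms by simp
  moreover have "\<rho> (brk A z + - brk A z) (0 + z) = \<rho> (brk A z) 0 + \<rho> (- brk A z) z"
    by (rule \<rho>_add[OF D mD])
  moreover have "brk A z + - brk A z = 0" by simp
  ultimately show ?thesis by (simp only: add_0_left add_0_right)
qed

lemma deg_m2: "deg G (- 2) = (\<lambda>\<delta>. \<rho> \<delta> 0) ` D"
proof -
  have "deg G (- 2) = (\<lambda>z. \<rho> (brk A z) 0) ` deg A (- 2)"
    unfolding deg_G by (rule image_cong[OF refl \<rho>0_brk])
  also have "\<dots> = (\<lambda>\<delta>. \<rho> \<delta> 0) ` (brk A ` deg A (- 2))" by (simp only: image_image)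
  also have "brk A ` deg A (- 2) = D" using ad unfolding cond_ad_def by blast
  finally show ?thesis .
qed

lemma deg_m2_span: "deg G (- 2) = G.span (dd ` X)"
proof -
  have "(\<lambda>\<delta>. \<rho> \<delta> 0) ` AFn.span (dyA r s R \<pi> ` X) = G.span ((\<lambda>\<delta>. \<rho> \<delta> 0) ` dyA r s R \<pi> ` X)"
    by (rule lin_on_image_span[OF AFn.module_axioms G.module_axioms lin_on_\<rho> subspace_D])
      (auto intro: dyA_D)
  then show ?thesis unfolding deg_m2 Dspace_def dd_def by (simp only: image_image)
qed

lemma dd_deg: "i \<in> X \<Longrightarrow> dd i \<in> deg G (- 2)"
  unfolding deg_m2_span by (rule G.span_base) (rule imageI)

lemma dd_par: "i \<in> X \<Longrightarrow> dd i \<in> par G (vp i)"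
  unfolding par_G dd_def using dyA_Dpar A.subspace_0[OF A.subspace_par] by blast

text \<open>The class of a pure derivation is zero only if the derivation is -ad 0 = 0, so the
  independence of the derivations passes to the quotient.\<close>

lemma dd_sum_eq_0:
  assumes "(\<Sum>i\<in>X. scl G (c i) (dd i)) = 0" "i \<in> X" shows "c i = 0"
proof -
  have sum: "\<rho> (\<Sum>i\<in>Y. fsc (scl A) (c i) (dyA r s R \<pi> i)) 0 = (\<Sum>i\<in>Y. scl G (c i) (dd i)) \<and>
      (\<Sum>i\<in>Y. fsc (scl A) (c i) (dyA r s R \<pi> i)) \<in> D" if "finite Y" "Y \<subseteq> X" for Y
    using that
  proof (induction Y)
    case empty
    show ?case unfolding sum.empty using zero_D \<rho>0.zero by blast
  next
    case (insert i Y)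
    have i: "dyA r s R \<pi> i \<in> D" using insert.prems dyA_D by blast
    then have ci: "fsc (scl A) (c i) (dyA r s R \<pi> i) \<in> D" by (rule AFn.subspace_scale[OF subspace_D])
    have "\<rho> (fsc (scl A) (c i) (dyA r s R \<pi> i)) 0 = scl G (c i) (dd i)"
      using \<rho>_scale[OF i, of "c i" 0] unfolding A.scale_zero_right dd_def .
    then show ?case
      using insert \<rho>_add[OF ci, of "\<Sum>i\<in>Y. fsc (scl A) (c i) (dyA r s R \<pi> i)" 0 0] AFn.subspace_add[OF subspace_D ci]
      by (simp only: sum.insert insert_subset add_0_left simp_thms)
  qed
  let ?\<delta> = "\<Sum>i\<in>X. fsc (scl A) (c i) (dyA r s R \<pi> i)"
  have "\<rho> ?\<delta> 0 = 0" "?\<delta> \<in> D" using sum[of X] assms(1) by auto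
  then have "?\<delta> = - brk A 0" using \<rho>_eq_0_iff by blast
  also have "\<dots> = 0" by (rule ext) simp
  finally have 0: "?\<delta> = 0" .
  have inj: "inj_on (dyA r s R \<pi>) X" and ind: "AFn.independent (dyA r s R \<pi> ` X)"
    using ad unfolding cond_ad_def basis_of_def by blast+
  have "(\<Sum>\<delta>\<in>dyA r s R \<pi> ` X. fsc (scl A) (c (inv_into X (dyA r s R \<pi>) \<delta>)) \<delta>) = ?\<delta>"
    by (subst sum.reindex[OF inj]) (rule sum.cong, auto simp only: o_apply inv_into_f_f[OF inj])
  with 0 have "(\<Sum>\<delta>\<in>dyA r s R \<pi> ` X. fsc (scl A) (c (inv_into X (dyA r s R \<pi>) \<delta>)) \<delta>) = 0" by (simp only:)
  then have "c (inv_into X (dyA r s R \<pi>) (dyA r s R \<pi> i)) = 0"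
    using AFn.independentD[OF ind, of "dyA r s R \<pi> ` X" "\<lambda>\<delta>. c (inv_into X (dyA r s R \<pi>) \<delta>)" "dyA r s R \<pi> i"] assms(2)
    by blast
  then show ?thesis by (simp only: inv_into_f_f[OF inj assms(2)])
qed

text \<open>Infinite sums of nonnegative degree are absorbed by \<open>fil G 0\<close>, and depth 3
  leaves only three negative components.\<close>

lemma span_G: "G.span (fil G 0 \<union> deg G (- 1) \<union> deg G (- 2) \<union> deg G (- 3)) = UNIV"
proof -
  let ?U = "G.span (fil G 0 \<union> deg G (- 1) \<union> deg G (- 2) \<union> deg G (- 3))"
  have neg: "deg G j \<subseteq> ?U" if "j < 0" for j
  proof (cases "j < - 3")
    case True
    then show ?thesis using deg_below G.span_zero by simp
  next
    case False
    then have "j = - 1 \<or> j = - 2 \<or> j = - 3" using that by auto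
    then show ?thesis by (auto intro: G.span_base)
  qed
  have fil: "fil G 0 \<subseteq> ?U" by (auto intro: G.span_base)
  have "range (\<rho> 0) = G.span (\<rho> 0 ` (fil A 0 \<union> (\<Union>j\<in>{..<0}. deg A j)))"
    unfolding fil_deg_span_A[symmetric] by (rule \<rho>0.span_image[symmetric])
  also have "\<dots> \<subseteq> ?U"
  proof (rule G.span_minimal[OF _ G.subspace_span])
    show "\<rho> 0 ` (fil A 0 \<union> (\<Union>j\<in>{..<0}. deg A j)) \<subseteq> ?U"
      using neg fil unfolding deg_G[symmetric] fil_G image_Un image_UN
      by (simp only: Un_subset_iff UN_subset_iff lessThan_iff simp_thms fil_G[symmetric] deg_G[symmetric] Ball_def) blast
  qed
  finally have *: "\<rho> 0 x \<in> ?U" for x by blast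
  have "x \<in> ?U" for x
  proof -
    obtain \<delta> z where \<delta>: "\<delta> \<in> D" "x = \<rho> \<delta> z" using \<rho>_surj by blast
    have "\<rho> \<delta> 0 \<in> deg G (- 2)" unfolding deg_m2 using \<delta>(1) by (rule imageI)
    then have "\<rho> \<delta> 0 \<in> ?U" by (auto intro: G.span_base)
    then show ?thesis unfolding \<delta>(2) \<rho>_split[OF \<delta>(1), of z] by (intro G.span_add *)
  qed
  then show ?thesis by blast
qed

section \<open>Homogeneous generators and their brackets with derivatives\<close>

definition g_gens :: "int \<Rightarrow> bit \<Rightarrow> 'g set" where
  "g_gens j p = {y M a | M a. M \<in> Std r s \<and> a \<in> gr (j - 2 * int (length M)) \<inter> par R (p + lpar vp M)}"

lemma g_gens_eq: "g_gens j p = \<rho> 0 ` deg_gens j p"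
  unfolding g_gens_def deg_gens_def y_el_def unfolding cl_def by blast

lemma deg_span: "deg G j = G.span (\<Union>p. g_gens j p)"
  unfolding deg_G deg_A_span g_gens_eq \<rho>0.span_image[symmetric] image_UN ..

lemma g_gens_par: "x \<in> g_gens j p \<Longrightarrow> x \<in> par G p"
  unfolding g_gens_eq using deg_gens_par \<rho>0_par by blast

lemma g_gens_deg: "x \<in> g_gens j p \<Longrightarrow> x \<in> deg G j"
  unfolding deg_span by (rule G.span_base) blast

lemma y_gens:
  assumes "K \<in> Std r s" "a \<in> gr d \<inter> par R p"
  shows "y K a \<in> g_gens (d + 2 * int (length K)) (p + lpar vp K)"
proof -
  have "p + lpar vp K + lpar vp K = p" by (simp only: add.assoc bit_add_self add_0_right)
  then show ?thesis unfolding g_gens_def using assms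
    by (intro CollectI exI[of _ K] exI[of _ a] conjI refl) simp_all
qed

lemma deg_decomp:
  assumes "x \<in> deg G j"
  obtains x0 x1 where "x0 \<in> G.span (g_gens j 0)" "x1 \<in> G.span (g_gens j 1)" "x = x0 + x1"
proof -
  have "x \<in> G.span (g_gens j 0 \<union> g_gens j 1)"
    using assms unfolding deg_span UNIV_bit by simp
  then show ?thesis unfolding G.span_Un using that by blast
qed

lemma span_g_gens: "G.span (g_gens j p) \<subseteq> deg G j \<inter> par G p"
  by (rule G.span_minimal) (auto intro: g_gens_deg g_gens_par G.subspace_inter subspace_deg)

text \<open>The decompositions by degree and by parity are compatible: subtracting the summand of
  parity \<open>p\<close> leaves a vector in both parity components. Statements about homogeneous
  elements thereby reduce to the \<open>y K a\<close>.\<close>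

lemma deg_par_span: "deg G j \<inter> par G p = G.span (g_gens j p)"
proof
  show "deg G j \<inter> par G p \<subseteq> G.span (g_gens j p)"
  proof
    fix x assume x: "x \<in> deg G j \<inter> par G p"
    then obtain x0 x1 where *: "x0 \<in> G.span (g_gens j 0)" "x1 \<in> G.span (g_gens j 1)" "x = x0 + x1"
      using deg_decomp by blast
    have x01: "x0 \<in> par G 0" "x1 \<in> par G 1" using * span_g_gens by blast+
    show "x \<in> G.span (g_gens j p)"
    proof (cases "p = 0")
      case True
      then have "x - x0 \<in> par G 0" using x x01 by (blast intro: G.subspace_diff G.subspace_par)
      then have "x1 = 0" using G.par_disjoint[OF x01(2), of 0] * by simp
      then show ?thesis using * True by simp
    next
      case False
      then have p: "p = 1" using bit_eq_1_iff by blast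
      then have "x - x1 \<in> par G 1" using x x01 by (blast intro: G.subspace_diff G.subspace_par)
      then have "x0 = 0" using G.par_disjoint[OF x01(1), of 1] * by simp
      then show ?thesis using * p by simp
    qed
  qed
qed (rule span_g_gens)

lemma deg_decomp_par:
  assumes "x \<in> deg G j"
  shows "\<exists>x0\<in>deg G j \<inter> par G 0. \<exists>x1\<in>deg G j \<inter> par G 1. x = x0 + x1"
  using deg_decomp[OF assms] unfolding deg_par_span by metis

lemma brk_dd_cl:
  assumes i: "i \<in> X" and \<phi>: "\<phi> \<in> Rt" "\<pi> \<phi> \<in> par A q"
  shows "brk G (dd i) (cl \<phi>) = cl (dy (scl R) r s i \<phi>)"
proof -
  let ?\<delta> = "dyA r s R \<pi> i"
  have \<delta>0: "?\<delta> 0 = 0"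
    using dyA_\<pi>[OF i Fn.subspace_0[OF subspace_Rt]] unfolding dy_0 \<pi>_0 .
  have z: "(0::'b) \<in> par A (vp i)" by (rule A.subspace_0[OF A.subspace_par])
  have "?\<delta> \<circ> (0::'b \<Rightarrow> 'b) - fsc (scl A) (ksgn (vp i * q)) (0 \<circ> ?\<delta>) = 0"
    by (rule ext) (simp add: \<delta>0)
  moreover have "brk A 0 (\<pi> \<phi>) + ?\<delta> (\<pi> \<phi>) - scl A (ksgn (vp i * q)) ((0::'b \<Rightarrow> 'b) 0) = ?\<delta> (\<pi> \<phi>)" by simp
  ultimately have "brk G (dd i) (cl \<phi>) = \<rho> 0 (?\<delta> (\<pi> \<phi>))"
    using brk_\<rho>[OF dyA_Dpar[OF i] z zero_Dpar \<phi>(2)] unfolding dd_def cl_def by (simp only:)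
  then show ?thesis unfolding dyA_\<pi>[OF i \<phi>(1)] cl_def .
qed

lemma cl_scale: "\<phi> \<in> Rt \<Longrightarrow> cl (fsc (scl R) c \<phi>) = scl G c (cl \<phi>)"
  by (simp only: cl_def \<pi>_scale \<rho>0.scale)

text \<open>Differentiating y_K in y_i removes one \<open>i\<close>: the sign moves it to the front,
  and \<open>count_list (remove1 i K) i + 1\<close> is its multiplicity in \<open>K\<close>.\<close>

lemma brk_dd_y:
  assumes i: "i \<in> X" and K: "K \<in> Std r s" and a: "a \<in> gr d \<inter> par R p"
  shows "brk G (dd i) (y K a) = (if i \<in> set K
    then scl G (ssgn vp (i # remove1 i K) * of_nat (count_list (remove1 i K) i + 1)) (y (remove1 i K) a) else 0)"
proof -
  let ?N = "remove1 i K" and ?c = "ssgn vp (i # remove1 i K) * of_nat (count_list (remove1 i K) i + 1) :: 'k"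
  have N: "?N \<in> Std r s" by (rule remove1_Std[OF K])
  have "y K a \<in> \<rho> 0 ` deg_gens (d + 2 * int (length K)) (p + lpar vp K)"
    using y_gens[OF K a] unfolding g_gens_eq .
  have "mon (scl R) vp K a L \<in> par R (p + lpar vp K + lpar vp L)" for L
  proof -
    have "p + lpar vp K + lpar vp K = p" by (simp only: add.assoc bit_add_self add_0_right)
    then show ?thesis using a R.subspace_0[OF R.subspace_par] unfolding mon_Std[OF K] by (cases "L = K") simp_all
  qed
  then have par: "\<pi> (mon (scl R) vp K a) \<in> par A (p + lpar vp K)"
    unfolding par_A using mon_Rt[OF K] by blast
  have dy: "dy (scl R) r s i (mon (scl R) vp K a) =
      (if i \<in> set K then fsc (scl R) ?c (mon (scl R) vp ?N a) else 0)"
  proof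
    fix L
    show "dy (scl R) r s i (mon (scl R) vp K a) L = (if i \<in> set K then fsc (scl R) ?c (mon (scl R) vp ?N a) else 0) L"
    proof (cases "L \<in> Std r s")
      case L: True
      show ?thesis
      proof (cases "i \<in> set K \<and> L = ?N")
        case True
        then have "sort (i # L) = K" using sort_Cons_eq_iff[OF K L] by blast
        then show ?thesis unfolding dy_def if_P[OF L] mon_Std[OF K] mon_Std[OF N]
          using True by (simp del: sort_key_simps)
      next
        case False
        then have "sort (i # L) \<noteq> K" using sort_Cons_eq_iff[OF K L] by blast
        then show ?thesis unfolding dy_def if_P[OF L] mon_Std[OF K] mon_Std[OF N]
          using False by (simp del: sort_key_simps)
      qed
    next
      case False
      then have "L \<noteq> ?N" using N by blast
      then show ?thesis using False unfolding dy_def mon_Std[OF N] by simp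
    qed
  qed
  have "brk G (dd i) (y K a) = cl (dy (scl R) r s i (mon (scl R) vp K a))"
    unfolding y_el_def by (rule brk_dd_cl[OF i mon_Rt[OF K] par])
  also have "\<dots> = (if i \<in> set K then scl G ?c (y ?N a) else 0)"
  proof (cases "i \<in> set K")
    case True
    then show ?thesis unfolding dy if_P[OF True] y_el_def by (rule_tac cl_scale[OF mon_Rt[OF N]])
  next
    case False
    then show ?thesis unfolding dy if_not_P[OF False] cl_def \<pi>_0 by (rule_tac \<rho>0.zero)
  qed
  finally show ?thesis .
qed

end

section \<open>Words in the induced module\<close>

text \<open>The sign is left open because only the vanishing of values will be transported. The
  prefix \<open>us\<close> lets the insertion move under the head of the list.\<close>

lemma insort_antisymmetric:
  fixes \<phi> :: "'i::linorder list \<Rightarrow> 'b::ab_group_add"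
  assumes swap: "\<And>us a b vs. length us + length vs + 2 = k \<Longrightarrow> set us \<union> {a, b} \<union> set vs \<subseteq> I \<Longrightarrow>
      \<phi> (us @ a # b # vs) = - \<phi> (us @ b # a # vs)"
    and "length us + length xs + 1 = k" "set us \<union> insert a (set xs) \<subseteq> I"
  shows "\<phi> (us @ a # xs) = \<phi> (us @ insort a xs) \<or> \<phi> (us @ a # xs) = - \<phi> (us @ insort a xs)"
  using assms(2,3)
proof (induction xs arbitrary: us)
  case (Cons x xs)
  show ?case
  proof (cases "a \<le> x")
    case False
    have "\<phi> (us @ a # x # xs) = - \<phi> (us @ x # a # xs)"
      by (rule swap) (use Cons.prems in auto)
    moreover have "\<phi> ((us @ [x]) @ a # xs) = \<phi> ((us @ [x]) @ insort a xs) \<or>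
        \<phi> ((us @ [x]) @ a # xs) = - \<phi> ((us @ [x]) @ insort a xs)"
      by (rule Cons.IH) (use Cons.prems in auto)
    ultimately show ?thesis using False by auto
  qed simp
qed simp

lemma sort_antisymmetric:
  fixes \<phi> :: "'i::linorder list \<Rightarrow> 'b::ab_group_add"
  assumes swap: "\<And>us a b vs. length us + length vs + 2 = k \<Longrightarrow> set us \<union> {a, b} \<union> set vs \<subseteq> I \<Longrightarrow>
      \<phi> (us @ a # b # vs) = - \<phi> (us @ b # a # vs)"
    and "length us + length xs = k" "set us \<union> set xs \<subseteq> I"
  shows "\<phi> (us @ xs) = \<phi> (us @ sort xs) \<or> \<phi> (us @ xs) = - \<phi> (us @ sort xs)"
  using assms(2,3)
proof (induction xs arbitrary: us)
  case (Cons x xs)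
  have 1: "\<phi> ((us @ [x]) @ xs) = \<phi> ((us @ [x]) @ sort xs) \<or> \<phi> ((us @ [x]) @ xs) = - \<phi> ((us @ [x]) @ sort xs)"
    by (rule Cons.IH) (use Cons.prems in auto)
  have 2: "\<phi> (us @ x # sort xs) = \<phi> (us @ insort x (sort xs)) \<or> \<phi> (us @ x # sort xs) = - \<phi> (us @ insort x (sort xs))"
    by (rule insort_antisymmetric[where \<phi> = \<phi> and k = k and I = I, OF swap]) (use Cons.prems in auto)
  have s: "us @ insort x (sort xs) = us @ sort (x # xs)" by simp
  have "(us @ [x]) @ xs = us @ x # xs" "(us @ [x]) @ sort xs = us @ x # sort xs" by simp_all
  then show ?case using 1 2 unfolding s by (metis minus_minus)
qed simp

lemma sorted_not_distinct:
  "sorted xs \<Longrightarrow> \<not> distinct xs \<Longrightarrow> \<exists>us a vs. xs = us @ a # a # vs"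
proof (induction xs)
  case (Cons x xs)
  show ?case
  proof (cases "distinct xs")
    case True
    then have x: "x \<in> set xs" using Cons.prems by simp
    then obtain z zs where xs: "xs = z # zs" by (cases xs) auto
    have "z \<le> x" using Cons.prems(1) x unfolding xs by auto
    moreover have "x \<le> z" using Cons.prems(1) unfolding xs by simp
    ultimately have "x # xs = [] @ x # x # zs" unfolding xs by simp
    then show ?thesis by blast
  next
    case False
    then obtain us a vs where "xs = us @ a # a # vs" using Cons by auto
    then have "x # xs = (x # us) @ a # a # vs" by simp
    then show ?thesis by blast
  qed
qed simp

text \<open>Sorting puts two equal letters side by side; exchanging them changes nothing but the
  sign.\<close>

lemma antisymmetric_not_distinct:
  fixes \<phi> :: "'i::linorder list \<Rightarrow> 'b::ab_group_add"
  assumes swap: "\<And>us a b vs. length us + length vs + 2 = k \<Longrightarrow> set us \<union> {a, b} \<union> set vs \<subseteq> I \<Longrightarrow>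
      \<phi> (us @ a # b # vs) = - \<phi> (us @ b # a # vs)"
    and two: "\<And>x::'b. x = - x \<Longrightarrow> x = 0"
    and "length xs = k" "set xs \<subseteq> I" "\<not> distinct xs"
  shows "\<phi> xs = 0"
proof -
  have "\<not> distinct (sort xs)" using assms(5) by simp
  then obtain us a vs where s: "sort xs = us @ a # a # vs"
    using sorted_not_distinct[OF sorted_sort] by blast
  have "length (sort xs) = k" "set (sort xs) \<subseteq> I" using assms(3,4) by simp_all
  then have "\<phi> (sort xs) = - \<phi> (sort xs)" unfolding s by (intro swap) auto
  then have "\<phi> (sort xs) = 0" by (rule two)
  moreover have "\<phi> ([] @ xs) = \<phi> ([] @ sort xs) \<or> \<phi> ([] @ xs) = - \<phi> ([] @ sort xs)"
    by (rule sort_antisymmetric[where \<phi> = \<phi> and k = k and I = I, OF swap]) (use assms(3,4) in auto)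
  ultimately show ?thesis by auto
qed

lemma (in module) span_indexed:
  assumes "x \<in> span (d ` I)" "finite I"
  shows "\<exists>c. x = (\<Sum>i\<in>I. scale (c i) (d i))"
  using assms(1)
proof (induction rule: span_induct_alt)
  case base
  show ?case by (rule exI[of _ "\<lambda>_. 0"]) simp
next
  case (step c x y)
  then obtain i u where i: "i \<in> I" "x = d i" and u: "y = (\<Sum>i\<in>I. scale (u i) (d i))" by blast
  have "scale c x = (\<Sum>j\<in>I. if j = i then scale c (d j) else 0)"
    using i assms(2) by simp
  also have "\<dots> = (\<Sum>j\<in>I. scale (if j = i then c else 0) (d j))"
    by (rule sum.cong) auto
  finally have "scale c x + y = (\<Sum>j\<in>I. scale ((if j = i then c else 0) + u j) (d j))"
    unfolding u by (simp only: scale_left_distrib sum.distrib)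
  then show ?case by (rule exI[where x = "\<lambda>j. (if j = i then c else 0) + u j"])
qed

locale conformal_induced = conformal_g r s R gr A \<pi> G \<rho> cl dd
  for r s :: nat
    and R :: "('k::field_char_0, 'a::ab_group_add) lie_conf"
    and gr :: "int \<Rightarrow> 'a set"
    and A :: "('k, 'b::ab_group_add) lie_super"
    and \<pi> :: "(nat list \<Rightarrow> 'a) \<Rightarrow> 'b"
    and G :: "('k, 'g::ab_group_add) lie_super"
    and \<rho> :: "('b \<Rightarrow> 'b) \<Rightarrow> 'b \<Rightarrow> 'g"
    and cl :: "(nat list \<Rightarrow> 'a) \<Rightarrow> 'g" and dd :: "nat \<Rightarrow> 'g" +
  fixes n l :: nat
    and F :: "('k, 'f::ab_group_add, 'g) lie_mod"
    and v :: "nat \<Rightarrow> 'f" and pv :: "nat \<Rightarrow> bit"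
    and d :: "nat \<Rightarrow> 'g"
    and M :: "('k, 'm::ab_group_add, 'g) lie_mod"
    and \<iota> :: "'f \<Rightarrow> 'm"
  assumes F_module: "lie_module G (fil G 0) F" and F_pos: "\<forall>x\<in>fil G 1. \<forall>w. act F x w = 0"
    and car_F: "car F = UNIV"
    and F_basis: "basis_of (scl F) UNIV l v" and v_par: "\<forall>h\<in>{1..l}. v h \<in> par F (pv h)"
    and d_basis: "basis_of (scl G) (module.span (scl G) (deg G (- 1) \<union> deg G (- 3))) n d"
    and induced: "induced_module G (fil G 0) F M \<iota>"
begin

abbreviation "\<Omega> \<equiv> {1..n}"

lemma M_module: "lie_module G UNIV M"
  and car_M: "car M = UNIV"
  and linear_\<iota>: "Vector_Spaces.linear (scl F) (scl M) \<iota>"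
  and \<iota>_par: "w \<in> par F q \<Longrightarrow> \<iota> w \<in> par M q"
  using induced[unfolded induced_module_def, THEN conjunct1]
    induced[unfolded induced_module_def, THEN conjunct2, THEN conjunct1]
    induced[unfolded induced_module_def, THEN conjunct2, THEN conjunct2, THEN conjunct1]
    induced[unfolded induced_module_def, THEN conjunct2, THEN conjunct2, THEN conjunct2, THEN conjunct1]
  by blast+

sublocale F: superspace F
  using F_module[unfolded lie_module_def, THEN conjunct1] by unfold_locales

sublocale M: superspace M
  using M_module[unfolded lie_module_def, THEN conjunct1] by unfold_locales

sublocale \<iota>: Vector_Spaces.linear "scl F" "scl M" \<iota>
  by (rule linear_\<iota>)

lemma act_right: "act M x (u + w) = act M x u + act M x w" "act M x (scl M c u) = scl M c (act M x u)"
  using M_module[unfolded lie_module_def, THEN conjunct2, THEN conjunct1] unfolding lin_on_def car_M by blast+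

lemma act_left: "act M (x + z) u = act M x u + act M z u" "act M (scl G c x) u = scl M c (act M x u)"
  using M_module[unfolded lie_module_def, THEN conjunct2, THEN conjunct2, THEN conjunct1]
  unfolding lin_on_def car_M by blast+

lemma act_par: "x \<in> par G p \<Longrightarrow> u \<in> par M q \<Longrightarrow> act M x u \<in> par M (p + q)"
  using M_module[unfolded lie_module_def, THEN conjunct2, THEN conjunct2, THEN conjunct2, THEN conjunct1] by blast

lemma act_commute: "x \<in> par G p \<Longrightarrow> z \<in> par G q \<Longrightarrow>
    act M x (act M z u) = act M (brk G x z) u + scl M (ksgn (p * q)) (act M z (act M x u))"
  using M_module[unfolded lie_module_def, THEN conjunct2, THEN conjunct2, THEN conjunct2, THEN conjunct2]
  unfolding car_M by (metis IntI UNIV_I diff_add_cancel)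

lemma act_linear: "Vector_Spaces.linear (scl M) (scl M) (act M x)"
  by unfold_locales (simp_all add: act_right)

lemma act_linear_left: "Vector_Spaces.linear (scl G) (scl M) (\<lambda>x. act M x u)"
  by unfold_locales (simp_all add: act_left)

lemma act_0 [simp]: "act M x 0 = 0" "act M 0 u = 0"
  using act_right(2)[of x 0 0] act_left(2)[of 0 0 u] by simp_all

lemma act_sum_left: "act M (sum f S) u = (\<Sum>i\<in>S. act M (f i) u)"
proof -
  interpret l: Vector_Spaces.linear "scl G" "scl M" "\<lambda>x. act M x u" by (rule act_linear_left)
  show ?thesis by (rule l.sum)
qed

lemma act_sum: "act M x (sum f S) = (\<Sum>i\<in>S. act M x (f i))"
proof -
  interpret l: Vector_Spaces.linear "scl M" "scl M" "act M x" by (rule act_linear)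
  show ?thesis by (rule l.sum)
qed

abbreviation "ev \<equiv> \<lambda>u. \<Sum>w | u w \<noteq> 0. scl M (u w) (foldr (act M) (fst w) (\<iota> (snd w)))"

lemma ev_surj: "\<exists>u. finite {w. u w \<noteq> 0} \<and> ev u = m"
  and ev_kernel: "finite {w. u w \<noteq> 0} \<Longrightarrow> ev u = 0 \<longleftrightarrow> u \<in> module.span (fsc (*)) (ind_rels G (fil G 0) F)"
  using induced[unfolded induced_module_def Let_def, THEN conjunct2, THEN conjunct2, THEN conjunct2, THEN conjunct2]
  by blast+

text \<open>The relation that moves \<open>x\<close> from the word into F is one of the generators
  of the kernel of \<open>ev\<close>.\<close>

lemma act_\<iota>: assumes x: "x \<in> fil G 0" shows "act M x (\<iota> w) = \<iota> (act F x w)"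
proof -
  interpret fk: vector_space "fsc ((*) :: 'k \<Rightarrow> 'k \<Rightarrow> 'k) :: 'k \<Rightarrow> ('g list \<times> 'f \<Rightarrow> 'k) \<Rightarrow> _"
    by (rule vector_space_fsc) (unfold_locales, simp_all add: algebra_simps)
  let ?a = "([x], w)" and ?b = "([], act F x w)"
  let ?u = "word ?a - word ?b :: 'g list \<times> 'f \<Rightarrow> 'k"
  have ab: "?a \<noteq> ?b" by simp
  have S: "{w. ?u w \<noteq> 0} = {?a, ?b}" using ab by (auto simp: word_def)
  have "?u \<in> ind_rels G (fil G 0) F"
    unfolding ind_rels_def using x by (intro UnI2) (metis (mono_tags, lifting) append_Nil mem_Collect_eq)
  then have "?u \<in> fk.span (ind_rels G (fil G 0) F)" by (rule fk.span_base)
  then have "ev ?u = 0" using ev_kernel[of ?u] S by simp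
  then show ?thesis using ab unfolding S by (simp add: word_def)
qed

lemma d_span: "G.span (d ` \<Omega>) = G.span (deg G (- 1) \<union> deg G (- 3))"
  using d_basis unfolding basis_of_def by blast

lemma d_sum: "x \<in> G.span (deg G (- 1) \<union> deg G (- 3)) \<Longrightarrow> \<exists>c. x = (\<Sum>i\<in>\<Omega>. scl G (c i) (d i))"
  unfolding d_span[symmetric] by (rule G.span_indexed) simp_all

lemma dd_sum: "x \<in> deg G (- 2) \<Longrightarrow> \<exists>c. x = (\<Sum>i\<in>X. scl G (c i) (dd i))"
  unfolding deg_m2_span by (rule G.span_indexed) simp_all

lemma d_O: "i \<in> \<Omega> \<Longrightarrow> d i \<in> G.span (deg G (- 1) \<union> deg G (- 3))"
  unfolding d_span[symmetric] by (rule G.span_base) simp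

lemma d_par: assumes "i \<in> \<Omega>" shows "d i \<in> par G 1"
proof -
  have "G.span (deg G (- 1) \<union> deg G (- 3)) \<subseteq> par G 1"
    by (rule G.span_minimal) (use deg_odd[of "- 1"] deg_odd[of "- 3"] in simp_all)
  then show ?thesis using d_O[OF assms] by blast
qed

text \<open>The vectors of the basis \<open>d\<close> may mix the degrees -1 and -3, so degree
  arguments are carried out in spans of two components.\<close>

lemma brk_O:
  assumes z: "z \<in> G.span (deg G (- 1) \<union> deg G (- 3))" and x: "x \<in> deg G j"
  shows "brk G x z \<in> G.span (deg G (j - 1) \<union> deg G (j - 3))" "brk G z x \<in> G.span (deg G (j - 1) \<union> deg G (j - 3))"
proof -
  have base: "brk G x u \<in> deg G (j - 1) \<union> deg G (j - 3)" "brk G u x \<in> deg G (j - 1) \<union> deg G (j - 3)"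
    if "u \<in> deg G (- 1) \<union> deg G (- 3)" for u
    using that deg_brk[OF x, of u "- 1"] deg_brk[OF x, of u "- 3"] deg_brk[of u "- 1", OF _ x] deg_brk[of u "- 3", OF _ x]
    by (auto simp: add.commute)
  show "brk G x z \<in> G.span (deg G (j - 1) \<union> deg G (j - 3))"
    using z
  proof (induction rule: G.span_induct_alt)
    case (step c u w)
    then show ?case using base(1) by (simp add: G.brk_add G.span_add G.span_scale G.span_base)
  qed (simp add: G.span_zero)
  show "brk G z x \<in> G.span (deg G (j - 1) \<union> deg G (j - 3))"
    using z
  proof (induction rule: G.span_induct_alt)
    case (step c u w)
    then show ?case using base(2) by (simp add: G.brk_add G.span_add G.span_scale G.span_base)
  qed (simp add: G.span_zero)
qed

lemma brk_d_dd:
  assumes "i \<in> \<Omega>" "j \<in> X" shows "brk G (d i) (dd j) \<in> G.span (deg G (- 1) \<union> deg G (- 3))"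
proof -
  have "brk G (d i) (dd j) \<in> G.span (deg G (- 3) \<union> deg G (- 5))"
    using brk_O(2)[OF d_O[OF assms(1)] dd_deg[OF assms(2)]] by simp
  also have "\<dots> \<subseteq> G.span (deg G (- 1) \<union> deg G (- 3))"
    by (rule G.span_minimal[OF _ G.subspace_span])
      (auto simp: deg_below G.span_zero intro: G.span_base)
  finally show ?thesis .
qed

text \<open>The possible degrees are -2, -4 and -6, and the depth leaves only -2. As the
  \<open>d i\<close> are odd, they anticommute up to derivatives.\<close>

lemma brk_d_d:
  assumes "i \<in> \<Omega>" "j \<in> \<Omega>" shows "brk G (d i) (d j) \<in> deg G (- 2)"
  using d_O[OF assms(1)]
proof (induction rule: G.span_induct_alt)
  case base
  show ?case unfolding G.brk_simps by (rule G.subspace_0[OF subspace_deg])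
next
  case (step c u w)
  have "brk G u (d j) \<in> deg G (- 2)"
  proof (cases "u \<in> deg G (- 1)")
    case True
    have "brk G u (d j) \<in> G.span (deg G (- 2) \<union> deg G (- 4))"
      using brk_O(1)[OF d_O[OF assms(2)] True] by simp
    also have "\<dots> \<subseteq> deg G (- 2)"
      by (rule G.span_minimal[OF _ subspace_deg]) (auto simp: deg_below G.subspace_0[OF subspace_deg])
    finally show ?thesis .
  next
    case False
    then have "u \<in> deg G (- 3)" using step(1) by blast
    then have "brk G u (d j) \<in> G.span (deg G (- 4) \<union> deg G (- 6))"
      using brk_O(1)[OF d_O[OF assms(2)], of u "- 3"] by simp
    also have "\<dots> \<subseteq> deg G (- 2)"
      by (rule G.span_minimal[OF _ subspace_deg]) (auto simp: deg_below G.subspace_0[OF subspace_deg])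
    finally show ?thesis .
  qed
  then show ?case using step(2)
    by (simp only: G.brk_add G.brk_simps G.subspace_add[OF subspace_deg] G.subspace_scale[OF subspace_deg])
qed

section \<open>Words in the \<open>d i\<close> and the filtration by their length\<close>

definition dword :: "nat list \<Rightarrow> 'f \<Rightarrow> 'm" where
  "dword js w = foldr (\<lambda>i. act M (d i)) js (\<iota> w)"

lemma dword_simps [simp]: "dword [] w = \<iota> w" "dword (i # js) w = act M (d i) (dword js w)"
  by (simp_all add: dword_def)

lemma dI_dword: "dI M \<iota> d v J h = dword (sorted_list_of_set J) (v h)"
  by (simp add: dI_def dword_def)

text \<open>The filtration of \<open>M\<close> by the number of factors \<open>d\<^sub>i\<close>: the smallest subspaces that contain the
  words of length at most \<open>m\<close> and are stable under the derivatives.\<close>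
inductive filt :: "nat \<Rightarrow> 'm \<Rightarrow> bool" for m where
  filt_zero: "filt m 0"
| filt_add: "filt m x \<Longrightarrow> filt m z \<Longrightarrow> filt m (x + z)"
| filt_scale: "filt m x \<Longrightarrow> filt m (scl M c x)"
| filt_word: "set js \<subseteq> \<Omega> \<Longrightarrow> length js \<le> m \<Longrightarrow> filt m (dword js w)"
| filt_dd: "i \<in> X \<Longrightarrow> filt m x \<Longrightarrow> filt m (act M (dd i) x)"

lemma filt_mono: "filt m x \<Longrightarrow> m \<le> m' \<Longrightarrow> filt m' x"
proof (induction rule: filt.induct)
  case (filt_word js w)
  then show ?case by (intro filt.filt_word) simp_all
qed (auto intro: filt.intros)

lemma filt_sum: "(\<And>i. i \<in> S \<Longrightarrow> filt m (f i)) \<Longrightarrow> filt m (sum f S)"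
  by (induction S rule: infinite_finite_induct) (simp_all add: filt_zero filt_add)

text \<open>Passing \<open>d i\<close> over a derivative costs a combination of the
  \<open>d k\<close>, which is again a single factor; so derivatives do not count in the
  filtration.\<close>

lemma filt_d: "filt m x \<Longrightarrow> i \<in> \<Omega> \<Longrightarrow> filt (Suc m) (act M (d i) x)"
proof (induction arbitrary: i rule: filt.induct)
  case (filt_word js w)
  have "filt (Suc m) (dword (i # js) w)" by (rule filt.filt_word) (use filt_word in auto)
  then show ?case by simp
next
  case (filt_dd j x)
  obtain c where c: "brk G (d i) (dd j) = (\<Sum>k\<in>\<Omega>. scl G (c k) (d k))"
    using d_sum[OF brk_d_dd[OF filt_dd.prems filt_dd.hyps(1)]] by blast
  have "filt (Suc m) (act M (brk G (d i) (dd j)) x)"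
    unfolding c act_sum_left act_left by (rule filt_sum) (rule filt_scale, rule filt_dd.IH)
  moreover have "filt (Suc m) (scl M (ksgn (1 * vp j)) (act M (dd j) (act M (d i) x)))"
    by (rule filt_scale, rule filt.filt_dd[OF filt_dd.hyps(1)], rule filt_dd.IH[OF filt_dd.prems])
  ultimately show ?case
    unfolding act_commute[OF d_par[OF filt_dd.prems] dd_par[OF filt_dd.hyps(1)]] by (rule filt_add)
qed (simp_all add: filt_zero filt_add filt_scale act_right)

lemma filt_prefix: "filt m x \<Longrightarrow> set us \<subseteq> \<Omega> \<Longrightarrow> filt (length us + m) (foldr (\<lambda>i. act M (d i)) us x)"
  by (induction us) (simp_all add: filt_d)

lemma filt_deg_m2: "z \<in> deg G (- 2) \<Longrightarrow> filt m x \<Longrightarrow> filt m (act M z x)"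
  using dd_sum[of z] by (auto simp: act_sum_left act_left intro!: filt_sum filt_scale filt_dd)

lemma filt_O: "z \<in> G.span (deg G (- 1) \<union> deg G (- 3)) \<Longrightarrow> filt m x \<Longrightarrow> filt (Suc m) (act M z x)"
  using d_sum[of z] by (auto simp: act_sum_left act_left intro!: filt_sum filt_scale filt_d)

text \<open>The commutation rule needs homogeneous elements. For a general \<open>x\<close> both
  parity components are handled by one predicate \<open>P\<close> closed under linear
  combinations.\<close>

lemma act_swap:
  assumes z: "z \<in> par G q"
    and P: "\<And>x z. P x \<Longrightarrow> P z \<Longrightarrow> P (x + z)" "\<And>c x. P x \<Longrightarrow> P (scl M c x)"
    and 1: "\<And>x. P (act M (brk G x z) u)" and 2: "\<And>x. P (act M z (act M x u))"
  shows "P (act M x (act M z u))"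
proof -
  obtain x0 x1 where x: "x0 \<in> par G 0" "x1 \<in> par G 1" "x = x0 + x1" using G.par_decomp[of x] by auto
  have "act M x (act M z u) = act M x0 (act M z u) + act M x1 (act M z u)" unfolding x(3) by (rule act_left)
  then show ?thesis
    unfolding act_commute[OF x(1) z] act_commute[OF x(2) z] by (simp only: P 1 2)
qed

text \<open>A double induction. Moving z past a first letter leaves [z, d i] on a shorter word,
  covered by the outer induction since z is arbitrary there; moving it past a derivative uses the
  inner induction. The empty word is settled by \<open>span_G\<close>.\<close>

lemma filt_act: "filt m x \<Longrightarrow> filt (Suc m) (act M z x)"
proof (induction m arbitrary: x z rule: less_induct)
  case (less m)
  show ?case using less.prems
  proof (induction arbitrary: z rule: filt.induct)
    case (filt_word js w)
    show ?case
    proof (cases js)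
      case Nil
      have w: "filt m (\<iota> w)" using filt.filt_word[of "[]" m w] by simp
      have "z \<in> G.span (fil G 0 \<union> deg G (- 1) \<union> deg G (- 2) \<union> deg G (- 3))" unfolding span_G by simp
      then have "filt (Suc m) (act M z (\<iota> w))"
      proof (induction rule: G.span_induct_alt)
        case base
        show ?case by (simp add: filt_zero)
      next
        case (step c x u)
        have "filt (Suc m) (act M x (\<iota> w))"
        proof -
          consider "x \<in> fil G 0" | "x \<in> deg G (- 1) \<union> deg G (- 3)" | "x \<in> deg G (- 2)" using step(1) by blast
          then show ?thesis
          proof cases
            case 1
            show ?thesis unfolding act_\<iota>[OF 1] using filt.filt_word[of "[]" "Suc m"] by simp
          next
            case 2
            then show ?thesis by (intro filt_O[OF _ w] G.span_base)
          next
            case 3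
            then show ?thesis using filt_deg_m2[OF 3 w] by (rule_tac filt_mono) auto
          qed
        qed
        then show ?case using step(2) by (simp only: act_left filt_add filt_scale)
      qed
      then show ?thesis unfolding Nil by simp
    next
      case (Cons i js')
      have i: "i \<in> \<Omega>" and js': "set js' \<subseteq> \<Omega>" and m: "length js' < m" using filt_word Cons by auto
      have X: "filt (length js') (dword js' w)" by (rule filt.filt_word[OF js']) simp
      show ?thesis unfolding Cons dword_simps
      proof (rule act_swap[OF d_par[OF i]])
        show "filt (Suc m) (act M (brk G x (d i)) (dword js' w))" for x
          by (rule filt_mono[OF less.IH[OF m X]]) (use m in simp)
        show "filt (Suc m) (act M (d i) (act M x (dword js' w)))" for x
          by (rule filt_mono[OF filt_d[OF less.IH[OF m X] i]]) (use m in simp)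
      qed (rule filt_add filt_scale, assumption+)+
    qed
  next
    case (filt_dd i x)
    show ?case
    proof (rule act_swap[OF dd_par[OF filt_dd.hyps(1)]])
      show "filt (Suc m) (act M (brk G x' (dd i)) x)" for x' by (rule filt_dd.IH)
      show "filt (Suc m) (act M (dd i) (act M x' x))" for x' by (rule filt.filt_dd[OF filt_dd.hyps(1) filt_dd.IH])
    qed (rule filt_add filt_scale, assumption+)+
  qed (simp_all add: filt_zero filt_add filt_scale act_right)
qed

text \<open>M consists of combinations of words in arbitrary elements of the algebra, and each
  letter raises the filtration by at most one.\<close>

lemma filt_exhaust: "\<exists>k. filt k m"
proof -
  have word: "filt (length xs) (foldr (act M) xs (\<iota> w))" for xs w
  proof (induction xs)
    case Nil
    show ?case using filt_word[of "[]" 0 w] by simp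
  qed (simp add: filt_act)
  have sum: "\<exists>k. filt k (sum f S)" if ex: "\<And>i. \<exists>k. filt k (f i)" for f :: "'g list \<times> 'f \<Rightarrow> 'm" and S
  proof (induction S rule: infinite_finite_induct)
    case (insert x S)
    then obtain a b where "filt a (sum f S)" "filt b (f x)" using ex by blast
    then have "filt (a + b) (sum f S)" "filt (a + b) (f x)" by (auto elim: filt_mono)
    then show ?case using insert by (auto intro: filt_add)
  qed (auto intro: filt_zero)
  obtain u where "ev u = m" using ev_surj by blast
  then show ?thesis using sum[of "\<lambda>w. scl M (u w) (foldr (act M) (fst w) (\<iota> (snd w)))" "{w. u w \<noteq> 0}"]
    by (auto intro: filt_scale word)
qed

text \<open>Positive degrees annihilate F. Commuting z past a factor of degree -1, -2 or -3 lowers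
  its degree by at most 3, so each factor raises the bound by 3. The bound holds for a whole degree
  at once, which makes the sums over N in the dual action finite.\<close>

lemma locally_nilpotent: "\<exists>B::int. \<forall>j>B. \<forall>z\<in>deg G j. act M z x = 0"
proof -
  let ?Q = "\<lambda>x. \<exists>B::int. \<forall>j>B. \<forall>z\<in>deg G j. act M z x = 0"
  have step: "act M z (act M u x) = 0"
    if B: "\<forall>j>B. \<forall>z\<in>deg G j. act M z x = 0" and j: "j > B + 3"
      and u: "u \<in> par G q" "u \<in> G.span (deg G (- 1) \<union> deg G (- 2) \<union> deg G (- 3))" and z: "z \<in> deg G j"
    for B j u q z x
  proof -
    have kill: "act M (brk G z u) x = 0" if "z \<in> deg G j" for z
      using u(2)
    proof (induction rule: G.span_induct_alt)
      case (step c w u)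
      have "brk G z w \<in> deg G (j - 1) \<union> deg G (j - 2) \<union> deg G (j - 3)"
        using step(1) deg_brk[OF \<open>z \<in> deg G j\<close>, of w "- 1"] deg_brk[OF \<open>z \<in> deg G j\<close>, of w "- 2"]
          deg_brk[OF \<open>z \<in> deg G j\<close>, of w "- 3"] by auto
      moreover have "\<forall>u\<in>deg G i. act M u x = 0" if "i \<in> {j - 1, j - 2, j - 3}" for i
      proof -
        have "i > B" using that j by auto
        then show ?thesis using B by blast
      qed
      ultimately have "act M (brk G z w) x = 0" by blast
      then show ?case using step(2) by (simp add: G.brk_add act_left)
    qed simp
    obtain z0 z1 where *: "z0 \<in> deg G j \<inter> par G 0" "z1 \<in> deg G j \<inter> par G 1" "z = z0 + z1"
      using deg_decomp_par[OF z] by blast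
    moreover have "j > B" using j by simp
    ultimately have k: "act M z0 x = 0" "act M z1 x = 0" using B by blast+
    have "act M z0 (act M u x) = 0" "act M z1 (act M u x) = 0"
      using * act_commute[of z0 0 u q x] act_commute[of z1 1 u q x] u kill k by auto
    then show ?thesis unfolding * act_left by simp
  qed
  have word: "?Q (dword js w)" if "set js \<subseteq> \<Omega>" for js w
    using that
  proof (induction js)
    case Nil
    have "act M z (\<iota> w) = 0" if "j > 0" "z \<in> deg G j" for j z
    proof -
      have "z \<in> fil G 0" "z \<in> fil G 1" using that deg_fil[of 0 j] deg_fil[of 1 j] by auto
      then show ?thesis using act_\<iota> F_pos \<iota>.zero by simp
    qed
    then show ?case by (metis dword_simps(1))
  next
    case (Cons i js)
    then obtain B where B: "\<forall>j>B. \<forall>z\<in>deg G j. act M z (dword js w) = 0" by auto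
    have i: "i \<in> \<Omega>" using Cons by simp
    have "d i \<in> G.span (deg G (- 1) \<union> deg G (- 2) \<union> deg G (- 3))"
      using d_O[OF i] G.span_mono[of "deg G (- 1) \<union> deg G (- 3)" "deg G (- 1) \<union> deg G (- 2) \<union> deg G (- 3)"] by blast
    then have "\<forall>j>B + 3. \<forall>z\<in>deg G j. act M z (dword (i # js) w) = 0"
      using step[OF B _ d_par[OF i]] by simp
    then show ?case by blast
  qed
  obtain k where "filt k x" using filt_exhaust by blast
  then show ?thesis
  proof (induction rule: filt.induct)
    case (filt_add x z)
    then obtain a b where a: "\<forall>j>a. \<forall>z\<in>deg G j. act M z x = 0" and b: "\<forall>j>b. \<forall>u\<in>deg G j. act M u z = 0" by blast
    have "\<forall>j>max a b. \<forall>u\<in>deg G j. act M u (x + z) = 0"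
    proof (intro allI impI ballI)
      fix j u assume "j > max a b" "u \<in> deg G j"
      then have "act M u x = 0" "act M u z = 0" using a b by auto
      then show "act M u (x + z) = 0" unfolding act_right by simp
    qed
    then show ?case by blast
  next
    case (filt_scale x c)
    then show ?case unfolding act_right by (metis M.scale_zero_right)
  next
    case (filt_word js w)
    then show ?case by (intro word)
  next
    case (filt_dd i x)
    then obtain B where B: "\<forall>j>B. \<forall>z\<in>deg G j. act M z x = 0" by auto
    have "dd i \<in> G.span (deg G (- 1) \<union> deg G (- 2) \<union> deg G (- 3))"
      by (rule G.span_base) (use dd_deg[OF filt_dd.hyps(1)] in blast)
    then have "\<forall>j>B + 3. \<forall>z\<in>deg G j. act M z (act M (dd i) x) = 0"
      using step[OF B _ dd_par[OF filt_dd.hyps(1)]] by simp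
    then show ?case by blast
  qed simp
qed

lemma dword_append: "dword (us @ vs) w = foldr (\<lambda>i. act M (d i)) us (dword vs w)"
  by (induction us) simp_all

lemma foldr_act_add: "foldr (\<lambda>i. act M (d i)) us (x + z) = foldr (\<lambda>i. act M (d i)) us x + foldr (\<lambda>i. act M (d i)) us z"
  by (induction us) (simp_all add: act_right)

text \<open>The sum carries [d a, d b] in place of the two letters. This is a combination of
  derivatives, so the filtration drops by two.\<close>

lemma dword_swap:
  assumes "set us \<union> {a, b} \<union> set vs \<subseteq> \<Omega>"
  shows "filt (length us + length vs) (dword (us @ a # b # vs) w + dword (us @ b # a # vs) w)"
proof -
  let ?x = "dword vs w"
  have ab: "a \<in> \<Omega>" "b \<in> \<Omega>" using assms by auto
  have "act M (d a) (act M (d b) ?x) + act M (d b) (act M (d a) ?x) = act M (brk G (d a) (d b)) ?x"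
    using act_commute[OF d_par[OF ab(1)] d_par[OF ab(2)], of ?x] by simp
  then have eq: "dword (us @ a # b # vs) w + dword (us @ b # a # vs) w =
      foldr (\<lambda>i. act M (d i)) us (act M (brk G (d a) (d b)) ?x)"
    unfolding dword_append dword_simps foldr_act_add[symmetric] by simp
  have "filt (length vs) ?x" by (rule filt_word) (use assms in auto)
  then show ?thesis unfolding eq
    by (intro filt_prefix filt_deg_m2 brk_d_d ab) (use assms in auto)
qed

lemma dword_add: "dword js (u + w) = dword js u + dword js w"
  and dword_scale: "dword js (scl F c w) = scl M c (dword js w)"
  by (induction js) (simp_all add: \<iota>.add \<iota>.scale act_right)

lemma F_basis_facts: "inj_on v {1..l}" "F.independent (v ` {1..l})" "F.span (v ` {1..l}) = UNIV"
  using F_basis unfolding basis_of_def by blast+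

section \<open>Functionals in the conformal dual and their values on words\<close>

lemma neg_eq_self: "x = 0" if "x = - (x :: nat list \<Rightarrow> 'k)" for x
proof
  fix K
  have "x K = - x K" using fun_cong[OF that, of K] by simp
  then have "2 * x K = 0" by (simp only: mult_2 add_eq_0_iff)
  then show "x K = 0 K" by simp
qed

lemma conf_dualD:
  assumes "f \<in> conf_dual r s dd M q"
  shows "f (x + z) = f x + f z" "f (scl M c x) = fsc (*) c (f x)" "f 0 = 0"
    "i \<in> X \<Longrightarrow> f (act M (dd i) x) = - fsc (*) (ksgn (vp i * q)) (pmul (*) vp i (f x))"
    "f x K \<noteq> 0 \<Longrightarrow> K \<in> Std r s"
    "x \<in> par M p \<Longrightarrow> f x K \<noteq> 0 \<Longrightarrow> lpar vp K = p + q"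
proof -
  note c = assms[unfolded conf_dual_def, THEN CollectD]
  interpret f: Vector_Spaces.linear "scl M" "fsc (*)" f using c by blast
  show "f (x + z) = f x + f z" "f (scl M c x) = fsc (*) c (f x)" "f 0 = 0"
    by (rule f.add f.scale f.zero)+
  show "i \<in> X \<Longrightarrow> f (act M (dd i) x) = - fsc (*) (ksgn (vp i * q)) (pmul (*) vp i (f x))"
  proof -
    assume i: "i \<in> X"
    have "f (del_act dd M i x) = fsc (*) (ksgn (vp i * q)) (pmul (*) vp i (f x))"
      using c i by blast
    then have "- f (act M (dd i) x) = fsc (*) (ksgn (vp i * q)) (pmul (*) vp i (f x))"
      unfolding del_act_def f.neg .
    then show ?thesis by (metis minus_minus)
  qed
  show "f x K \<noteq> 0 \<Longrightarrow> K \<in> Std r s" using c by blast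
  show "x \<in> par M p \<Longrightarrow> f x K \<noteq> 0 \<Longrightarrow> lpar vp K = p + q" using c by blast
qed

lemma dual_dd_0:
  assumes "f \<in> conf_dual r s dd M q" "i \<in> X" "f x = 0" shows "f (act M (dd i) x) = 0"
  unfolding conf_dualD(4)[OF assms(1,2)] assms(3) pmul_0 by (rule ext) simp

text \<open>On values a derivative acts as a scalar times multiplication by a variable, so vanishing
  on the generating words propagates through the filtration step.\<close>

lemma dual_filt:
  assumes f: "f \<in> conf_dual r s dd M q"
    and w: "\<And>js w. set js \<subseteq> \<Omega> \<Longrightarrow> length js \<le> m \<Longrightarrow> f (dword js w) = 0"
    and "filt m x"
  shows "f x = 0"
  using assms(3)
proof (induction rule: filt.induct)
  case (filt_scale x c)
  show ?case unfolding conf_dualD(2)[OF f] filt_scale.IH by (rule ext) simp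
next
  case (filt_add x z)
  show ?case unfolding conf_dualD(1)[OF f] filt_add.IH by (rule add_0_left)
next
  case (filt_dd i x)
  show ?case by (rule dual_dd_0[OF f filt_dd.hyps(1) filt_dd.IH])
qed (use w conf_dualD(3)[OF f] in blast)+

lemma dual_swap:
  assumes f: "f \<in> conf_dual r s dd M q"
    and w: "\<And>js w. set js \<subseteq> \<Omega> \<Longrightarrow> length js < k \<Longrightarrow> f (dword js w) = 0"
    and "length us + length vs + 2 = k" "set us \<union> {a, b} \<union> set vs \<subseteq> \<Omega>"
  shows "f (dword (us @ a # b # vs) w) = - f (dword (us @ b # a # vs) w)"
proof -
  have "f (dword (us @ a # b # vs) w + dword (us @ b # a # vs) w) = 0"
    by (rule dual_filt[OF f _ dword_swap[OF assms(4)]]) (use w assms(3) in auto)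
  then show ?thesis unfolding conf_dualD(1)[OF f] by (rule eq_neg_iff_add_eq_0[THEN iffD2])
qed

text \<open>By induction on the length \<open>f\<close> vanishes on shorter words, which makes it
  alternating on words of the present length. Words with a repetition give zero, and the others can
  be sorted into some d_J.\<close>

lemma dual_dword_0:
  assumes f: "f \<in> conf_dual r s dd M q"
    and J: "\<And>J h. J \<subseteq> \<Omega> \<Longrightarrow> card J \<le> m \<Longrightarrow> h \<in> {1..l} \<Longrightarrow> f (dI M \<iota> d v J h) = 0"
    and "set js \<subseteq> \<Omega>" "length js \<le> m"
  shows "f (dword js w) = 0"
  using assms(3,4)
proof (induction "length js" arbitrary: js w rule: less_induct)
  case less
  have shorter: "f (dword ks w) = 0" if "set ks \<subseteq> \<Omega>" "length ks < length js" for ks w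
    using less that by (metis le_trans less_imp_le)
  have swap: "f (dword (us @ a # b # vs) w) = - f (dword (us @ b # a # vs) w)"
    if "length us + length vs + 2 = length js" "set us \<union> {a, b} \<union> set vs \<subseteq> \<Omega>" for us a b vs
    by (rule dual_swap[OF f shorter that])
  show ?case
  proof (cases "distinct js")
    case False
    show ?thesis
    proof (rule antisymmetric_not_distinct[where \<phi> = "\<lambda>js. f (dword js w)" and k = "length js" and I = \<Omega>])
      show "x = 0" if "x = - x" for x :: "nat list \<Rightarrow> 'k" by (rule neg_eq_self[OF that])
    qed (rule swap, assumption, assumption, rule refl, rule less.prems(1), rule False)
  next
    case True
    then have J: "sort js = sorted_list_of_set (set js)" "card (set js) \<le> m"
      using less.prems(2) by (simp_all add: sorted_list_of_set_sort_remdups distinct_remdups_id distinct_card)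
    have "w \<in> F.span (v ` {1..l})" using F_basis_facts by simp
    then have "f (dword (sort js) w) = 0"
    proof (induction rule: F.span_induct_alt)
      case base
      have "dword (sort js) 0 = 0" using dword_scale[of "sort js" 0 0] by simp
      then show ?case by (simp only: conf_dualD(3)[OF f])
    next
      case (step c u w)
      then obtain h where "h \<in> {1..l}" "u = v h" by blast
      then have "f (dword (sort js) u) = 0" unfolding J(1) using assms(2)[OF less.prems(1) J(2)] dI_dword by metis
      then show ?case unfolding dword_add dword_scale conf_dualD(1,2)[OF f] step(2) by (intro ext) simp
    qed
    moreover have "f (dword ([] @ js) w) = f (dword ([] @ sort js) w) \<or> f (dword ([] @ js) w) = - f (dword ([] @ sort js) w)"
    proof (rule sort_antisymmetric[where \<phi> = "\<lambda>js. f (dword js w)" and k = "length js" and I = \<Omega>])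
      show "set [] \<union> set js \<subseteq> \<Omega>" using less.prems by simp
    qed (rule swap, assumption, assumption, simp)
    ultimately show ?thesis unfolding append_Nil by (elim disjE) (simp_all only: neg_0_equal_iff_equal neg_equal_0_iff_equal)
  qed
qed

lemma dual_eq_0:
  assumes f: "f \<in> conf_dual r s dd M q"
    and J: "\<And>J h. J \<subseteq> \<Omega> \<Longrightarrow> h \<in> {1..l} \<Longrightarrow> f (dI M \<iota> d v J h) = 0"
  shows "f = 0"
proof
  fix x
  obtain k where k: "filt k x" using filt_exhaust by blast
  have "f x = 0" by (rule dual_filt[OF f _ k]) (use dual_dword_0[OF f J, where m = k] in blast)
  then show "f x = 0 x" by (simp only: zero_fun_apply)
qed

text \<open>A word of length \<open>n\<close> with a repeated letter is, modulo shorter words, equal to its negative.\<close>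
lemma dual_top_not_distinct:
  assumes f: "f \<in> conf_dual r s dd M q"
    and J: "\<And>J h. J \<subset> \<Omega> \<Longrightarrow> h \<in> {1..l} \<Longrightarrow> f (dI M \<iota> d v J h) = 0"
    and js: "set js \<subseteq> \<Omega>" "length js \<le> n" "distinct js \<longrightarrow> length js < n"
  shows "f (dword js w) = 0"
proof -
  have short: "f (dword ks w) = 0" if "set ks \<subseteq> \<Omega>" "length ks < n" for ks w
  proof (rule dual_dword_0[OF f _ that(1)])
    show "f (dI M \<iota> d v J h) = 0" if "J \<subseteq> \<Omega>" "card J \<le> n - 1" "h \<in> {1..l}" for J h
    proof -
      \<comment> \<open>The word \<open>ks\<close> shorter than \<open>n\<close> forces n > 0, so
        that card J \<le> n - 1 really excludes the full set.\<close>
      have "J \<noteq> \<Omega>" using that(2) \<open>length ks < n\<close> by auto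
      then show ?thesis using J that by blast
    qed
  qed (use that(2) in simp)
  show ?thesis
  proof (cases "length js < n")
    case False
    then have len: "length js = n" "\<not> distinct js" using js by auto
    show ?thesis
    proof (rule antisymmetric_not_distinct[where \<phi> = "\<lambda>js. f (dword js w)" and k = n and I = \<Omega>])
      show "x = 0" if "x = - x" for x :: "nat list \<Rightarrow> 'k" by (rule neg_eq_self[OF that])
      show "f (dword (us @ a # b # vs) w) = - f (dword (us @ b # a # vs) w)"
        if "length us + length vs + 2 = n" "set us \<union> {a, b} \<union> set vs \<subseteq> \<Omega>" for us a b vs
        by (rule dual_swap[OF f short that])
    qed (fact len js)+
  qed (use short js in blast)
qed

end

section \<open>The action of degree zero elements on the dual\<close>

lemma mon_Nil: "mon (*) p [] (c::'k::field) = (\<lambda>L. if L = [] then c else 0)"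
  by (simp add: mon_def fun_eq_iff)

lemma mon_Nil_add: "mon (*) p [] (a + b) = mon (*) p [] a + mon (*) p [] (b::'k::field)"
  and mon_Nil_scale: "mon (*) p [] (c * b) = fsc (*) c (mon (*) p [] b)"
  by (simp_all add: mon_Nil fun_eq_iff)

lemma ksgn_of_nat: "ksgn (of_nat n) = ((- 1) ^ n :: 'k::comm_ring_1)"
proof (induction n)
  case (Suc n)
  show ?case unfolding of_nat_Suc ksgn_add Suc.IH by simp
qed simp

locale conformal_dual = conformal_induced r s R gr A \<pi> G \<rho> cl dd n l F v pv d M \<iota>
  for r s :: nat
    and R :: "('k::field_char_0, 'a::ab_group_add) lie_conf"
    and gr :: "int \<Rightarrow> 'a set"
    and A :: "('k, 'b::ab_group_add) lie_super"
    and \<pi> :: "(nat list \<Rightarrow> 'a) \<Rightarrow> 'b"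
    and G :: "('k, 'g::ab_group_add) lie_super"
    and \<rho> :: "('b \<Rightarrow> 'b) \<Rightarrow> 'b \<Rightarrow> 'g"
    and cl :: "(nat list \<Rightarrow> 'a) \<Rightarrow> 'g" and dd :: "nat \<Rightarrow> 'g"
    and n l :: nat
    and F :: "('k, 'f::ab_group_add, 'g) lie_mod"
    and v :: "nat \<Rightarrow> 'f" and pv :: "nat \<Rightarrow> bit"
    and d :: "nat \<Rightarrow> 'g"
    and M :: "('k, 'm::ab_group_add, 'g) lie_mod"
    and \<iota> :: "'f \<Rightarrow> 'm" +
  fixes \<sigma> :: "'g \<Rightarrow> ('m \<Rightarrow> nat list \<Rightarrow> 'k) \<Rightarrow> 'm \<Rightarrow> nat list \<Rightarrow> 'k"
    and e :: "nat set \<Rightarrow> nat \<Rightarrow> 'm \<Rightarrow> nat list \<Rightarrow> 'k"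
    and Ms :: "('k, 'm \<Rightarrow> nat list \<Rightarrow> 'k, 'g) lie_mod"
  assumes dual_action: "dual_action r s R G cl dd M \<sigma>" and Ms_def: "Ms = dual_mod r s dd M \<sigma>"
    and dual_basis: "dual_basis r s dd M \<iota> n d l v e"
begin

abbreviation const :: "'k \<Rightarrow> nat list \<Rightarrow> 'k" where "const \<equiv> mon (*) vp []"

lemma Ms_module: "lie_module G UNIV Ms"
  unfolding Ms_def by (rule dual_action[unfolded dual_action_def, THEN conjunct1])

sublocale Ms: superspace Ms
  using Ms_module[unfolded lie_module_def, THEN conjunct1] by unfold_locales

lemma Ms_sel: "scl Ms = fsc (fsc (*))" "par Ms q = conf_dual r s dd M q" "act Ms = \<sigma>"
    "car Ms = module.span (fsc (fsc (*))) (\<Union>q. conf_dual r s dd M q)"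
  by (simp_all add: Ms_def dual_mod_def)

lemma \<sigma>_car: "f \<in> car Ms \<Longrightarrow> \<sigma> x f \<in> car Ms"
  using Ms_module[unfolded lie_module_def, THEN conjunct2, THEN conjunct1] unfolding Ms_sel(3) by blast

lemma \<sigma>_right: "f \<in> car Ms \<Longrightarrow> g \<in> car Ms \<Longrightarrow> \<sigma> x (f + g) = \<sigma> x f + \<sigma> x g"
    "f \<in> car Ms \<Longrightarrow> \<sigma> x (scl Ms c f) = scl Ms c (\<sigma> x f)"
  using Ms_module[unfolded lie_module_def, THEN conjunct2, THEN conjunct1] unfolding Ms_sel(3) lin_on_def by blast+

lemma \<sigma>_left: "f \<in> car Ms \<Longrightarrow> \<sigma> (x + z) f = \<sigma> x f + \<sigma> z f"
    "f \<in> car Ms \<Longrightarrow> \<sigma> (scl G c x) f = scl Ms c (\<sigma> x f)"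
  using Ms_module[unfolded lie_module_def, THEN conjunct2, THEN conjunct2, THEN conjunct1]
  unfolding Ms_sel(3) lin_on_def by blast+

lemma \<sigma>_y:
  "a \<in> par R p \<Longrightarrow> f \<in> conf_dual r s dd M q \<Longrightarrow> K \<in> Std r s \<Longrightarrow> L \<in> Std r s \<Longrightarrow>
    conf_coeff r K * \<sigma> (y K a) f m L = dual_lam r s R cl M p q a f m (lam_word K @ mu_word L)"
  using dual_action[unfolded dual_action_def, THEN conjunct2, THEN conjunct1] by blast

text \<open>The defining equations of \<open>\<sigma>\<close> concern only standard
  \<open>L\<close>; this settles the remaining coefficients.\<close>

lemma car_support: assumes "f \<in> car Ms" "L \<notin> Std r s" shows "f m L = 0"
proof -
  obtain f0 f1 where f: "f0 \<in> conf_dual r s dd M 0" "f1 \<in> conf_dual r s dd M 1" "f = f0 + f1"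
    using Ms.par_decomp[OF assms(1)] unfolding Ms_sel by blast
  have "f0 m L = 0" "f1 m L = 0" using conf_dualD(5)[OF f(1)] conf_dualD(5)[OF f(2)] assms(2) by blast+
  then show ?thesis unfolding f(3) by simp
qed

lemma e_car: "I \<subseteq> \<Omega> \<Longrightarrow> h \<in> {1..l} \<Longrightarrow> e I h \<in> car Ms"
  unfolding Ms_sel(4) using dual_basis[unfolded dual_basis_def] by blast

lemma e_dI: "I \<subseteq> \<Omega> \<Longrightarrow> h \<in> {1..l} \<Longrightarrow> J \<subseteq> \<Omega> \<Longrightarrow> k \<in> {1..l} \<Longrightarrow>
    e I h (dI M \<iota> d v J k) = const (if I = J \<and> h = k then 1 else 0)"
  using dual_basis[unfolded dual_basis_def] by blast

lemma dword_par: "set js \<subseteq> \<Omega> \<Longrightarrow> w \<in> par F q \<Longrightarrow> dword js w \<in> par M (of_nat (length js) + q)"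
proof (induction js)
  case (Cons i js)
  have "act M (d i) (dword js w) \<in> par M (1 + (of_nat (length js) + q))"
    by (rule act_par[OF d_par]) (use Cons in auto)
  then show ?case by (simp only: dword_simps length_Cons of_nat_Suc add.assoc)
next
  case Nil
  then show ?case using \<iota>_par by (simp only: dword_simps list.size of_nat_0 add_0_left)
qed

lemma dI_par:
  assumes "J \<subseteq> \<Omega>" "k \<in> {1..l}" shows "dI M \<iota> d v J k \<in> par M (of_nat (card J) + pv k)"
proof -
  have fin: "finite J" using assms(1) by (rule finite_subset) simp
  have "dword (sorted_list_of_set J) (v k) \<in> par M (of_nat (length (sorted_list_of_set J)) + pv k)"
    by (rule dword_par) (use assms v_par fin in auto)
  then show ?thesis by (simp only: dI_dword length_sorted_list_of_set)
qed

text \<open>The parity components of a functional take values with disjoint supports.\<close>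
lemma component_eq_0:
  assumes "f0 \<in> conf_dual r s dd M p" "f1 \<in> conf_dual r s dd M q" "p \<noteq> q" "x \<in> par M t"
    and "(f0 + f1) x = const c" and "c \<noteq> 0 \<Longrightarrow> t = q"
  shows "f0 x = 0"
proof
  fix K
  show "f0 x K = 0 K"
  proof (rule ccontr)
    assume "f0 x K \<noteq> 0 K"
    then have nz: "f0 x K \<noteq> 0" unfolding zero_fun_apply .
    then have K: "lpar vp K = t + p" by (rule conf_dualD(6)[OF assms(1,4)])
    then have "f1 x K = 0" using conf_dualD(6)[OF assms(2,4), of K] assms(3) by (metis add_left_cancel)
    then have "const c K \<noteq> 0" using fun_cong[OF assms(5), of K] nz by simp
    then have "K = []" "c \<noteq> 0" by (auto simp: mon_Nil split: if_splits)
    then have "t = p" using K by (cases t; cases p; simp)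
    then show False using assms(3,6) \<open>c \<noteq> 0\<close> by blast
  qed
qed

text \<open>Elements of the dual need not be homogeneous, but disjoint supports make each parity
  component vanish on the d_J v_k separately.\<close>

lemma car_eq_0:
  assumes f: "f \<in> car Ms" and J: "\<And>J k. J \<subseteq> \<Omega> \<Longrightarrow> k \<in> {1..l} \<Longrightarrow> f (dI M \<iota> d v J k) = 0"
  shows "f = 0"
proof -
  obtain f0 f1 where *: "f0 \<in> conf_dual r s dd M 0" "f1 \<in> conf_dual r s dd M 1" "f = f0 + f1"
    using Ms.par_decomp[OF f] unfolding Ms_sel by blast
  have c0: "const 0 = 0" by (rule mon_0)
  have "f0 = 0"
    by (rule dual_eq_0[OF *(1)], rule component_eq_0[OF *(1,2) _ dI_par, of _ _ 0])
      (use J *(3) c0 in auto)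
  moreover have "f1 = 0"
    by (rule dual_eq_0[OF *(2)], rule component_eq_0[OF *(2,1) _ dI_par, of _ _ 0])
      (use J *(3) c0 in \<open>auto simp: add.commute\<close>)
  ultimately show ?thesis using *(3) by simp
qed

text \<open>The dual basis is given only by its values, without parities. The component of the wrong
  parity vanishes on every d_J v_k and is therefore zero.\<close>

lemma e_conf_dual:
  assumes I: "I \<subseteq> \<Omega>" and h: "h \<in> {1..l}"
  shows "e I h \<in> conf_dual r s dd M (of_nat (card I) + pv h)"
proof -
  obtain f0 f1 where *: "f0 \<in> conf_dual r s dd M 0" "f1 \<in> conf_dual r s dd M 1" "e I h = f0 + f1"
    using Ms.par_decomp[OF e_car[OF I h]] unfolding Ms_sel by blast
  let ?q = "of_nat (card I) + pv h"
  have zero: "g = 0" if g: "g \<in> conf_dual r s dd M p" and g': "g' \<in> conf_dual r s dd M ?q" "p \<noteq> ?q" "e I h = g + g'" for g g' p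
  proof (rule dual_eq_0[OF g])
    fix J k assume J: "J \<subseteq> \<Omega>" and k: "k \<in> {1..l}"
    show "g (dI M \<iota> d v J k) = 0"
    proof (rule component_eq_0[OF g g'(1,2) dI_par[OF J k]])
      show "(g + g') (dI M \<iota> d v J k) = const (if I = J \<and> h = k then 1 else 0)"
        using e_dI[OF I h J k] unfolding g'(3) .
      show "of_nat (card J) + pv k = ?q" if "(if I = J \<and> h = k then 1 else 0::'k) \<noteq> 0"
        using that by (simp split: if_splits)
    qed
  qed
  show ?thesis
  proof (cases "?q = 0")
    case True
    then have "f1 = 0" using zero[OF *(2), of f0] * by (simp add: add.commute)
    then show ?thesis using * True by simp
  next
    case False
    then have q: "?q = 1" using bit_eq_1_iff by blast
    then have "f0 = 0" using zero[OF *(1), of f1] * by simp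
    then show ?thesis using * q by simp
  qed
qed

section \<open>Coefficients of the dual action for elements of degree zero\<close>

definition ddc :: "'g \<Rightarrow> nat \<Rightarrow> 'k" where
  "ddc z = (SOME c. z = (\<Sum>j\<in>X. scl G (c j) (dd j)))"

lemma ddc: "z \<in> deg G (- 2) \<Longrightarrow> z = (\<Sum>j\<in>X. scl G (ddc z j) (dd j))"
  unfolding ddc_def by (rule someI_ex[OF dd_sum])

text \<open>Independence of the derivatives makes the coordinates chosen in \<open>ddc\<close>
  unique, from which their linearity follows.\<close>

lemma ddc_eq:
  assumes z: "z = (\<Sum>j\<in>X. scl G (c j) (dd j))" and j: "j \<in> X" shows "ddc z j = c j"
proof -
  have "z \<in> deg G (- 2)" unfolding z
    by (intro G.subspace_sum[OF subspace_deg] G.subspace_scale[OF subspace_deg] dd_deg)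
  then have "(\<Sum>j\<in>X. scl G (ddc z j) (dd j)) = (\<Sum>j\<in>X. scl G (c j) (dd j))"
    using ddc[of z] z by (simp only:)
  then have "(\<Sum>j\<in>X. scl G (ddc z j - c j) (dd j)) = 0"
    by (simp only: G.scale_left_diff_distrib sum_subtractf diff_self)
  then have "ddc z j - c j = 0" using j by (rule dd_sum_eq_0)
  then show ?thesis by simp
qed

lemma ddc_add: assumes "z \<in> deg G (- 2)" "u \<in> deg G (- 2)" "j \<in> X" shows "ddc (z + u) j = ddc z j + ddc u j"
proof (rule ddc_eq[OF _ assms(3)])
  show "z + u = (\<Sum>j\<in>X. scl G (ddc z j + ddc u j) (dd j))"
    using ddc[OF assms(1)] ddc[OF assms(2)] by (simp only: G.scale_left_distrib sum.distrib)
qed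

lemma ddc_scale: assumes "z \<in> deg G (- 2)" "j \<in> X" shows "ddc (scl G c z) j = c * ddc z j"
proof (rule ddc_eq[OF _ assms(2)])
  have "scl G c z = scl G c (\<Sum>j\<in>X. scl G (ddc z j) (dd j))" using ddc[OF assms(1)] by (simp only:)
  then show "scl G c z = (\<Sum>j\<in>X. scl G (c * ddc z j) (dd j))"
    by (simp only: G.scale_sum_right G.scale_scale)
qed

lemma ddc_0: "j \<in> X \<Longrightarrow> ddc 0 j = 0"
  by (rule ddc_eq[of 0 "\<lambda>_. 0"]) simp_all

text \<open>\<open>psum\<close> runs over an unknown support. Its words have bounded length, so any
  finite set of standard words containing all short ones can replace it; the freedom in
  \<open>S\<close> later makes room for \<open>K\<close> and its deletions.\<close>

lemma dual_lam_sum: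
  assumes f: "f \<in> conf_dual r s dd M q" and a: "a \<in> gr (- 2 * int (length K)) \<inter> par R p"
  shows "\<exists>B. \<forall>S. finite S \<longrightarrow> {N \<in> Std r s. length N \<le> B} \<subseteq> S \<longrightarrow> S \<subseteq> Std r s \<longrightarrow>
    (\<forall>L. dual_lam r s R cl M p q a f m L = - ksgn (p * q) * (\<Sum>N\<in>S. ksgn (lpar vp N * q) *
      foldr (pmul (*) (vpar2 r)) (lam_word N) (lam_shift r (f (scl M (conf_coeff r N) (act M (y N a) m)))) L))"
proof -
  obtain B :: int where B: "\<forall>j>B. \<forall>z\<in>deg G j. act M z m = 0" using locally_nilpotent by blast
  \<comment> \<open>\<open>y N a\<close> has degree 2 l(N) - 2 l(K), which exceeds \<open>B\<close>
    as soon as l(N) > B'.\<close>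
  define B' where "B' = nat (B + 2 * int (length K))"
  have van: "act M (y N a) m = 0" if "N \<in> Std r s" "length N > B'" for N
  proof -
    have "y N a \<in> deg G (- 2 * int (length K) + 2 * int (length N))"
      using y_gens[OF that(1) a] by (rule g_gens_deg)
    moreover have "- 2 * int (length K) + 2 * int (length N) > B" using that(2) unfolding B'_def by linarith
    ultimately show ?thesis using B by blast
  qed
  show ?thesis
  proof (intro exI[of _ B'] allI impI)
    fix S L assume S: "finite S" "{N \<in> Std r s. length N \<le> B'} \<subseteq> S" "S \<subseteq> Std r s"
    let ?T = "\<lambda>N u. fsc (*) (ksgn (lpar vp N * q)) (foldr (pmul (*) (vpar2 r)) (lam_word N) (lam_shift r (f u)))"
    have T0: "?T N 0 = 0" for N
      unfolding conf_dualD(3)[OF f] lam_shift_0 foldr_pmul_0 by (rule ext) simp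
    have "psum (lam_act r s R cl M a m) ?T = (\<Sum>N\<in>S. ?T N (lam_act r s R cl M a m N))"
    proof (rule psum_mono_neutral[OF S(1)])
      show "?T N 0 = 0" for N by (rule T0)
    next
      fix N assume nz: "lam_act r s R cl M a m N \<noteq> 0"
      then have N: "N \<in> Std r s" unfolding lam_act_def by presburger
      then have "act M (y N a) m \<noteq> 0" using nz unfolding lam_act_def by auto
      then have "length N \<le> B'" using van[OF N] by (metis not_le)
      then show "N \<in> S" using S(2) N by blast
    qed
    also have "\<dots> = (\<Sum>N\<in>S. ?T N (scl M (conf_coeff r N) (act M (y N a) m)))"
      by (intro sum.cong refl) (use S(3) in \<open>simp add: lam_act_def subset_iff\<close>)
    finally have ps: "psum (lam_act r s R cl M a m) ?T = (\<Sum>N\<in>S. ?T N (scl M (conf_coeff r N) (act M (y N a) m)))" .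
    show "dual_lam r s R cl M p q a f m L = - ksgn (p * q) * (\<Sum>N\<in>S. ksgn (lpar vp N * q) *
      foldr (pmul (*) (vpar2 r)) (lam_word N) (lam_shift r (f (scl M (conf_coeff r N) (act M (y N a) m)))) L)"
      unfolding dual_lam_def Let_def lam_shift_def[symmetric] ps by (simp add: sum_fun_apply)
  qed
qed

lemma conf_dual_sum:
  assumes f: "f \<in> conf_dual r s dd M q" shows "f (sum g S) = (\<Sum>i\<in>S. f (g i))"
proof (induction S rule: infinite_finite_induct)
  case (insert x S)
  show ?case by (simp only: sum.insert[OF insert(1,2)] conf_dualD(1)[OF f] insert.IH)
qed (simp_all add: conf_dualD(3)[OF f])

text \<open>z is a combination of derivatives, and each of them turns the constant \<delta> into a
  multiple of its variable. The minus sign comes from \<partial>_j acting as minus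
  \<open>dd j\<close>.\<close>

lemma dual_deg_m2:
  assumes f: "f \<in> conf_dual r s dd M q" and m: "f m = const \<delta>" and z: "z \<in> deg G (- 2)"
  shows "f (scl M c (act M z m)) = (\<Sum>j\<in>X. mon (*) vp [j] (- (c * ddc z j * ksgn (vp j * q) * \<delta>)))"
proof -
  have "act M z m = act M (\<Sum>j\<in>X. scl G (ddc z j) (dd j)) m" using ddc[OF z] by (rule arg_cong)
  then have eq: "act M z m = (\<Sum>j\<in>X. scl M (ddc z j) (act M (dd j) m))"
    unfolding act_sum_left act_left .
  have "f (scl M c (act M z m)) = (\<Sum>j\<in>X. f (scl M c (scl M (ddc z j) (act M (dd j) m))))"
    unfolding eq M.scale_sum_right by (rule conf_dual_sum[OF f])
  also have "\<dots> = (\<Sum>j\<in>X. mon (*) vp [j] (- (c * ddc z j * ksgn (vp j * q) * \<delta>)))"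
  proof (rule sum.cong[OF refl])
    fix j assume j: "j \<in> X"
    show "f (scl M c (scl M (ddc z j) (act M (dd j) m))) = mon (*) vp [j] (- (c * ddc z j * ksgn (vp j * q) * \<delta>))"
      unfolding conf_dualD(2)[OF f] conf_dualD(4)[OF f j] m pmul_mon
      by (rule ext) (simp add: mon_def)
  qed
  finally show ?thesis .
qed

text \<open>The coefficient of \<open>\<lambda>\<^sub>K \<mu>\<^sub>L\<close> in \<open>(a\<^sub>\<lambda> f)\<^sub>\<mu> m\<close> only involves \<open>y\<^sub>N a\<close> for \<open>N = K\<close> and for the \<open>N\<close> obtained
  from \<open>K\<close> by deleting one variable, as \<open>y\<^sub>N a\<close> has degree \<open>2 \<ell>(N) - 2 \<ell>(K)\<close> and the depth is at
  most 3.\<close>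
lemma dual_lam_top:
  assumes f: "f \<in> conf_dual r s dd M q" and m: "f m = const \<delta>"
    and deg0: "\<And>z. z \<in> deg G 0 \<Longrightarrow> \<exists>c. f (act M z m) = const c"
    and K: "K \<in> Std r s" and a: "a \<in> gr (- 2 * int (length K)) \<inter> par R p"
  shows "dual_lam r s R cl M p q a f m (lam_word K @ mu_word L) =
    - ksgn (p * q) * (if L = [] then conf_coeff r K * ksgn (lpar vp K * q) *
      (f (act M (y K a) m) [] + \<delta> * (\<Sum>j\<in>X. ksgn (vp j) * ddc (brk G (dd j) (y K a)) j)) else 0)"
proof -
  obtain B where B: "\<forall>S. finite S \<longrightarrow> {N \<in> Std r s. length N \<le> B} \<subseteq> S \<longrightarrow> S \<subseteq> Std r s \<longrightarrow>
    (\<forall>L. dual_lam r s R cl M p q a f m L = - ksgn (p * q) * (\<Sum>N\<in>S. ksgn (lpar vp N * q) *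
      foldr (pmul (*) (vpar2 r)) (lam_word N) (lam_shift r (f (scl M (conf_coeff r N) (act M (y N a) m)))) L))"
    using dual_lam_sum[OF f a] by blast
  define S where "S = {N \<in> Std r s. length N \<le> max B (length K)}"
  have S: "finite S" "{N \<in> Std r s. length N \<le> B} \<subseteq> S" "S \<subseteq> Std r s"
    unfolding S_def by (rule finite_Std_le) auto
  let ?t = "\<lambda>N. foldr (pmul (*) (vpar2 r)) (lam_word N) (lam_shift r (f (scl M (conf_coeff r N) (act M (y N a) m))))
      (lam_word K @ mu_word L)"
  let ?c = "\<lambda>N j. if L = [] \<and> sort (N @ [j]) = K then ssgn vp (N @ [j]) * (conf_coeff r N * ddc (y N a) j * ksgn (vp j * q) * \<delta>) else 0"
  let ?u = "\<lambda>N. if length N + 1 = length K then \<Sum>j\<in>X. ?c N j else 0"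
  have y_deg: "y N a \<in> deg G (- 2 * int (length K) + 2 * int (length N))" if "N \<in> Std r s" for N
    using y_gens[OF that a] by (rule g_gens_deg)
  have t: "?t N = (if N = K \<and> L = [] then conf_coeff r K * f (act M (y K a) m) [] else 0) + ?u N" if N: "N \<in> S" for N
  proof -
    have NS: "N \<in> Std r s" using N S(3) by blast
    \<comment> \<open>The degree of \<open>y N a\<close> is respectively positive, 0, -2, or at most
      -4. In the first case the \<lambda>-degree is too large, in the last the element is
      zero.\<close>
    consider "length N > length K" | "length N = length K" | "length N + 1 = length K" | "length N + 1 < length K"
      by linarith
    then show ?thesis
    proof cases
      case 1
      have "?t N = 0"
      proof (rule ccontr)
        assume "?t N \<noteq> 0"
        from lam_degree[OF this] show False using 1 by (simp add: filter_map o_def)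
      qed
      then show ?thesis using 1 by auto
    next
      case 2
      have "y N a \<in> deg G 0" using y_deg[OF NS] 2 by simp
      then obtain c where c: "f (act M (y N a) m) = const c" using deg0 by blast
      have "?t N = (if N = K \<and> L = [] then conf_coeff r N * c else 0)"
        unfolding conf_dualD(2)[OF f] c mon_Nil_scale[symmetric] lam_shift_const
        by (rule lam_coeff_const[OF NS])
      moreover have "c = f (act M (y N a) m) []" unfolding c by (simp add: mon_Nil)
      ultimately show ?thesis using 2 by auto
    next
      case 3
      have "- 2 * int (length K) + 2 * int (length N) = - 2" using 3 by linarith
      then have z: "y N a \<in> deg G (- 2)" using y_deg[OF NS] by (simp only:)
      have len: "length K = Suc (length N)" using 3 by simp
      have "?t N = - (\<Sum>j\<in>X. if L = [] \<and> sort (N @ [j]) = K then ssgn vp (N @ [j]) *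
          (- (conf_coeff r N * ddc (y N a) j * ksgn (vp j * q) * \<delta>)) else 0)"
        unfolding dual_deg_m2[OF f m z] by (rule lam_coeff_linear[OF _ len]) simp
      also have "\<dots> = (\<Sum>j\<in>X. ?c N j)"
        unfolding sum_negf[symmetric] by (rule sum.cong) auto
      finally show ?thesis using 3 by auto
    next
      case 4
      then have "- 2 * int (length K) + 2 * int (length N) < - 3" by linarith
      then have "y N a = 0" using y_deg[OF NS] deg_below by blast
      then have "f (scl M (conf_coeff r N) (act M (y N a) m)) = 0"
        by (simp only: act_0 M.scale_zero_right conf_dualD(3)[OF f])
      then have "?t N = 0" by (simp only: lam_shift_0 foldr_pmul_0 zero_fun_apply)
      then show ?thesis using 4 by auto
    qed
  qed
  have KS: "K \<in> S" unfolding S_def using K by simp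
  have "(\<Sum>N\<in>S. ksgn (lpar vp N * q) * ?t N) =
    (\<Sum>N\<in>S. (if N = K then ksgn (lpar vp K * q) * (if L = [] then conf_coeff r K * f (act M (y K a) m) [] else 0) else 0)
       + ksgn (lpar vp N * q) * ?u N)"
    by (rule sum.cong[OF refl]) (auto simp only: t distrib_left mult_zero_right if_True if_False simp_thms split: if_splits)
  also have "\<dots> = ksgn (lpar vp K * q) * (if L = [] then conf_coeff r K * f (act M (y K a) m) [] else 0) +
       (\<Sum>N\<in>S. ksgn (lpar vp N * q) * ?u N)"
    unfolding sum.distrib using S(1) KS by simp
  also have "(\<Sum>N\<in>S. ksgn (lpar vp N * q) * ?u N) = (\<Sum>N\<in>S. \<Sum>j\<in>X. ksgn (lpar vp N * q) * ?c N j)"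
  proof (rule sum.cong[OF refl])
    fix N
    have "?c N j = 0" if "length N + 1 \<noteq> length K" for j
    proof -
      have "length (sort (N @ [j])) = length N + 1" by (simp only: length_sort length_append) simp
      then have "sort (N @ [j]) \<noteq> K" using that by metis
      then show ?thesis by simp
    qed
    then show "ksgn (lpar vp N * q) * ?u N = (\<Sum>j\<in>X. ksgn (lpar vp N * q) * ?c N j)"
      by (simp add: sum_distrib_left)
  qed
  also have "\<dots> = (\<Sum>j\<in>X. \<Sum>N\<in>S. ksgn (lpar vp N * q) * ?c N j)" by (rule sum.swap)
  also have "\<dots> = (\<Sum>j\<in>X. if L = [] then conf_coeff r K * ksgn (lpar vp K * q) * \<delta> * (ksgn (vp j) * ddc (brk G (dd j) (y K a)) j) else 0)"
  proof (rule sum.cong[OF refl])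
    fix j assume j: "j \<in> X"
    let ?N = "remove1 j K"
    have NS: "?N \<in> Std r s" by (rule remove1_Std[OF K])
    have "length ?N \<le> length K" by (simp add: length_remove1)
    then have NS': "?N \<in> S" unfolding S_def using NS by simp
    have sort_iff: "sort (N @ [j]) = K \<longleftrightarrow> j \<in> set K \<and> N = ?N" if "N \<in> S" for N
    proof -
      have "sort (N @ [j]) = sort (j # N)" by (rule properties_for_sort) (simp_all add: sorted_insort)
      then show ?thesis using sort_Cons_eq_iff[OF K] that S(3) by auto
    qed
    show "(\<Sum>N\<in>S. ksgn (lpar vp N * q) * ?c N j) =
      (if L = [] then conf_coeff r K * ksgn (lpar vp K * q) * \<delta> * (ksgn (vp j) * ddc (brk G (dd j) (y K a)) j) else 0)"
    proof (cases "L = [] \<and> j \<in> set K")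
      case True
      then have jK: "j \<in> set K" by simp
      have lenN: "length ?N + 1 = length K" using jK by (simp add: length_remove1) (metis length_pos_if_in_set Suc_pred)
      have "- 2 * int (length K) + 2 * int (length ?N) = - 2" using lenN by linarith
      then have z: "y ?N a \<in> deg G (- 2)" using y_deg[OF NS] by (simp only:)
      have "(\<Sum>N\<in>S. ksgn (lpar vp N * q) * ?c N j) = (\<Sum>N\<in>S. if N = ?N then
          ksgn (lpar vp ?N * q) * (ssgn vp (?N @ [j]) * (conf_coeff r ?N * ddc (y ?N a) j * ksgn (vp j * q) * \<delta>)) else 0)"
        by (rule sum.cong[OF refl]) (use True sort_iff in auto)
      also have "\<dots> = ksgn (lpar vp ?N * q) * (ssgn vp (?N @ [j]) * (conf_coeff r ?N * ddc (y ?N a) j * ksgn (vp j * q) * \<delta>))"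
        using S(1) NS' by simp
      \<comment> \<open>Regrouped so that \<open>conf_coeff_remove1\<close> turns the coefficient of
        the shortened word into that of \<open>K\<close> times the factor of the derivative of y_K;
        the two remaining signs combine to the sign of \<open>K\<close>.\<close>
      also have "\<dots> = (ssgn vp (?N @ [j]) * conf_coeff r ?N) * (ksgn (vp j * q) * ksgn (lpar vp ?N * q)) * \<delta> * ddc (y ?N a) j"
        by (simp only: mult_ac)
      also have "ssgn vp (?N @ [j]) * conf_coeff r ?N = ksgn (vp j) * ssgn vp (j # ?N) * of_nat (count_list ?N j + 1) * (conf_coeff r K :: 'k)"
        by (rule conf_coeff_remove1[OF K jK refl])
      also have "ksgn (vp j * q) * ksgn (lpar vp ?N * q) = (ksgn (lpar vp K * q) :: 'k)"
      proof -
        have "lpar vp K = lpar vp (j # ?N)" by (rule lpar_mset) (use jK in simp)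
        then show ?thesis by (simp only: lpar_simps distrib_right ksgn_add)
      qed
      finally have 1: "(\<Sum>N\<in>S. ksgn (lpar vp N * q) * ?c N j) =
        ksgn (vp j) * ssgn vp (j # ?N) * of_nat (count_list ?N j + 1) * conf_coeff r K * ksgn (lpar vp K * q) * \<delta> * ddc (y ?N a) j" .
      have "ddc (brk G (dd j) (y K a)) j = (ssgn vp (j # ?N) * of_nat (count_list ?N j + 1)) * ddc (y ?N a) j"
        unfolding brk_dd_y[OF j K a] if_P[OF jK] by (rule ddc_scale[OF z j])
      then show ?thesis unfolding 1 if_P[OF True[THEN conjunct1]] by (simp only: mult_ac)
    next
      case False
      have "(\<Sum>N\<in>S. ksgn (lpar vp N * q) * ?c N j) = 0"
        by (rule sum.neutral) (use False sort_iff in auto)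
      moreover have "L = [] \<Longrightarrow> ddc (brk G (dd j) (y K a)) j = 0"
        unfolding brk_dd_y[OF j K a] using False ddc_0[OF j] by simp
      ultimately show ?thesis by simp
    qed
  qed
  finally have fin: "(\<Sum>N\<in>S. ksgn (lpar vp N * q) * ?t N) =
    (if L = [] then conf_coeff r K * ksgn (lpar vp K * q) *
      (f (act M (y K a) m) [] + \<delta> * (\<Sum>j\<in>X. ksgn (vp j) * ddc (brk G (dd j) (y K a)) j)) else 0)"
    by (simp add: sum_distrib_left[symmetric] distrib_left mult.assoc)
  show ?thesis using B S unfolding fin[symmetric] by blast
qed

lemma conf_dual_car: "f \<in> conf_dual r s dd M q \<Longrightarrow> f \<in> car Ms"
  using Ms.par_subset_car unfolding Ms_sel(2) by blast

lemma brk_dd_deg0: "j \<in> X \<Longrightarrow> x \<in> deg G 0 \<Longrightarrow> brk G (dd j) x \<in> deg G (- 2)"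
  using deg_brk[OF dd_deg, of j x 0] by simp

text \<open>For x = y_K a the parity of a is p + p_K, and the extra sign cancels the one from moving
  \<lambda>_K past \<open>f\<close>. Division by the nonzero \<open>conf_coeff\<close> gives the
  formula for generators, and linearity the rest.\<close>

lemma \<sigma>_deg0:
  assumes f: "f \<in> conf_dual r s dd M q" and m: "f m = const \<delta>"
    and deg0: "\<And>z. z \<in> deg G 0 \<Longrightarrow> \<exists>c. f (act M z m) = const c"
    and x: "x \<in> deg G 0 \<inter> par G p"
  shows "\<sigma> x f m = const (- ksgn (p * q) *
    (f (act M x m) [] + \<delta> * (\<Sum>j\<in>X. ksgn (vp j) * ddc (brk G (dd j) x) j)))"
proof -
  let ?r = "\<lambda>x. - ksgn (p * q) * (f (act M x m) [] + \<delta> * (\<Sum>j\<in>X. ksgn (vp j) * ddc (brk G (dd j) x) j))"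
  have fc: "f \<in> car Ms" by (rule conf_dual_car[OF f])
  have gen: "\<sigma> z f m = const (?r z)" if gz: "z \<in> g_gens 0 p" for z
  proof
    fix L
    obtain K a where K: "K \<in> Std r s" and a: "a \<in> gr (0 - 2 * int (length K)) \<inter> par R (p + lpar vp K)"
      and z: "z = y K a" using gz unfolding g_gens_def by blast
    have a': "a \<in> gr (- 2 * int (length K)) \<inter> par R (p + lpar vp K)" using a by simp
    show "\<sigma> z f m L = const (?r z) L"
    proof (cases "L \<in> Std r s")
      case True
      have "conf_coeff r K * \<sigma> z f m L = dual_lam r s R cl M (p + lpar vp K) q a f m (lam_word K @ mu_word L)"
        unfolding z by (rule \<sigma>_y[OF _ f K True]) (use a in blast)
      also have "\<dots> = - ksgn ((p + lpar vp K) * q) * (if L = [] then conf_coeff r K * ksgn (lpar vp K * q) *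
        (f (act M (y K a) m) [] + \<delta> * (\<Sum>j\<in>X. ksgn (vp j) * ddc (brk G (dd j) (y K a)) j)) else 0)"
        by (rule dual_lam_top[OF f m deg0 K a'])
      also have "\<dots> = conf_coeff r K * (- (ksgn (p * q) * (ksgn (lpar vp K * q) * ksgn (lpar vp K * q))) * (if L = [] then
        (f (act M z m) [] + \<delta> * (\<Sum>j\<in>X. ksgn (vp j) * ddc (brk G (dd j) z) j)) else 0))"
        unfolding distrib_right ksgn_add z by (cases "L = []") (simp_all only: if_True if_False mult_zero_right mult_zero_left mult_ac mult_minus_left mult_minus_right simp_thms)
      also have "\<dots> = conf_coeff r K * const (?r z) L"
        unfolding mon_Nil ksgn_mult_self by (cases "L = []") simp_all
      finally have "conf_coeff r K * \<sigma> z f m L = conf_coeff r K * const (?r z) L" .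
      then show ?thesis unfolding mult_left_cancel[OF conf_coeff_neq_0[OF K]] .
    next
      case False
      then have "L \<noteq> []" by auto
      then show ?thesis using car_support[OF \<sigma>_car[OF fc] False] by (simp add: mon_Nil)
    qed
  qed
  have "x \<in> G.span (g_gens 0 p)" using x unfolding deg_par_span .
  then have "x \<in> deg G 0 \<and> \<sigma> x f m = const (?r x)"
  proof (induction rule: G.span_induct_alt)
    case base
    have "\<sigma> 0 f = 0" using \<sigma>_left(2)[OF fc, of 0 0] by simp
    moreover have "?r 0 = 0" using ddc_0 by (simp add: conf_dualD(3)[OF f])
    ultimately show ?case using G.subspace_0[OF subspace_deg] by (simp only: mon_0 zero_fun_apply simp_thms)
  next
    case (step c z u)
    have z: "z \<in> deg G 0" by (rule g_gens_deg[OF step(1)])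
    have u: "u \<in> deg G 0" "\<sigma> u f m = const (?r u)" using step(2) by blast+
    have cz: "scl G c z \<in> deg G 0" by (rule G.subspace_scale[OF subspace_deg z])
    have "\<sigma> (scl G c z + u) f m = fsc (*) c (\<sigma> z f m) + \<sigma> u f m"
      unfolding \<sigma>_left[OF fc] Ms_sel by (rule ext) simp
    also have "\<dots> = const (c * ?r z + ?r u)" unfolding gen[OF step(1)] u(2) mon_Nil_add mon_Nil_scale ..
    also have "c * ?r z + ?r u = ?r (scl G c z + u)"
    proof -
      have alg: "c * (- k * (a + \<delta> * S)) + - k * (b + \<delta> * T) = - k * ((c * a + b) + \<delta> * (c * S + T))"
        for k a b S T :: 'k
        by (simp add: algebra_simps)
      have "f (act M (scl G c z + u) m) [] = c * f (act M z m) [] + f (act M u m) []"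
        unfolding act_left conf_dualD(1,2)[OF f] by simp
      moreover have "(\<Sum>j\<in>X. ksgn (vp j) * ddc (brk G (dd j) (scl G c z + u)) j) =
          (\<Sum>j\<in>X. c * (ksgn (vp j) * ddc (brk G (dd j) z) j) + ksgn (vp j) * ddc (brk G (dd j) u) j)"
      proof (rule sum.cong[OF refl])
        fix j assume j: "j \<in> X"
        show "ksgn (vp j) * ddc (brk G (dd j) (scl G c z + u)) j = c * (ksgn (vp j) * ddc (brk G (dd j) z) j) + ksgn (vp j) * ddc (brk G (dd j) u) j"
          unfolding G.brk_add G.brk_simps
            ddc_add[OF G.subspace_scale[OF subspace_deg brk_dd_deg0[OF j z]] brk_dd_deg0[OF j u(1)] j]
            ddc_scale[OF brk_dd_deg0[OF j z] j]
          by (simp only: distrib_left mult.left_commute)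
      qed
      ultimately show ?thesis
        unfolding sum.distrib sum_distrib_left[symmetric]
        by (simp only: alg)
    qed
    finally show ?case using G.subspace_add[OF subspace_deg cz u(1)] by blast
  qed
  then show ?thesis ..
qed

section \<open>Degree zero elements acting on words\<close>

lemma fil0: "x \<in> deg G 0 \<Longrightarrow> x \<in> fil G 0"
  using deg_fil[of 0 0] by blast

lemma brk_deg0_O: "x \<in> deg G 0 \<Longrightarrow> z \<in> G.span (deg G (- 1) \<union> deg G (- 3)) \<Longrightarrow>
    brk G x z \<in> G.span (deg G (- 1) \<union> deg G (- 3))"
  using brk_O(1)[of z x 0] by simp

text \<open>The Leibniz rule: an even x passes the letters without sign, and each letter in turn is
  replaced by the expansion of its bracket with x.\<close>

lemma act_deg0_dword_even:
  assumes x: "x \<in> deg G 0" "x \<in> par G 0"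
    and c: "\<And>i. i \<in> \<Omega> \<Longrightarrow> brk G x (d i) = (\<Sum>k\<in>\<Omega>. scl G (c i k) (d k))"
  shows "set js \<subseteq> \<Omega> \<Longrightarrow> act M x (dword js w) =
    (\<Sum>t<length js. \<Sum>k\<in>\<Omega>. scl M (c (js ! t) k) (dword (js[t := k]) w)) + dword js (act F x w)"
proof (induction js)
  case Nil
  show ?case using act_\<iota>[OF fil0[OF x(1)]] by simp
next
  case (Cons i js)
  have i: "i \<in> \<Omega>" using Cons by simp
  have "act M x (dword (i # js) w) = act M (brk G x (d i)) (dword js w) + act M (d i) (act M x (dword js w))"
    using act_commute[OF x(2) d_par[OF i]] by simp
  also have "act M (brk G x (d i)) (dword js w) = (\<Sum>k\<in>\<Omega>. scl M (c i k) (dword (k # js) w))"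
    unfolding c[OF i] act_sum_left act_left by simp
  also have "act M (d i) (act M x (dword js w)) =
      (\<Sum>t<length js. \<Sum>k\<in>\<Omega>. scl M (c (js ! t) k) (dword (i # js[t := k]) w)) + dword (i # js) (act F x w)"
    using Cons by (simp add: act_right act_sum)
  finally show ?case by (simp only: length_Cons sum.lessThan_Suc_shift nth_Cons_0 nth_Cons_Suc list_update_code add.assoc)
qed

text \<open>[x, d i] is even, yet lies in the odd space of degrees -1 and -3, so it vanishes; x
  merely picks up a sign at each letter.\<close>

lemma act_deg0_dword_odd:
  assumes x: "x \<in> deg G 0" "x \<in> par G 1"
  shows "set js \<subseteq> \<Omega> \<Longrightarrow> act M x (dword js w) = scl M ((- 1) ^ length js) (dword js (act F x w))"
proof (induction js)
  case Nil
  show ?case using act_\<iota>[OF fil0[OF x(1)]] by simp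
next
  case (Cons i js)
  have i: "i \<in> \<Omega>" using Cons by simp
  have "G.span (deg G (- 1) \<union> deg G (- 3)) \<subseteq> par G 1"
    by (rule G.span_minimal) (use deg_odd[of "- 1"] deg_odd[of "- 3"] in simp_all)
  then have "brk G x (d i) \<in> par G 1" using brk_deg0_O[OF x(1) d_O[OF i]] by blast
  moreover have "brk G x (d i) \<in> par G 0" using G.brk_par[OF x(2) d_par[OF i]] by simp
  ultimately have "brk G x (d i) = 0" by (rule G.par_disjoint) simp
  then have "act M x (dword (i # js) w) = scl M (- 1) (act M (d i) (act M x (dword js w)))"
    using act_commute[OF x(2) d_par[OF i]] by simp
  then show ?case using Cons by (simp add: act_right)
qed

text \<open>In contrast to \<open>filt_act\<close>, an element of degree zero does not lengthen
  words, since its brackets with the \<open>d i\<close> are combinations of the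
  \<open>d k\<close>.\<close>

lemma filt_deg0:
  assumes x: "x \<in> deg G 0" and w: "set js \<subseteq> \<Omega>" shows "filt (length js) (act M x (dword js w))"
proof -
  obtain x0 x1 where *: "x0 \<in> deg G 0 \<inter> par G 0" "x1 \<in> deg G 0 \<inter> par G 1" "x = x0 + x1"
    using deg_decomp_par[OF x] by blast
  have "\<forall>i\<in>\<Omega>. \<exists>c. brk G x0 (d i) = (\<Sum>k\<in>\<Omega>. scl G (c k) (d k))"
    using * d_sum[OF brk_deg0_O[OF _ d_O]] by blast
  then obtain c where c: "\<forall>i\<in>\<Omega>. brk G x0 (d i) = (\<Sum>k\<in>\<Omega>. scl G (c i k) (d k))" by metis
  have "filt (length js) (act M x0 (dword js w))"
  proof -
    have "filt (length js) (dword (js[t := k]) w)" if "k \<in> \<Omega>" for t k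
      by (rule filt_word) (use set_update_subset_insert[of js t k] assms(2) that in auto)
    moreover have "filt (length js) (dword js (act F x0 w))" by (rule filt_word[OF assms(2)]) simp
    moreover have "act M x0 (dword js w) =
        (\<Sum>t<length js. \<Sum>k\<in>\<Omega>. scl M (c (js ! t) k) (dword (js[t := k]) w)) + dword js (act F x0 w)"
      by (rule act_deg0_dword_even) (use * c assms(2) in auto)
    ultimately show ?thesis by (simp only: filt_add filt_sum filt_scale)
  qed
  moreover have "filt (length js) (act M x1 (dword js w))"
    using act_deg0_dword_odd[of x1 js w] * w by (auto intro!: filt_scale filt_word)
  ultimately show ?thesis unfolding * act_left by (rule filt_add)
qed

section \<open>The functionals dual to the full word\<close>

abbreviation "letters \<equiv> sorted_list_of_set \<Omega>"

lemma letters: "set letters = \<Omega>" "length letters = n" "distinct letters"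
  by simp_all

lemma e_top_not_distinct:
  assumes h: "h \<in> {1..l}" and js: "set js \<subseteq> \<Omega>" "length js \<le> n" "distinct js \<longrightarrow> length js < n"
  shows "e \<Omega> h (dword js w) = 0"
proof (rule dual_top_not_distinct[OF e_conf_dual[OF subset_refl h] _ js])
  show "e \<Omega> h (dI M \<iota> d v J k) = 0" if "J \<subset> \<Omega>" "k \<in> {1..l}" for J k
  proof -
    have "J \<subseteq> \<Omega>" "J \<noteq> \<Omega>" using that(1) by auto
    then show ?thesis using e_dI[OF subset_refl h _ that(2), of J] by (auto simp: mon_0)
  qed
qed

lemma F_rep: "w = (\<Sum>k\<in>{1..l}. scl F (coord F l v k w) (v k))"
proof -
  note b = F_basis_facts
  have "(\<Sum>u\<in>v ` {1..l}. scl F (F.representation (v ` {1..l}) w u) u) = w"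
    by (rule F.sum_representation_eq[OF b(2)]) (use b(3) in auto)
  then show ?thesis unfolding sum.reindex[OF b(1)] coord_def o_def by (rule sym)
qed

lemma coord_add: "coord F l v h (u + w) = coord F l v h u + coord F l v h w"
  and coord_scale: "coord F l v h (scl F c w) = c * coord F l v h w"
  unfolding coord_def using F_basis_facts by (simp_all add: F.representation_add F.representation_scale)

lemma coord_basis: "h \<in> {1..l} \<Longrightarrow> k \<in> {1..l} \<Longrightarrow> coord F l v h (v k) = (if h = k then 1 else 0)"
  unfolding coord_def
  by (subst F.representation_basis[OF F_basis_facts(2)]) (simp_all add: inj_on_eq_iff[OF F_basis_facts(1)])

lemma e_top_dword:
  assumes h: "h \<in> {1..l}" shows "e \<Omega> h (dword letters w) = const (coord F l v h w)"
proof -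
  note f = e_conf_dual[OF subset_refl h]
  interpret W: Vector_Spaces.linear "scl F" "scl M" "dword letters"
    by unfold_locales (simp_all add: dword_add dword_scale)
  have "dword letters w = dword letters (\<Sum>k\<in>{1..l}. scl F (coord F l v k w) (v k))" using F_rep by (rule arg_cong)
  also have "\<dots> = (\<Sum>k\<in>{1..l}. scl M (coord F l v k w) (dword letters (v k)))" by (simp only: W.sum W.scale)
  finally have "e \<Omega> h (dword letters w) = (\<Sum>k\<in>{1..l}. e \<Omega> h (scl M (coord F l v k w) (dword letters (v k))))"
    by (simp only: conf_dual_sum[OF f])
  also have "\<dots> = (\<Sum>k\<in>{1..l}. if k = h then const (coord F l v h w) else 0)"
  proof (rule sum.cong[OF refl])
    fix k assume k: "k \<in> {1..l}"
    have "e \<Omega> h (dword letters (v k)) = const (if h = k then 1 else 0)"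
      using e_dI[OF subset_refl h subset_refl k] unfolding dI_dword by simp
    then show "e \<Omega> h (scl M (coord F l v k w) (dword letters (v k))) = (if k = h then const (coord F l v h w) else 0)"
      unfolding conf_dualD(2)[OF f] by (auto simp: mon_Nil fun_eq_iff)
  qed
  also have "\<dots> = const (coord F l v h w)" using h by simp
  finally show ?thesis .
qed

text \<open>Replacing a letter of the full word by a different one creates a repetition, on which
  the functional vanishes. Only diagonal terms survive, and they add up to the trace.\<close>

lemma e_act_top_even:
  assumes x: "x \<in> deg G 0" "x \<in> par G 0" and h: "h \<in> {1..l}"
    and c: "\<And>i. i \<in> \<Omega> \<Longrightarrow> brk G x (d i) = (\<Sum>k\<in>\<Omega>. scl G (c i k) (d k))"
  shows "e \<Omega> h (act M x (dword letters w)) = const ((\<Sum>i\<in>\<Omega>. c i i) * coord F l v h w + coord F l v h (act F x w))"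
proof -
  note f = e_conf_dual[OF subset_refl h]
  have kill: "e \<Omega> h (dword (letters[t := k]) w) = (if k = letters ! t then const (coord F l v h w) else 0)"
    if t: "t < n" and k: "k \<in> \<Omega>" for t k
  proof (cases "k = letters ! t")
    case True
    then show ?thesis using e_top_dword[OF h] by simp
  next
    case False
    have sub: "set (letters[t := k]) \<subseteq> \<Omega>" using set_update_subset_insert[of letters t k] k letters by auto
    have "\<not> distinct (letters[t := k])"
    proof
      assume "distinct (letters[t := k])"
      then have "card (set (letters[t := k])) = n" using distinct_card letters(2) by fastforce
      then have eq: "set (letters[t := k]) = \<Omega>" using sub by (intro card_subset_eq) simp_all
      have "letters ! t \<in> \<Omega>" using t letters nth_mem by metis
      then obtain u where u: "u < n" "letters[t := k] ! u = letters ! t" using eq by (metis in_set_conv_nth length_list_update letters(2))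
      then show False using False t letters by (metis nth_list_update nth_eq_iff_index_eq)
    qed
    then show ?thesis using False e_top_not_distinct[OF h sub] letters(2) by simp
  qed
  have "e \<Omega> h (act M x (dword letters w)) =
      (\<Sum>t<n. \<Sum>k\<in>\<Omega>. e \<Omega> h (scl M (c (letters ! t) k) (dword (letters[t := k]) w))) + e \<Omega> h (dword letters (act F x w))"
    using act_deg0_dword_even[OF x c, of letters w] letters by (simp only: conf_dualD(1)[OF f] conf_dual_sum[OF f] subset_refl)
  also have "(\<Sum>t<n. \<Sum>k\<in>\<Omega>. e \<Omega> h (scl M (c (letters ! t) k) (dword (letters[t := k]) w))) =
      (\<Sum>t<n. const (c (letters ! t) (letters ! t) * coord F l v h w))"
  proof (rule sum.cong[OF refl])
    fix t assume t: "t \<in> {..<n}"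
    have "letters ! t \<in> \<Omega>" using t letters nth_mem by (metis lessThan_iff)
    have "(\<Sum>k\<in>\<Omega>. e \<Omega> h (scl M (c (letters ! t) k) (dword (letters[t := k]) w))) =
        (\<Sum>k\<in>\<Omega>. if k = letters ! t then const (c (letters ! t) (letters ! t) * coord F l v h w) else 0)"
    proof (rule sum.cong[OF refl])
      fix k assume k: "k \<in> \<Omega>"
      have "t < n" using t by simp
      show "e \<Omega> h (scl M (c (letters ! t) k) (dword (letters[t := k]) w)) = (if k = letters ! t then const (c (letters ! t) (letters ! t) * coord F l v h w) else 0)"
        unfolding conf_dualD(2)[OF f] kill[OF \<open>t < n\<close> k] by (auto simp: mon_Nil fun_eq_iff)
    qed
    then show "(\<Sum>k\<in>\<Omega>. e \<Omega> h (scl M (c (letters ! t) k) (dword (letters[t := k]) w))) = const (c (letters ! t) (letters ! t) * coord F l v h w)"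
      using \<open>letters ! t \<in> \<Omega>\<close> by simp
  qed
  also have "\<dots> = (\<Sum>i\<in>\<Omega>. const (c i i * coord F l v h w))"
  proof -
    have "bij_betw ((!) letters) {..<n} \<Omega>" using bij_betw_nth[OF letters(3), of "{..<n}" \<Omega>] letters by simp
    then show ?thesis by (rule sum.reindex_bij_betw)
  qed
  also have "\<dots> = const ((\<Sum>i\<in>\<Omega>. c i i) * coord F l v h w)"
    by (rule ext) (simp add: sum_fun_apply mon_Nil sum_distrib_right)
  finally show ?thesis unfolding e_top_dword[OF h] mon_Nil_add .
qed

lemma e_act_top_odd:
  assumes x: "x \<in> deg G 0" "x \<in> par G 1" and h: "h \<in> {1..l}"
  shows "e \<Omega> h (act M x (dword letters w)) = const ((- 1) ^ n * coord F l v h (act F x w))"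
proof -
  have "act M x (dword letters w) = scl M ((- 1) ^ n) (dword letters (act F x w))"
    using act_deg0_dword_odd[OF x, of letters w] letters by simp
  then show ?thesis by (simp only: conf_dualD(2)[OF e_conf_dual[OF subset_refl h]] e_top_dword[OF h] mon_Nil_scale)
qed

text \<open>Supplies the constants required by \<open>\<sigma>_deg0\<close>. If J is not full,
  degree zero elements stay among words shorter than \<open>n\<close>, where the functional
  vanishes.\<close>

lemma e_act_const:
  assumes z: "z \<in> deg G 0" and h: "h \<in> {1..l}" and J: "J \<subseteq> \<Omega>"
  shows "\<exists>c. e \<Omega> h (act M z (dI M \<iota> d v J k)) = const c" "J \<noteq> \<Omega> \<Longrightarrow> e \<Omega> h (act M z (dI M \<iota> d v J k)) = 0"
proof -
  note f = e_conf_dual[OF subset_refl h]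
  have fin: "finite J" using J by (rule finite_subset) simp
  show 0: "e \<Omega> h (act M z (dI M \<iota> d v J k)) = 0" if "J \<noteq> \<Omega>"
  proof -
    let ?js = "sorted_list_of_set J"
    have "J \<subset> \<Omega>" using that J by blast
    then have "card J < n" using psubset_card_mono[of \<Omega> J] by simp
    then have len: "length ?js < n" by simp
    have "filt (length ?js) (act M z (dword ?js (v k)))" by (rule filt_deg0[OF z]) (use J fin in simp)
    then show ?thesis unfolding dI_dword
      by (rule dual_filt[OF f, rotated]) (use e_top_not_distinct[OF h] len in auto)
  qed
  show "\<exists>c. e \<Omega> h (act M z (dI M \<iota> d v J k)) = const c"
  proof (cases "J = \<Omega>")
    case False
    then show ?thesis using 0 mon_0[of vp "[]"] by metis
  next
    case True
    obtain x0 x1 where *: "x0 \<in> deg G 0 \<inter> par G 0" "x1 \<in> deg G 0 \<inter> par G 1" "z = x0 + x1"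
      using deg_decomp_par[OF z] by blast
    have "\<forall>i\<in>\<Omega>. \<exists>c. brk G x0 (d i) = (\<Sum>k\<in>\<Omega>. scl G (c k) (d k))"
      using * d_sum[OF brk_deg0_O[OF _ d_O]] by blast
    then obtain c where c: "\<And>i. i \<in> \<Omega> \<Longrightarrow> brk G x0 (d i) = (\<Sum>k\<in>\<Omega>. scl G (c i k) (d k))" by metis
    have "\<exists>a. e \<Omega> h (act M x0 (dword letters (v k))) = const a" using e_act_top_even[OF _ _ h c] * by blast
    moreover have "\<exists>b. e \<Omega> h (act M x1 (dword letters (v k))) = const b" using e_act_top_odd[OF _ _ h] * by blast
    ultimately obtain a b where "e \<Omega> h (act M x0 (dword letters (v k))) = const a" "e \<Omega> h (act M x1 (dword letters (v k))) = const b"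
      by blast
    then have "e \<Omega> h (act M z (dI M \<iota> d v J k)) = const (a + b)"
      unfolding True dI_dword * act_left conf_dualD(1)[OF f] mon_Nil_add by (simp only:)
    then show ?thesis by blast
  qed
qed

end

lemma sum_fsc_const:
  "finite S \<Longrightarrow> (\<Sum>k\<in>S. fsc (*) (a k) (mon (*) p [] (if k = j then 1 else 0))) = mon (*) p [] (if j \<in> S then a j else (0::'k::field))"
  by (rule ext) (simp add: sum_fun_apply mon_Nil if_distrib[of "(*) _"] cong: if_cong)

context conformal_dual
begin

section \<open>The supertrace on the negative part\<close>

definition \<chi> :: "'g \<Rightarrow> 'k" where
  "\<chi> = (\<lambda>x. supertrace G (neg_part G) (brk G x))"

definition B\<^sub>0 :: "'g set" where "B\<^sub>0 = d ` \<Omega> \<union> dd ` X"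

lemma neg_part_span: "neg_part G = G.span B\<^sub>0"
proof
  have deg: "deg G j \<subseteq> G.span B\<^sub>0" if "j < 0" for j
  proof (cases "j < - 3")
    case True
    then show ?thesis using deg_below G.span_zero by simp
  next
    case False
    then have "j = - 2 \<or> j = - 1 \<or> j = - 3" using that by auto
    moreover have "deg G (- 2) \<subseteq> G.span B\<^sub>0" unfolding deg_m2_span B\<^sub>0_def by (rule G.span_mono) blast
    moreover have "deg G (- 1) \<union> deg G (- 3) \<subseteq> G.span (d ` \<Omega>)" unfolding d_span by (rule G.span_superset)
    moreover have "G.span (d ` \<Omega>) \<subseteq> G.span B\<^sub>0" unfolding B\<^sub>0_def by (rule G.span_mono) blast
    ultimately show ?thesis by blast
  qed
  show "neg_part G \<subseteq> G.span B\<^sub>0"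
    unfolding neg_part_def by (rule G.span_minimal[OF _ G.subspace_span]) (use deg in blast)
  show "G.span B\<^sub>0 \<subseteq> neg_part G"
    unfolding neg_part_def
  proof (rule G.span_minimal[OF _ G.subspace_span])
    have "d ` \<Omega> \<subseteq> G.span (deg G (- 1) \<union> deg G (- 3))" using d_O by blast
    also have "\<dots> \<subseteq> G.span (\<Union>j\<in>{..<0}. deg G j)" by (rule G.span_mono, rule Un_least; rule UN_upper, simp)
    finally have "d ` \<Omega> \<subseteq> G.span (\<Union>j\<in>{..<0}. deg G j)" .
    moreover have "dd ` X \<subseteq> (\<Union>j\<in>{..<0}. deg G j)"
    proof
      fix z assume "z \<in> dd ` X"
      then have "z \<in> deg G (- 2)" using dd_deg by blast
      then show "z \<in> (\<Union>j\<in>{..<0}. deg G j)" by (rule UN_I[rotated]) simp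
    qed
    ultimately show "B\<^sub>0 \<subseteq> G.span (\<Union>j\<in>{..<0}. deg G j)"
      unfolding B\<^sub>0_def using G.span_superset[of "\<Union>j\<in>{..<0}. deg G j"] by (intro Un_least) (assumption, rule order_trans)
  qed
qed

lemma brk_neg_part: assumes x: "x \<in> deg G 0" shows "brk G x ` neg_part G \<subseteq> neg_part G"
proof
  fix z assume "z \<in> brk G x ` neg_part G"
  then obtain u where u: "u \<in> neg_part G" "z = brk G x u" by blast
  from u(1)[unfolded neg_part_def] have "brk G x u \<in> neg_part G"
    unfolding neg_part_def
  proof (induction rule: G.span_induct_alt)
    case base
    show ?case unfolding G.brk_simps by (rule G.span_zero)
  next
    case (step c w u)
    then obtain j where j: "j \<in> {..<0}" "w \<in> deg G j" by blast
    have "brk G x w \<in> deg G j" using deg_brk[OF x j(2)] by simp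
    then have "brk G x w \<in> G.span (\<Union>j\<in>{..<0}. deg G j)" using j(1) by (intro G.span_base) blast
    then show ?case using step(2) by (simp only: G.brk_add G.brk_simps G.span_add G.span_scale)
  qed
  then show "z \<in> neg_part G" unfolding u(2) .
qed

lemma B\<^sub>0_homogeneous: "finite B\<^sub>0" "B\<^sub>0 \<subseteq> par G 0 \<union> par G 1"
proof -
  show "finite B\<^sub>0" unfolding B\<^sub>0_def by simp
  have par: "par G p \<subseteq> par G 0 \<union> par G 1" for p by (cases p) simp_all
  have "d i \<in> par G 0 \<union> par G 1" if "i \<in> \<Omega>" for i using d_par[OF that] by (rule UnI2)
  moreover have "dd j \<in> par G 0 \<union> par G 1" if "j \<in> X" for j using dd_par[OF that] par[THEN subsetD] by (rule_tac par[THEN subsetD])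
  ultimately show "B\<^sub>0 \<subseteq> par G 0 \<union> par G 1" unfolding B\<^sub>0_def by (intro Un_least image_subsetI)
qed

text \<open>There is no index \<open>h\<close> here from which to deduce that
  \<open>B\<^sub>0\<close> is independent; a maximal independent subset of it is a homogeneous basis
  in any case.\<close>

lemma character_\<chi>: "character G (deg G 0) \<chi>"
proof -
  obtain B where B: "B \<subseteq> B\<^sub>0" "G.independent B" "B\<^sub>0 \<subseteq> G.span B"
    using G.maximal_independent_subset[of B\<^sub>0] by blast
  have "G.span B = neg_part G" unfolding neg_part_span G.span_eq using B(1,3) G.span_superset[of B\<^sub>0] by (metis order_trans)
  then have "G.homogeneous_basis (neg_part G) B"
    unfolding G.homogeneous_basis_def using B B\<^sub>0_homogeneous finite_subset by blast
  then show ?thesis unfolding \<chi>_def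
  proof (rule G.character_supertrace[OF _ subspace_deg])
    show "brk G x z \<in> deg G 0" if "x \<in> deg G 0" "z \<in> deg G 0" for x z
      using deg_brk[OF that] by simp
  qed (rule brk_neg_part, assumption, rule deg_decomp_par, assumption)
qed

text \<open>Let the relation act on \<open>\<iota> (v h)\<close> and apply the functional dual to
  d_i v_h. It kills \<open>\<iota> (v h)\<close>, hence all derivatives of it, and picks out the
  coefficient \<open>c i\<close>. What remains is a relation among derivatives.\<close>

lemma d_dd_independent:
  assumes h: "h \<in> {1..l}" and 0: "(\<Sum>i\<in>\<Omega>. scl G (c i) (d i)) + (\<Sum>j\<in>X. scl G (b j) (dd j)) = 0"
  shows "\<forall>i\<in>\<Omega>. c i = 0" "\<forall>j\<in>X. b j = 0"
proof -
  show c: "\<forall>i\<in>\<Omega>. c i = 0"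
  proof
    fix i assume i: "i \<in> \<Omega>"
    have I: "{i} \<subseteq> \<Omega>" using i by simp
    note f = e_conf_dual[OF I h]
    let ?f = "e {i} h" and ?m = "\<iota> (v h)"
    have "?f ?m = 0" using e_dI[OF I h _ h, of "{}"] by (simp add: dI_def mon_0)
    then have dd0: "?f (act M (dd j) ?m) = 0" if "j \<in> X" for j by (rule dual_dd_0[OF f that])
    have d: "?f (act M (d k) ?m) = const (if k = i then 1 else 0)" if "k \<in> \<Omega>" for k
    proof -
      have "({i} = {k} \<and> h = h) = (k = i)" by auto
      moreover have "dI M \<iota> d v {k} h = act M (d k) ?m" by (simp add: dI_def)
      moreover have "{k} \<subseteq> \<Omega>" using that by simp
      ultimately show ?thesis using e_dI[OF I h _ h, of "{k}"] by (simp only:)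
    qed
    have "?f (act M ((\<Sum>i\<in>\<Omega>. scl G (c i) (d i)) + (\<Sum>j\<in>X. scl G (b j) (dd j))) ?m) = 0"
      unfolding 0 act_0 by (rule conf_dualD(3)[OF f])
    then have "(\<Sum>k\<in>\<Omega>. fsc (*) (c k) (?f (act M (d k) ?m))) + (\<Sum>j\<in>X. fsc (*) (b j) (?f (act M (dd j) ?m))) = 0"
      unfolding act_left(1) act_sum_left act_left(2) conf_dualD(1)[OF f] conf_dual_sum[OF f] conf_dualD(2)[OF f] .
    moreover have "(\<Sum>j\<in>X. fsc (*) (b j) (?f (act M (dd j) ?m))) = 0"
      by (rule sum.neutral) (auto simp: dd0 fun_eq_iff)
    moreover have "(\<Sum>k\<in>\<Omega>. fsc (*) (c k) (?f (act M (d k) ?m))) = const (c i)"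
    proof -
      have "(\<Sum>k\<in>\<Omega>. fsc (*) (c k) (?f (act M (d k) ?m))) = (\<Sum>k\<in>\<Omega>. fsc (*) (c k) (const (if k = i then 1 else 0)))"
        by (rule sum.cong[OF refl]) (simp only: d)
      then show ?thesis unfolding sum_fsc_const[OF finite_atLeastAtMost] if_P[OF i] .
    qed
    ultimately have "const (c i) = 0" by (simp only: add_0_right)
    then show "c i = 0" using fun_cong[of _ _ "[]"] by (fastforce simp: mon_Nil)
  qed
  have "(\<Sum>i\<in>\<Omega>. scl G (c i) (d i)) = 0" by (rule sum.neutral) (use c in simp)
  then have "(\<Sum>j\<in>X. scl G (b j) (dd j)) = 0" using 0 by (simp only: add_0_left)
  then show "\<forall>j\<in>X. b j = 0" using dd_sum_eq_0 by blast
qed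

lemma inj_d: "inj_on d \<Omega>"
  using d_basis unfolding basis_of_def by blast

lemma inj_dd: "inj_on dd X"
proof (rule inj_onI, rule ccontr)
  fix i j assume ij: "i \<in> X" "j \<in> X" "dd i = dd j" "i \<noteq> j"
  let ?c = "\<lambda>k. if k = i then 1 else if k = j then - 1 else (0::'k)"
  have "(\<Sum>k\<in>X. scl G (?c k) (dd k)) = (\<Sum>k\<in>{i, j}. scl G (?c k) (dd k))"
    by (rule sum.mono_neutral_right) (use ij in auto)
  also have "\<dots> = 0" using ij by simp
  finally have "?c i = 0" by (rule dd_sum_eq_0[OF _ ij(1)])
  then show False by simp
qed

lemma d_neq_dd:
  assumes h: "h \<in> {1..l}" and i: "i \<in> \<Omega>" and j: "j \<in> X" shows "d i \<noteq> dd j"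
proof
  assume eq: "d i = dd j"
  have "(\<Sum>k\<in>\<Omega>. scl G (if k = i then 1 else 0) (d k)) = (\<Sum>k\<in>\<Omega>. if k = i then d i else 0)"
    by (rule sum.cong) auto
  moreover have "(\<Sum>k\<in>X. scl G (if k = j then - 1 else 0) (dd k)) = (\<Sum>k\<in>X. if k = j then - dd j else 0)"
    by (rule sum.cong) auto
  ultimately have "(\<Sum>k\<in>\<Omega>. scl G (if k = i then 1 else 0) (d k)) + (\<Sum>k\<in>X. scl G (if k = j then - 1 else 0) (dd k)) = 0"
    using i j eq by simp
  from bspec[OF d_dd_independent(1)[OF h this] i] show False by simp
qed

lemma sum_B\<^sub>0:
  fixes g :: "'g \<Rightarrow> 'c::comm_monoid_add"
  assumes h: "h \<in> {1..l}"
  shows "sum g B\<^sub>0 = (\<Sum>i\<in>\<Omega>. g (d i)) + (\<Sum>j\<in>X. g (dd j))"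
proof -
  have "d ` \<Omega> \<inter> dd ` X = {}" using d_neq_dd[OF h] by blast
  then have "sum g B\<^sub>0 = sum g (d ` \<Omega>) + sum g (dd ` X)" unfolding B\<^sub>0_def by (intro sum.union_disjoint) simp_all
  then show ?thesis by (simp only: sum.reindex[OF inj_d] sum.reindex[OF inj_dd] o_def)
qed

lemma B\<^sub>0_basis: assumes h: "h \<in> {1..l}" shows "G.homogeneous_basis (neg_part G) B\<^sub>0"
proof -
  have "G.independent B\<^sub>0"
  proof (rule G.independent_if_scalars_zero[OF B\<^sub>0_homogeneous(1)])
    fix g z assume "(\<Sum>x\<in>B\<^sub>0. scl G (g x) x) = 0" and z: "z \<in> B\<^sub>0"
    then have "(\<Sum>i\<in>\<Omega>. scl G (g (d i)) (d i)) + (\<Sum>j\<in>X. scl G (g (dd j)) (dd j)) = 0"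
      unfolding sum_B\<^sub>0[OF h] by simp
    from d_dd_independent[OF h this] z show "g z = 0" unfolding B\<^sub>0_def by blast
  qed
  then show ?thesis unfolding G.homogeneous_basis_def using B\<^sub>0_homogeneous neg_part_span by blast
qed

lemma representation_B\<^sub>0:
  assumes h: "h \<in> {1..l}" and z: "z = (\<Sum>i\<in>\<Omega>. scl G (c i) (d i)) + (\<Sum>j\<in>X. scl G (b j) (dd j))"
  shows "i \<in> \<Omega> \<Longrightarrow> G.representation B\<^sub>0 z (d i) = c i" "j \<in> X \<Longrightarrow> G.representation B\<^sub>0 z (dd j) = b j"
proof -
  let ?r = "G.representation B\<^sub>0 z"
  have "z \<in> G.span B\<^sub>0" unfolding z B\<^sub>0_def
    by (intro G.span_add G.span_sum G.span_scale G.span_base) auto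
  then have "(\<Sum>x\<in>B\<^sub>0. scl G (?r x) x) = z"
    using B\<^sub>0_basis[OF h] unfolding G.homogeneous_basis_def by (intro G.sum_representation_eq) auto
  then have "(\<Sum>i\<in>\<Omega>. scl G (?r (d i)) (d i)) + (\<Sum>j\<in>X. scl G (?r (dd j)) (dd j)) =
      (\<Sum>i\<in>\<Omega>. scl G (c i) (d i)) + (\<Sum>j\<in>X. scl G (b j) (dd j))" unfolding sum_B\<^sub>0[OF h] z[symmetric] .
  then have "(\<Sum>i\<in>\<Omega>. scl G (?r (d i) - c i) (d i)) + (\<Sum>j\<in>X. scl G (?r (dd j) - b j) (dd j)) = 0"
    unfolding G.scale_left_diff_distrib sum_subtractf by (simp add: algebra_simps)
  from d_dd_independent[OF h this]
  show "i \<in> \<Omega> \<Longrightarrow> ?r (d i) = c i" "j \<in> X \<Longrightarrow> ?r (dd j) = b j" by simp_all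
qed

lemma representation_ddc:
  assumes h: "h \<in> {1..l}" and z: "z \<in> deg G (- 2)" and j: "j \<in> X"
  shows "G.representation B\<^sub>0 z (dd j) = ddc z j"
proof (rule representation_B\<^sub>0(2)[OF h _ j, of _ "\<lambda>_. 0"])
  have "z = (\<Sum>j\<in>X. scl G (ddc z j) (dd j))" by (rule ddc[OF z])
  then show "z = (\<Sum>i\<in>\<Omega>. scl G 0 (d i)) + (\<Sum>j\<in>X. scl G (ddc z j) (dd j))" by simp
qed

lemma B\<^sub>0_nonzero: assumes h: "h \<in> {1..l}" and "z \<in> B\<^sub>0" shows "z \<noteq> 0"
  using B\<^sub>0_basis[OF h] assms(2) G.dependent_zero unfolding G.homogeneous_basis_def by metis

lemma brk_dd_even:
  assumes x: "x \<in> deg G 0" "x \<in> par G 0" and j: "j \<in> X"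
  shows "ddc (brk G x (dd j)) j = - ddc (brk G (dd j) x) j"
proof -
  have "brk G x (dd j) = scl G (- 1) (brk G (dd j) x)"
    using G.brk_skew[OF dd_par[OF j] x(2)] by simp
  then show ?thesis using ddc_scale[OF brk_dd_deg0[OF j x(1)] j, of "- 1"] by simp
qed

text \<open>The \<open>d i\<close> are odd and contribute minus the trace. A derivative contributes
  with the sign of its parity, and rewriting [x, dd j] as -[dd j, x] gives the other minus.\<close>

lemma \<chi>_even:
  assumes h: "h \<in> {1..l}" and x: "x \<in> deg G 0" "x \<in> par G 0"
    and c: "\<And>i. i \<in> \<Omega> \<Longrightarrow> brk G x (d i) = (\<Sum>k\<in>\<Omega>. scl G (c i k) (d k))"
  shows "\<chi> x = - (\<Sum>i\<in>\<Omega>. c i i) - (\<Sum>j\<in>X. ksgn (vp j) * ddc (brk G (dd j) x) j)"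
proof -
  have "\<chi> x = G.str_sum B\<^sub>0 (brk G x)"
    unfolding \<chi>_def by (rule G.supertrace_eq[OF B\<^sub>0_basis[OF h] G.linear_brk brk_neg_part[OF x(1)]])
  also have "\<dots> = (\<Sum>i\<in>\<Omega>. G.parity_sign (d i) * G.representation B\<^sub>0 (brk G x (d i)) (d i)) +
      (\<Sum>j\<in>X. G.parity_sign (dd j) * G.representation B\<^sub>0 (brk G x (dd j)) (dd j))"
    unfolding G.str_sum_def by (rule sum_B\<^sub>0[OF h])
  also have "(\<Sum>i\<in>\<Omega>. G.parity_sign (d i) * G.representation B\<^sub>0 (brk G x (d i)) (d i)) = (\<Sum>i\<in>\<Omega>. - c i i)"
  proof (rule sum.cong[OF refl])
    fix i assume i: "i \<in> \<Omega>"
    have "G.parity_sign (d i) = - 1"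
      using G.parity_sign[OF d_par[OF i] B\<^sub>0_nonzero[OF h]] i unfolding B\<^sub>0_def by simp
    moreover have "G.representation B\<^sub>0 (brk G x (d i)) (d i) = c i i"
      by (rule representation_B\<^sub>0(1)[OF h _ i, of _ _ "\<lambda>_. 0"]) (simp add: c[OF i])
    ultimately show "G.parity_sign (d i) * G.representation B\<^sub>0 (brk G x (d i)) (d i) = - c i i" by simp
  qed
  also have "(\<Sum>j\<in>X. G.parity_sign (dd j) * G.representation B\<^sub>0 (brk G x (dd j)) (dd j)) =
      (\<Sum>j\<in>X. - (ksgn (vp j) * ddc (brk G (dd j) x) j))"
  proof (rule sum.cong[OF refl])
    fix j assume j: "j \<in> X"
    have "brk G x (dd j) \<in> deg G (- 2)" using deg_brk[OF x(1) dd_deg[OF j]] by simp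
    then have "G.representation B\<^sub>0 (brk G x (dd j)) (dd j) = - ddc (brk G (dd j) x) j"
      using representation_ddc[OF h _ j] brk_dd_even[OF x j] by simp
    moreover have "G.parity_sign (dd j) = ksgn (vp j)"
      using G.parity_sign[OF dd_par[OF j] B\<^sub>0_nonzero[OF h]] j unfolding B\<^sub>0_def by simp
    ultimately show "G.parity_sign (dd j) * G.representation B\<^sub>0 (brk G x (dd j)) (dd j) = - (ksgn (vp j) * ddc (brk G (dd j) x) j)"
      by simp
  qed
  finally show ?thesis by (simp add: sum_negf)
qed

lemma \<chi>_odd: "x \<in> deg G 0 \<Longrightarrow> x \<in> par G 1 \<Longrightarrow> \<chi> x = 0"
  using character_\<chi> unfolding character_def by blast

text \<open>Bracketing with an odd element reverses the parity of a derivative, so the result has no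
  component along that derivative.\<close>

lemma ddc_odd:
  assumes h: "h \<in> {1..l}" and x: "x \<in> deg G 0" "x \<in> par G 1" and j: "j \<in> X"
  shows "ddc (brk G (dd j) x) j = 0"
proof (rule ccontr)
  assume nz: "ddc (brk G (dd j) x) j \<noteq> 0"
  have z: "brk G (dd j) x \<in> deg G (- 2)" by (rule brk_dd_deg0[OF j x(1)])
  have B: "B\<^sub>0 \<subseteq> par G 0 \<union> par G 1" "G.independent B\<^sub>0"
    using B\<^sub>0_basis[OF h] unfolding G.homogeneous_basis_def by blast+
  have "brk G (dd j) x \<in> G.span B\<^sub>0"
    using z G.span_mono[of "dd ` X" B\<^sub>0] unfolding deg_m2_span B\<^sub>0_def by blast
  then have "dd j \<in> par G (vp j + 1)"
    by (rule G.representation_parity[OF B _ G.brk_par[OF dd_par[OF j] x(2)]])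
      (use nz representation_ddc[OF h z j] in simp)
  moreover have "vp j \<noteq> vp j + 1" by (cases "vp j") auto
  ultimately have "dd j = 0" using G.par_disjoint[OF dd_par[OF j]] by blast
  then show False using B\<^sub>0_nonzero[OF h, of "dd j"] j unfolding B\<^sub>0_def by blast
qed

text \<open>Coefficient of the k-th dual basis vector in the shifted dual action of
  \<open>x\<close>, of parity \<open>p\<close>, on the h-th one.\<close>

definition dual_coeff :: "bit \<Rightarrow> 'g \<Rightarrow> nat \<Rightarrow> nat \<Rightarrow> 'k" where
  "dual_coeff p x h k = \<chi> x * (if k = h then 1 else 0) - ksgn (p * pv h) * coord F l v h (act F x (v k))"

lemma \<sigma>_e_top:
  assumes x: "x \<in> deg G 0 \<inter> par G p" and h: "h \<in> {1..l}" and k: "k \<in> {1..l}"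
  shows "\<sigma> x (e \<Omega> h) (dI M \<iota> d v \<Omega> k) = const (dual_coeff p x h k)"
proof -
  note f = e_conf_dual[OF subset_refl h]
  let ?q = "of_nat (card \<Omega>) + pv h"
  have eq: "\<sigma> x (e \<Omega> h) (dI M \<iota> d v \<Omega> k) = const (- ksgn (p * ?q) * (e \<Omega> h (act M x (dword letters (v k))) [] +
      (if k = h then 1 else 0) * (\<Sum>j\<in>X. ksgn (vp j) * ddc (brk G (dd j) x) j)))"
    unfolding dI_dword[symmetric]
  proof (rule \<sigma>_deg0[OF f _ _ x])
    show "e \<Omega> h (dI M \<iota> d v \<Omega> k) = const (if k = h then 1 else 0)"
    proof -
      have "(\<Omega> = \<Omega> \<and> h = k) = (k = h)" by auto
      then show ?thesis using e_dI[OF subset_refl h subset_refl k] by (simp only:)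
    qed
  qed (rule e_act_const(1)[OF _ h subset_refl])
  have cd: "coord F l v h (v k) = (if k = h then 1 else 0)" using coord_basis[OF h k] by auto
  show ?thesis
  proof (cases "p = 0")
    case True
    then have x0: "x \<in> deg G 0" "x \<in> par G 0" using x by auto
    have "\<forall>i\<in>\<Omega>. \<exists>c. brk G x (d i) = (\<Sum>k\<in>\<Omega>. scl G (c k) (d k))"
      using d_sum[OF brk_deg0_O[OF x0(1) d_O]] by blast
    then obtain c where c: "\<And>i. i \<in> \<Omega> \<Longrightarrow> brk G x (d i) = (\<Sum>k\<in>\<Omega>. scl G (c i k) (d k))" by metis
    have "e \<Omega> h (act M x (dword letters (v k))) [] = (\<Sum>i\<in>\<Omega>. c i i) * (if k = h then 1 else 0) + coord F l v h (act F x (v k))"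
      using fun_cong[OF e_act_top_even[OF x0 h c, of "v k"], of "[]"] by (simp add: mon_Nil cd)
    moreover have "\<chi> x = - (\<Sum>i\<in>\<Omega>. c i i) - (\<Sum>j\<in>X. ksgn (vp j) * ddc (brk G (dd j) x) j)"
      by (rule \<chi>_even[OF h x0 c])
    \<comment> \<open>Here a is the trace on the \<open>d i\<close>, b the action on F and S the sum
      over the derivatives, so that -a - S is the character.\<close>
    moreover have "- ksgn (p * ?q) * (a * t + b + t * S) = (- a - S) * t - ksgn (p * pv h) * b" for a b S t :: 'k
      unfolding True by (simp add: algebra_simps)
    ultimately show ?thesis unfolding eq dual_coeff_def by (simp only:)
  next
    case False
    then have p: "p = 1" using bit_eq_1_iff by blast
    then have x1: "x \<in> deg G 0" "x \<in> par G 1" using x by auto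
    have "e \<Omega> h (act M x (dword letters (v k))) [] = (- 1) ^ n * coord F l v h (act F x (v k))"
      using fun_cong[OF e_act_top_odd[OF x1 h, of "v k"], of "[]"] by (simp add: mon_Nil)
    moreover have "(\<Sum>j\<in>X. ksgn (vp j) * ddc (brk G (dd j) x) j) = 0"
      by (rule sum.neutral) (simp add: ddc_odd[OF h x1])
    \<comment> \<open>The \<open>n\<close> odd letters in the parity of the functional give a sign
      that cancels the one from moving x through the word.\<close>
    moreover have "ksgn (p * ?q) = (- 1) ^ n * (ksgn (pv h) :: 'k)"
      unfolding p mult_1_left ksgn_add ksgn_of_nat by simp
    moreover have "(- 1) ^ n * ((- 1) ^ n * u) = (u :: 'k)" for u by (rule neg_one_power_twice)
    ultimately show ?thesis unfolding eq dual_coeff_def \<chi>_odd[OF x1] p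
      by (simp only: mult_1_left mult_zero_left mult_zero_right add_0_right diff_0 mult_minus_left)
        (simp add: mult.assoc mult.left_commute)
  qed
qed

text \<open>Both sides are compared on all d_J v_k: at the top this is
  \<open>\<sigma>_e_top\<close>, and elsewhere both vanish.\<close>

lemma \<sigma>_e:
  assumes x: "x \<in> deg G 0 \<inter> par G p" and h: "h \<in> {1..l}"
  shows "\<sigma> x (e \<Omega> h) = (\<Sum>k\<in>{1..l}. scl Ms (dual_coeff p x h k) (e \<Omega> k))"
proof -
  note f = e_conf_dual[OF subset_refl h]
  let ?g = "\<Sum>k\<in>{1..l}. scl Ms (dual_coeff p x h k) (e \<Omega> k)"
  have car: "\<sigma> x (e \<Omega> h) \<in> car Ms" "?g \<in> car Ms"
    by (auto intro!: \<sigma>_car e_car Ms.subspace_sum Ms.subspace_scale)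
      (use h in auto)
  have "\<sigma> x (e \<Omega> h) - ?g = 0"
  proof (rule car_eq_0)
    show "\<sigma> x (e \<Omega> h) - ?g \<in> car Ms" using car by (intro Ms.subspace_diff) auto
    fix J k assume J: "J \<subseteq> \<Omega>" and k: "k \<in> {1..l}"
    let ?m = "dI M \<iota> d v J k"
    have "?g ?m = (\<Sum>k'\<in>{1..l}. scl Ms (dual_coeff p x h k') (e \<Omega> k') ?m)"
      by (rule sum_fun_apply)
    also have "\<dots> = (\<Sum>k'\<in>{1..l}. fsc (*) (dual_coeff p x h k') (const (if J = \<Omega> \<and> k' = k then 1 else 0)))"
      unfolding Ms_sel
    proof (rule sum.cong[OF refl])
      fix k' assume k': "k' \<in> {1..l}"
      have "(\<Omega> = J \<and> k' = k) = (J = \<Omega> \<and> k' = k)" by auto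
      then show "fsc (fsc (*)) (dual_coeff p x h k') (e \<Omega> k') ?m = fsc (*) (dual_coeff p x h k') (const (if J = \<Omega> \<and> k' = k then 1 else 0))"
        using e_dI[OF subset_refl k' J k] by (simp only: fsc_apply[of "fsc (*)"])
    qed
    also have "\<dots> = const (if J = \<Omega> then dual_coeff p x h k else 0)"
    proof (cases "J = \<Omega>")
      case True
      then show ?thesis using sum_fsc_const[of "{1..l}" "dual_coeff p x h" vp k] k by simp
    next
      case False
      have "(\<Sum>k'\<in>{1..l}. fsc (*) (dual_coeff p x h k') (const (if J = \<Omega> \<and> k' = k then 1 else 0))) = 0"
        by (rule sum.neutral) (use False in \<open>auto simp: fun_eq_iff mon_Nil\<close>)
      then show ?thesis using False by (simp add: mon_0)
    qed
    finally have g: "?g ?m = const (if J = \<Omega> then dual_coeff p x h k else 0)" .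
    have "\<sigma> x (e \<Omega> h) ?m = const (if J = \<Omega> then dual_coeff p x h k else 0)"
    proof (cases "J = \<Omega>")
      case True
      then show ?thesis using \<sigma>_e_top[OF x h k] by simp
    next
      case False
      have "e \<Omega> h ?m = const 0" using e_dI[OF subset_refl h J k] False by auto
      then have "\<sigma> x (e \<Omega> h) ?m = const (- ksgn (p * (of_nat (card \<Omega>) + pv h)) * (e \<Omega> h (act M x ?m) [] +
          0 * (\<Sum>j\<in>X. ksgn (vp j) * ddc (brk G (dd j) x) j)))"
        by (rule \<sigma>_deg0[OF f _ e_act_const(1)[OF _ h J] x])
      moreover have "e \<Omega> h (act M x ?m) [] = 0"
        using e_act_const(2)[OF _ h J False, of x k] x by simp
      ultimately show ?thesis using False by simp
    qed
    then show "(\<sigma> x (e \<Omega> h) - ?g) ?m = 0" unfolding fun_diff_def g by (intro ext) simp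
  qed
  then show ?thesis by simp
qed

section \<open>The top submodule of the dual\<close>

definition F\<^sub>\<Omega> :: "('m \<Rightarrow> nat list \<Rightarrow> 'k) set" where
  "F\<^sub>\<Omega> = Ms.span (e \<Omega> ` {1..l})"

lemma F\<^sub>\<Omega>_car: "F\<^sub>\<Omega> \<subseteq> car Ms"
  unfolding F\<^sub>\<Omega>_def by (rule Ms.span_minimal[OF _ Ms.subspace_car]) (use e_car in blast)

lemma e_F\<^sub>\<Omega>: "h \<in> {1..l} \<Longrightarrow> e \<Omega> h \<in> F\<^sub>\<Omega>"
  unfolding F\<^sub>\<Omega>_def by (rule Ms.span_base) (rule imageI)

lemma subspace_F\<^sub>\<Omega>: "Ms.subspace F\<^sub>\<Omega>"
  unfolding F\<^sub>\<Omega>_def by (rule Ms.subspace_span)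

lemma \<sigma>_0: "\<sigma> x 0 = 0"
  using \<sigma>_right(2)[OF Ms.subspace_0[OF Ms.subspace_car], of x 0] by simp

lemma \<sigma>_F\<^sub>\<Omega>: assumes x: "x \<in> deg G 0" and f: "f \<in> F\<^sub>\<Omega>" shows "\<sigma> x f \<in> F\<^sub>\<Omega>"
proof -
  obtain x0 x1 where *: "x0 \<in> deg G 0 \<inter> par G 0" "x1 \<in> deg G 0 \<inter> par G 1" "x = x0 + x1"
    using deg_decomp_par[OF x] by blast
  have e: "\<sigma> x (e \<Omega> h) \<in> F\<^sub>\<Omega>" if h: "h \<in> {1..l}" for h
    unfolding *(3) \<sigma>_left(1)[OF e_car[OF subset_refl h]] \<sigma>_e[OF *(1) h] \<sigma>_e[OF *(2) h]
    by (intro Ms.subspace_add[OF subspace_F\<^sub>\<Omega>] Ms.subspace_sum[OF subspace_F\<^sub>\<Omega>] Ms.subspace_scale[OF subspace_F\<^sub>\<Omega>] e_F\<^sub>\<Omega>)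
  have "f \<in> car Ms \<and> \<sigma> x f \<in> F\<^sub>\<Omega>" using f[unfolded F\<^sub>\<Omega>_def]
  proof (induction rule: Ms.span_induct_alt)
    case base
    show ?case unfolding \<sigma>_0 using Ms.subspace_0[OF Ms.subspace_car] Ms.subspace_0[OF subspace_F\<^sub>\<Omega>] by blast
  next
    case (step c g f)
    have g: "g \<in> car Ms" "\<sigma> x g \<in> F\<^sub>\<Omega>" using step(1) e e_car[OF subset_refl] by blast+
    have "\<sigma> x (scl Ms c g + f) = scl Ms c (\<sigma> x g) + \<sigma> x f"
      using g(1) step(2) Ms.subspace_scale[OF Ms.subspace_car g(1)] by (simp only: \<sigma>_right simp_thms)
    then show ?case using g step(2)
      by (simp only: Ms.subspace_add[OF Ms.subspace_car] Ms.subspace_scale[OF Ms.subspace_car]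
        Ms.subspace_add[OF subspace_F\<^sub>\<Omega>] Ms.subspace_scale[OF subspace_F\<^sub>\<Omega>] simp_thms)
  qed
  then show ?thesis ..
qed

lemma lie_submodule_F\<^sub>\<Omega>: "lie_submodule (deg G 0) Ms F\<^sub>\<Omega>"
proof -
  have "F\<^sub>\<Omega> \<subseteq> Ms.span (\<Union>q. F\<^sub>\<Omega> \<inter> par Ms q)"
  proof -
    have "e \<Omega> h \<in> (\<Union>q. F\<^sub>\<Omega> \<inter> par Ms q)" if "h \<in> {1..l}" for h
      using e_conf_dual[OF subset_refl that] e_F\<^sub>\<Omega>[OF that] unfolding Ms_sel by blast
    then have "e \<Omega> ` {1..l} \<subseteq> (\<Union>q. F\<^sub>\<Omega> \<inter> par Ms q)" by blast
    then show ?thesis unfolding F\<^sub>\<Omega>_def by (rule Ms.span_mono)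
  qed
  moreover have "Ms.span (\<Union>q. F\<^sub>\<Omega> \<inter> par Ms q) \<subseteq> F\<^sub>\<Omega>"
    by (rule Ms.span_minimal[OF _ subspace_F\<^sub>\<Omega>]) blast
  ultimately show ?thesis
    unfolding lie_submodule_def Ms_sel(3)
    using subspace_F\<^sub>\<Omega> F\<^sub>\<Omega>_car \<sigma>_F\<^sub>\<Omega> by blast
qed

section \<open>The isomorphism with the shifted dual\<close>

abbreviation SD :: "('k, 'f \<Rightarrow> 'k, 'g) lie_mod" where
  "SD \<equiv> shifted_dual G \<chi> F l v pv"

abbreviation ev_top :: "('m \<Rightarrow> nat list \<Rightarrow> 'k) \<Rightarrow> nat \<Rightarrow> 'k" where
  "ev_top f h \<equiv> f (dI M \<iota> d v \<Omega> h) []"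

lemma e_ev_top: "h \<in> {1..l} \<Longrightarrow> k \<in> {1..l} \<Longrightarrow> ev_top (e \<Omega> h) k = (if h = k then 1 else 0)"
  using fun_cong[OF e_dI[OF subset_refl _ subset_refl, of h k], of "[]"] by (simp add: mon_Nil)

lemma F\<^sub>\<Omega>_expand: assumes "f \<in> F\<^sub>\<Omega>" shows "f = (\<Sum>h\<in>{1..l}. scl Ms (ev_top f h) (e \<Omega> h))"
proof -
  obtain c where c: "f = (\<Sum>h\<in>{1..l}. scl Ms (c h) (e \<Omega> h))"
    using Ms.span_indexed[OF assms[unfolded F\<^sub>\<Omega>_def]] by blast
  have "ev_top f k = c k" if k: "k \<in> {1..l}" for k
  proof -
    have "ev_top f k = (\<Sum>h\<in>{1..l}. c h * ev_top (e \<Omega> h) k)"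
      unfolding c Ms_sel by (simp add: sum_fun_apply)
    also have "\<dots> = (\<Sum>h\<in>{1..l}. if h = k then c k else 0)"
      by (rule sum.cong[OF refl]) (simp add: e_ev_top[OF _ k] del: One_nat_def)
    also have "\<dots> = c k" using k by simp
    finally show ?thesis .
  qed
  then have "(\<Sum>h\<in>{1..l}. scl Ms (ev_top f h) (e \<Omega> h)) = (\<Sum>h\<in>{1..l}. scl Ms (c h) (e \<Omega> h))"
    by (intro sum.cong refl) (simp only:)
  then show ?thesis using c by simp
qed

text \<open>The isomorphism has the parity of \<open>n\<close>; the sign \<open>\<plusminus>1\<close> on the \<open>h\<close>-th basis vector is forced
  by \<open>T (x m) = (-1)\<^bsup>p(x) p(T)\<^esup> x T m\<close>.\<close>
definition T :: "('m \<Rightarrow> nat list \<Rightarrow> 'k) \<Rightarrow> 'f \<Rightarrow> 'k" where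
  "T f = (\<Sum>h\<in>{1..l}. fsc (*) (ksgn (of_nat n * pv h) * ev_top f h) (coord F l v h))"

lemma T_apply: "T f w = (\<Sum>h\<in>{1..l}. ksgn (of_nat n * pv h) * ev_top f h * coord F l v h w)"
  by (simp add: T_def sum_fun_apply)

lemma linear_sum_coord: "Vector_Spaces.linear (scl F) (*) (\<lambda>w. \<Sum>h\<in>{1..l}. c h * coord F l v h w)"
proof -
  interpret k: vector_space "(*) :: 'k \<Rightarrow> 'k \<Rightarrow> 'k" by unfold_locales (simp_all add: algebra_simps)
  show ?thesis
  proof unfold_locales
    show "(\<Sum>h\<in>{1..l}. c h * coord F l v h (u + w)) = (\<Sum>h\<in>{1..l}. c h * coord F l v h u) + (\<Sum>h\<in>{1..l}. c h * coord F l v h w)" for u w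
      by (simp only: coord_add distrib_left sum.distrib)
    show "(\<Sum>h\<in>{1..l}. c h * coord F l v h (scl F a w)) = a * (\<Sum>h\<in>{1..l}. c h * coord F l v h w)" for a w
      by (simp only: coord_scale sum_distrib_left mult.left_commute)
  qed
qed

lemma linear_T: "Vector_Spaces.linear (scl F) (*) (T f)"
proof -
  have "T f = (\<lambda>w. \<Sum>h\<in>{1..l}. (ksgn (of_nat n * pv h) * ev_top f h) * coord F l v h w)"
    by (rule ext) (rule T_apply)
  then show ?thesis using linear_sum_coord[of "\<lambda>h. ksgn (of_nat n * pv h) * ev_top f h"] by (simp only:)
qed

lemma T_add: "T (f + g) = T f + T g"
  and T_scale: "T (scl Ms c f) = fsc (*) c (T f)"
  by (rule ext, simp add: T_apply Ms_sel distrib_left distrib_right sum.distrib)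
    (rule ext, simp add: T_apply Ms_sel sum_distrib_left mult_ac)

lemma T_sum: "T (sum f S) = (\<Sum>i\<in>S. T (f i))"
proof (induction S rule: infinite_finite_induct)
  case (insert x S)
  show ?case by (simp only: sum.insert[OF insert(1,2)] T_add insert.IH)
qed (simp_all add: T_def fun_eq_iff sum_fun_apply)

lemma T_e: assumes h: "h \<in> {1..l}" shows "T (e \<Omega> h) = fsc (*) (ksgn (of_nat n * pv h)) (coord F l v h)"
proof
  fix w
  have "T (e \<Omega> h) w = (\<Sum>k\<in>{1..l}. if k = h then ksgn (of_nat n * pv h) * coord F l v h w else 0)"
    unfolding T_apply by (rule sum.cong[OF refl]) (auto simp: e_ev_top[OF h] simp del: One_nat_def)
  then show "T (e \<Omega> h) w = fsc (*) (ksgn (of_nat n * pv h)) (coord F l v h) w" using h by simp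
qed

lemma T_v: assumes k: "k \<in> {1..l}" shows "T f (v k) = ksgn (of_nat n * pv k) * ev_top f k"
proof -
  have "T f (v k) = (\<Sum>h\<in>{1..l}. if h = k then ksgn (of_nat n * pv k) * ev_top f k else 0)"
    unfolding T_apply by (rule sum.cong[OF refl]) (auto simp: coord_basis[OF _ k])
  then show ?thesis using k by simp
qed

lemma linear_expand:
  assumes "Vector_Spaces.linear (scl F) (*) \<phi>" shows "\<phi> w = (\<Sum>h\<in>{1..l}. \<phi> (v h) * coord F l v h w)"
proof -
  interpret p: Vector_Spaces.linear "scl F" "(*)" \<phi> by fact
  have "\<phi> w = \<phi> (\<Sum>k\<in>{1..l}. scl F (coord F l v k w) (v k))" using F_rep by (rule arg_cong)
  then show ?thesis unfolding p.sum p.scale by (simp only: mult.commute)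
qed

lemma SD_sel: "car SD = {\<phi>. Vector_Spaces.linear (scl F) (*) \<phi>}" "scl SD = fsc (*)"
    "par SD q = {\<phi>. Vector_Spaces.linear (scl F) (*) \<phi> \<and> (\<forall>w\<in>par F (q + 1). \<phi> w = 0)}"
  by (simp_all add: shifted_dual_def Let_def)

lemma act_F_0: "act F 0 w = 0"
proof -
  have "0 \<in> fil G 0" by (rule fil0[OF G.subspace_0[OF subspace_deg]])
  then have "act F (scl G 0 0) w = scl F 0 (act F 0 w)"
    using F_module[unfolded lie_module_def, THEN conjunct2, THEN conjunct2, THEN conjunct1]
    unfolding lin_on_def car_F by blast
  then show ?thesis by simp
qed

lemma \<chi>_0: "\<chi> 0 = 0"
proof -
  have "\<chi> (scl G 0 0) = 0 * \<chi> 0"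
    using character_\<chi> G.subspace_0[OF subspace_deg] unfolding character_def lin_on_def by blast
  then show ?thesis by simp
qed

text \<open>The action is defined through both parity components of x; for homogeneous x one
  component is 0 and its contribution drops out.\<close>

lemma SD_act:
  assumes x: "x \<in> par G p"
  shows "act SD x \<phi> w = (\<Sum>h\<in>{1..l}. \<phi> (v h) * (\<Sum>k\<in>{1..l}. dual_coeff p x h k * coord F l v k w))"
proof -
  define A where "A = (\<lambda>p x h. fsc (*) (\<chi> x) (coord F l v h) - fsc (*) (ksgn (p * pv h))
                 (\<Sum>k\<in>{1..l}. fsc (*) (coord F l v h (act F x (v k))) (coord F l v k)))"
  have A: "A p x h w = (\<Sum>k\<in>{1..l}. dual_coeff p x h k * coord F l v k w)" if h: "h \<in> {1..l}" for p x h
  proof -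
    have "(\<Sum>k\<in>{1..l}. dual_coeff p x h k * coord F l v k w) =
      (\<Sum>k\<in>{1..l}. (if k = h then \<chi> x * coord F l v h w else 0) - ksgn (p * pv h) * (coord F l v h (act F x (v k)) * coord F l v k w))"
      by (rule sum.cong[OF refl]) (simp add: dual_coeff_def left_diff_distrib mult.assoc)
    also have "\<dots> = \<chi> x * coord F l v h w - ksgn (p * pv h) * (\<Sum>k\<in>{1..l}. coord F l v h (act F x (v k)) * coord F l v k w)"
      unfolding sum_subtractf sum_distrib_left using h by simp
    finally show ?thesis by (simp add: A_def sum_fun_apply)
  qed
  have A0: "A q 0 h = 0" for q h
  proof -
    have c0: "coord F l v h 0 = 0" using coord_scale[of h 0 0] by simp
    show ?thesis unfolding A_def by (rule ext) (simp add: \<chi>_0 act_F_0 c0 sum_fun_apply)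
  qed
  have "A 0 (hcomp G 0 x) h + A 1 (hcomp G 1 x) h = A p x h" for h
  proof (cases "p = 0")
    case True
    have "hcomp G 0 x = x" by (rule G.hcomp_same) (use x True in simp)
    moreover have "hcomp G 1 x = 0" by (rule G.hcomp_other) (use x True in simp)
    ultimately show ?thesis unfolding True by (simp only: A0 add_0_right)
  next
    case False
    then have p: "p = 1" using bit_eq_1_iff by blast
    have "hcomp G 1 x = x" by (rule G.hcomp_same) (use x p in simp)
    moreover have "hcomp G 0 x = 0" by (rule G.hcomp_other) (use x p in simp)
    ultimately show ?thesis unfolding p by (simp only: A0 add_0_left)
  qed
  then have "act SD x \<phi> = (\<Sum>h\<in>{1..l}. fsc (*) (\<phi> (v h)) (A p x h))"
    unfolding shifted_dual_def Let_def A_def[symmetric] by simp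
  then show ?thesis by (simp add: sum_fun_apply A)
qed

lemma coord_parity:
  assumes h: "h \<in> {1..l}" and w: "w \<in> par F q" and nz: "coord F l v h w \<noteq> 0" shows "pv h = q"
proof (rule ccontr)
  assume ne: "pv h \<noteq> q"
  have B: "v ` {1..l} \<subseteq> par F 0 \<union> par F 1"
  proof
    fix u assume "u \<in> v ` {1..l}"
    then obtain k where "u \<in> par F (pv k)" using v_par by blast
    then show "u \<in> par F 0 \<union> par F 1" by (cases "pv k") simp_all
  qed
  have "v h \<in> par F q"
    by (rule F.representation_parity[OF B F_basis_facts(2) _ w]) (use nz F_basis_facts(3) in \<open>auto simp: coord_def\<close>)
  then have "v h = 0" using F.par_disjoint[OF _ _ ne] v_par h by blast
  moreover have "v h \<in> v ` {1..l}" using h by (rule imageI)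
  ultimately show False using F.dependent_zero F_basis_facts(2) by metis
qed

lemma act_F_par: "x \<in> deg G 0 \<inter> par G p \<Longrightarrow> w \<in> par F q \<Longrightarrow> act F x w \<in> par F (p + q)"
  using F_module[unfolded lie_module_def, THEN conjunct2, THEN conjunct2, THEN conjunct2, THEN conjunct1] fil0 by blast

text \<open>Each term forces the relation: the action on F shifts parities by \<open>p\<close>, and
  the character vanishes on odd elements. The signs in \<open>T\<close> need to be compared only for
  nonzero coefficients.\<close>

lemma dual_coeff_parity:
  assumes x: "x \<in> deg G 0 \<inter> par G p" and h: "h \<in> {1..l}" and k: "k \<in> {1..l}" and nz: "dual_coeff p x h k \<noteq> 0"
  shows "pv h = p + pv k"
proof (cases "coord F l v h (act F x (v k)) = 0")
  case False
  then show ?thesis using coord_parity[OF h act_F_par[OF x]] v_par k by blast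
next
  case True
  then have *: "\<chi> x \<noteq> 0" "k = h" using nz unfolding dual_coeff_def by (auto split: if_splits)
  then have "p \<noteq> 1" using \<chi>_odd x by blast
  then have "p = 0" using bit_eq_1_iff by blast
  then show ?thesis using * by simp
qed

lemma T_intertwines_e:
  assumes x: "x \<in> deg G 0 \<inter> par G p" and h: "h \<in> {1..l}"
  shows "T (\<sigma> x (e \<Omega> h)) = fsc (*) (ksgn (p * of_nat n)) (act SD x (T (e \<Omega> h)))"
proof
  fix w
  have xp: "x \<in> par G p" using x by blast
  have "act SD x (T (e \<Omega> h)) w = (\<Sum>h'\<in>{1..l}. if h' = h then ksgn (of_nat n * pv h) * (\<Sum>k\<in>{1..l}. dual_coeff p x h k * coord F l v k w) else 0)"
    unfolding SD_act[OF xp] by (rule sum.cong[OF refl]) (auto simp: T_v e_ev_top[OF h] simp del: One_nat_def)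
  also have "\<dots> = ksgn (of_nat n * pv h) * (\<Sum>k\<in>{1..l}. dual_coeff p x h k * coord F l v k w)"
    using h by simp
  finally have r: "act SD x (T (e \<Omega> h)) w = ksgn (of_nat n * pv h) * (\<Sum>k\<in>{1..l}. dual_coeff p x h k * coord F l v k w)" .
  have "T (\<sigma> x (e \<Omega> h)) w = (\<Sum>k\<in>{1..l}. dual_coeff p x h k * (ksgn (of_nat n * pv k) * coord F l v k w))"
    unfolding \<sigma>_e[OF x h] T_sum T_scale sum_fun_apply by (rule sum.cong[OF refl]) (simp add: T_e del: One_nat_def)
  also have "\<dots> = (\<Sum>k\<in>{1..l}. ksgn (p * of_nat n) * (ksgn (of_nat n * pv h) * (dual_coeff p x h k * coord F l v k w)))"
  proof (rule sum.cong[OF refl])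
    fix k assume k: "k \<in> {1..l}"
    show "dual_coeff p x h k * (ksgn (of_nat n * pv k) * coord F l v k w) =
      ksgn (p * of_nat n) * (ksgn (of_nat n * pv h) * (dual_coeff p x h k * coord F l v k w))"
    proof (cases "dual_coeff p x h k = 0")
      case False
      \<comment> \<open>The parity relation turns the sign of \<open>T\<close> at \<open>h\<close>
        into its sign at \<open>k\<close> times the Koszul sign for moving \<open>x\<close> past
        \<open>T\<close>.\<close>
      have "of_nat n * pv h = p * of_nat n + of_nat n * pv k"
        unfolding dual_coeff_parity[OF x h k False] distrib_left by (simp only: mult.commute)
      then have "ksgn (p * of_nat n) * ksgn (of_nat n * pv h) = (ksgn (of_nat n * pv k) :: 'k)"
        by (simp only: ksgn_add mult.assoc[symmetric] ksgn_mult_self mult_1_left)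
      then have "ksgn (p * of_nat n) * (ksgn (of_nat n * pv h) * u) = (ksgn (of_nat n * pv k) * u :: 'k)" for u
        by (simp only: mult.assoc[symmetric])
      then show ?thesis by (simp only: mult.left_commute)
    qed simp
  qed
  also have "\<dots> = fsc (*) (ksgn (p * of_nat n)) (act SD x (T (e \<Omega> h))) w"
    unfolding fsc_apply r sum_distrib_left ..
  finally show "T (\<sigma> x (e \<Omega> h)) w = fsc (*) (ksgn (p * of_nat n)) (act SD x (T (e \<Omega> h))) w" .
qed

lemma T_intertwines:
  assumes x: "x \<in> deg G 0 \<inter> par G p" and f: "f \<in> F\<^sub>\<Omega>"
  shows "T (\<sigma> x f) = fsc (*) (ksgn (p * of_nat n)) (act SD x (T f))"
proof -
  have xp: "x \<in> par G p" using x by blast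
  have lin: "act SD x (fsc (*) c \<phi> + \<psi>) = fsc (*) c (act SD x \<phi>) + act SD x \<psi>" for c \<phi> \<psi>
    by (rule ext) (simp add: SD_act[OF xp] distrib_right sum.distrib sum_distrib_left mult.assoc)
  have "f \<in> car Ms \<and> T (\<sigma> x f) = fsc (*) (ksgn (p * of_nat n)) (act SD x (T f))"
    using f[unfolded F\<^sub>\<Omega>_def]
  proof (induction rule: Ms.span_induct_alt)
    case base
    have T0: "T 0 = 0" using T_sum[of _ "{}"] by (simp only: sum.empty)
    have "act SD x 0 = 0" by (rule ext) (simp add: SD_act[OF xp])
    then have "T (\<sigma> x 0) = fsc (*) (ksgn (p * of_nat n)) (act SD x (T 0))"
      unfolding \<sigma>_0 T0 by (intro ext) simp
    then show ?case using Ms.subspace_0[OF Ms.subspace_car] by blast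
  next
    case (step c g f)
    then obtain h where h: "h \<in> {1..l}" "g = e \<Omega> h" by blast
    have g: "g \<in> car Ms" unfolding h(2) by (rule e_car[OF subset_refl h(1)])
    note cg = Ms.subspace_scale[OF Ms.subspace_car g, of c]
    have fc: "f \<in> car Ms" using step(2) ..
    have "T (\<sigma> x (scl Ms c g + f)) = fsc (*) c (T (\<sigma> x g)) + T (\<sigma> x f)"
      unfolding \<sigma>_right(1)[OF cg fc] \<sigma>_right(2)[OF g] T_add T_scale ..
    also have "\<dots> = fsc (*) c (fsc (*) (ksgn (p * of_nat n)) (act SD x (T g))) + fsc (*) (ksgn (p * of_nat n)) (act SD x (T f))"
      using T_intertwines_e[OF x h(1)] step(2) unfolding h(2) by (simp only:)
    also have "\<dots> = fsc (*) (ksgn (p * of_nat n)) (act SD x (T (scl Ms c g + f)))"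
      unfolding T_add T_scale lin by (rule ext) (simp add: distrib_left mult.left_commute)
    finally show ?case using Ms.subspace_add[OF Ms.subspace_car cg fc] by blast
  qed
  then show ?thesis ..
qed

lemma T_par:
  assumes f: "f \<in> par Ms q \<inter> F\<^sub>\<Omega>" shows "T f \<in> par SD (q + of_nat n)"
proof -
  have fd: "f \<in> conf_dual r s dd M q" using f unfolding Ms_sel by blast
  have "T f w = 0" if w: "w \<in> par F (q + of_nat n + 1)" for w
    unfolding T_apply
  proof (rule sum.neutral, rule ballI, rule ccontr)
    fix h assume h: "h \<in> {1..l}" and nz: "ksgn (of_nat n * pv h) * ev_top f h * coord F l v h w \<noteq> 0"
    \<comment> \<open>The constant monomial is even, so a nonzero constant term ties the parity of
      \<open>f\<close> to \<open>n\<close> plus the parity of \<open>v h\<close>.\<close>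
    have "lpar vp [] = of_nat (card \<Omega>) + pv h + q"
      by (rule conf_dualD(6)[OF fd dI_par[OF subset_refl h]]) (use nz in auto)
    then have 0: "of_nat n + pv h + q = (0::bit)" by simp
    have "pv h = q + of_nat n + 1" using coord_parity[OF h w] nz by auto
    then have "of_nat n + (q + of_nat n + 1) + q = (0::bit)" using 0 by (simp only:)
    then show False by (cases q; cases "of_nat n :: bit") simp_all
  qed
  then show ?thesis unfolding SD_sel using linear_T by blast
qed

text \<open>The signs square to one, so the inverse map carries the same signs.\<close>

lemma bij_T: "bij_betw T F\<^sub>\<Omega> (car SD)"
proof (rule bij_betw_byWitness[where f' = "\<lambda>\<phi>. \<Sum>h\<in>{1..l}. scl Ms (ksgn (of_nat n * pv h) * \<phi> (v h)) (e \<Omega> h)"])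
  have sq: "ksgn b * (ksgn b * u) = (u::'k)" for b u by (simp only: mult.assoc[symmetric] ksgn_mult_self mult_1_left)
  show "\<forall>f\<in>F\<^sub>\<Omega>. (\<Sum>h\<in>{1..l}. scl Ms (ksgn (of_nat n * pv h) * T f (v h)) (e \<Omega> h)) = f"
  proof
    fix f assume f: "f \<in> F\<^sub>\<Omega>"
    have "(\<Sum>h\<in>{1..l}. scl Ms (ksgn (of_nat n * pv h) * T f (v h)) (e \<Omega> h)) = (\<Sum>h\<in>{1..l}. scl Ms (ev_top f h) (e \<Omega> h))"
      by (rule sum.cong[OF refl]) (simp only: T_v sq)
    then show "(\<Sum>h\<in>{1..l}. scl Ms (ksgn (of_nat n * pv h) * T f (v h)) (e \<Omega> h)) = f"
      by (rule trans[OF _ F\<^sub>\<Omega>_expand[OF f, symmetric]])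
  qed
  show "\<forall>\<phi>\<in>car SD. T (\<Sum>h\<in>{1..l}. scl Ms (ksgn (of_nat n * pv h) * \<phi> (v h)) (e \<Omega> h)) = \<phi>"
  proof
    fix \<phi> assume "\<phi> \<in> car SD"
    then have \<phi>: "Vector_Spaces.linear (scl F) (*) \<phi>" unfolding SD_sel by blast
    show "T (\<Sum>h\<in>{1..l}. scl Ms (ksgn (of_nat n * pv h) * \<phi> (v h)) (e \<Omega> h)) = \<phi>"
    proof
      fix w
      have "T (\<Sum>h\<in>{1..l}. scl Ms (ksgn (of_nat n * pv h) * \<phi> (v h)) (e \<Omega> h)) w = (\<Sum>h\<in>{1..l}. \<phi> (v h) * coord F l v h w)"
        unfolding T_sum T_scale sum_fun_apply
      proof (rule sum.cong[OF refl])
        fix h assume "h \<in> {1..l}"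
        have "ksgn (of_nat n * pv h) * \<phi> (v h) * (ksgn (of_nat n * pv h) * coord F l v h w) =
          ksgn (of_nat n * pv h) * (ksgn (of_nat n * pv h) * (\<phi> (v h) * coord F l v h w))" by (simp only: mult_ac)
        then show "fsc (*) (ksgn (of_nat n * pv h) * \<phi> (v h)) (T (e \<Omega> h)) w = \<phi> (v h) * coord F l v h w"
          unfolding T_e[OF \<open>h \<in> {1..l}\<close>] fsc_apply by (simp only: sq)
      qed
      also have "\<dots> = \<phi> w" by (rule linear_expand[OF \<phi>, symmetric])
      finally show "T (\<Sum>h\<in>{1..l}. scl Ms (ksgn (of_nat n * pv h) * \<phi> (v h)) (e \<Omega> h)) w = \<phi> w" .
    qed
  qed
  show "T ` F\<^sub>\<Omega> \<subseteq> car SD" unfolding SD_sel using linear_T by blast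
  show "(\<lambda>\<phi>. \<Sum>h\<in>{1..l}. scl Ms (ksgn (of_nat n * pv h) * \<phi> (v h)) (e \<Omega> h)) ` car SD \<subseteq> F\<^sub>\<Omega>"
    by (intro image_subsetI Ms.subspace_sum[OF subspace_F\<^sub>\<Omega>] Ms.subspace_scale[OF subspace_F\<^sub>\<Omega>] e_F\<^sub>\<Omega>)
qed

lemma lie_isomorphic_F\<^sub>\<Omega>: "lie_isomorphic G (deg G 0) (sub_mod Ms F\<^sub>\<Omega>) SD"
proof -
  have sub: "car (sub_mod Ms F\<^sub>\<Omega>) = F\<^sub>\<Omega>" "scl (sub_mod Ms F\<^sub>\<Omega>) = scl Ms"
    "par (sub_mod Ms F\<^sub>\<Omega>) q = par Ms q \<inter> F\<^sub>\<Omega>" "act (sub_mod Ms F\<^sub>\<Omega>) = \<sigma>" for q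
    by (simp_all add: sub_mod_def Ms_sel(3))
  have 1: "lin_on F\<^sub>\<Omega> (scl Ms) (scl SD) T" unfolding lin_on_def SD_sel using T_add T_scale by blast
  have 2: "\<forall>q. T ` (par Ms q \<inter> F\<^sub>\<Omega>) \<subseteq> par SD (q + of_nat n)" using T_par by blast
  have 3: "\<forall>p. \<forall>x\<in>deg G 0 \<inter> par G p. \<forall>f\<in>F\<^sub>\<Omega>. T (\<sigma> x f) = scl SD (ksgn (p * of_nat n)) (act SD x (T f))"
    unfolding SD_sel(2) using T_intertwines by blast
  show ?thesis
    unfolding lie_isomorphic_def sub
    by (rule exI[of _ "of_nat n"], rule exI[of _ T]) (intro conjI 1 bij_T 2 3)
qed

end

theorem theorem3p15:
  fixes r s n l :: nat
    and R :: "('k::{alg_closed_field,field_char_0}, 'a::ab_group_add) lie_conf"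
    and gr :: "int \<Rightarrow> 'a set"
    and A :: "('k, 'b::ab_group_add) lie_super"
    and \<pi> :: "(nat list \<Rightarrow> 'a) \<Rightarrow> 'b"
    and G :: "('k, 'g::ab_group_add) lie_super"
    and \<rho> :: "('b \<Rightarrow> 'b) \<Rightarrow> 'b \<Rightarrow> 'g"
    and F :: "('k, 'f::ab_group_add, 'g) lie_mod"
    and v :: "nat \<Rightarrow> 'f" and pv :: "nat \<Rightarrow> bit"
    and d :: "nat \<Rightarrow> 'g"
    and M :: "('k, 'm::ab_group_add, 'g) lie_mod"
    and \<iota> :: "'f \<Rightarrow> 'm"
    and \<sigma> :: "'g \<Rightarrow> ('m \<Rightarrow> nat list \<Rightarrow> 'k) \<Rightarrow> 'm \<Rightarrow> nat list \<Rightarrow> 'k"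
    and e :: "nat set \<Rightarrow> nat \<Rightarrow> 'm \<Rightarrow> nat list \<Rightarrow> 'k"
    and cl :: "(nat list \<Rightarrow> 'a) \<Rightarrow> 'g" and dd :: "nat \<Rightarrow> 'g"
    and Ms :: "('k, 'm \<Rightarrow> nat list \<Rightarrow> 'k, 'g) lie_mod"
    and F\<^sub>\<Omega> :: "('m \<Rightarrow> nat list \<Rightarrow> 'k) set"
    and \<chi> :: "'g \<Rightarrow> 'k"
  assumes "lie_conformal_superalgebra r s R"
    and "graded_conformal r s R gr"
    and "annihilation_algebra r s R gr A \<pi>"
    and "cond_depth A" and "cond_odd A" and "cond_ad r s R A \<pi>"
    and "g_algebra r s R A \<pi> G \<rho>"
    and cl_def: "cl = (\<lambda>\<phi>. \<rho> 0 (\<pi> \<phi>))" and dd_def: "dd = (\<lambda>i. \<rho> (dyA r s R \<pi> i) 0)"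
    and "lie_module G (fil G 0) F" and "\<forall>x\<in>fil G 1. \<forall>w. act F x w = 0" and "car F = UNIV"
    and "basis_of (scl F) UNIV l v" and "\<forall>h\<in>{1..l}. v h \<in> par F (pv h)"
    and "basis_of (scl G) (module.span (scl G) (deg G (- 1) \<union> deg G (- 3))) n d"
    and "induced_module G (fil G 0) F M \<iota>"
    and "dual_action r s R G cl dd M \<sigma>" and Ms_def: "Ms = dual_mod r s dd M \<sigma>"
    and "dual_basis r s dd M \<iota> n d l v e"
    and F\<^sub>\<Omega>_def: "F\<^sub>\<Omega> = module.span (scl Ms) (e {1..n} ` {1..l})"
    and \<chi>_def: "\<chi> = (\<lambda>x. supertrace G (neg_part G) (brk G x))"
  shows "lie_submodule (deg G 0) Ms F\<^sub>\<Omega> \<and>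
    character G (deg G 0) \<chi> \<and>
    lie_isomorphic G (deg G 0) (sub_mod Ms F\<^sub>\<Omega>) (shifted_dual G \<chi> F l v pv)"
proof -
  interpret D: conformal_dual r s R gr A \<pi> G \<rho> cl dd n l F v pv d M \<iota> \<sigma> e Ms
    by unfold_locales (fact assms)+
  have eqs: "F\<^sub>\<Omega> = D.F\<^sub>\<Omega>" "\<chi> = D.\<chi>"
    unfolding F\<^sub>\<Omega>_def \<chi>_def D.F\<^sub>\<Omega>_def D.\<chi>_def by (rule refl)+
  show ?thesis
    unfolding eqs using D.lie_submodule_F\<^sub>\<Omega> D.character_\<chi> D.lie_isomorphic_F\<^sub>\<Omega> by blast
qed

end
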